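(* Let $C_1,C_2\in\mathbb{C}$ be constants, not both zero, let $\varphi(z)=C_1\operatorname{Ai}(-2^{-1/3}z)+C_2\operatorname{Bi}(-2^{-1/3}z)$, $\tau_0(z)=1$ and $\tau_n(z)=\det\left(\frac{d^{j+k}}{dz^{j+k}}\varphi(z)\right)_{j,k=0,\ldots,n-1}$ for $n\ge1$. For $n\ge 1$ define $$\sigma_n(z)=\frac{d}{dz}\log\tau_n(z),\qquad p_n(z)=-2\frac{d^2}{dz^2}\log\tau_n(z),\qquad q_n(z)=\frac{d}{dz}\log\frac{\tau_{n-1}(z)}{\tau_n(z)}.$$ Then for every $n\ge1$: 1. If $C_2\neq0$, as $|z|\to\infty$ with $|\arg(-z)|<\frac\pi3$, $$\sigma_n(z)=-\frac{n(-z)^{1/2}}{\sqrt2}-\frac{n^2}{4z}+\frac{\sqrt2\,n(4n^2+1)}{32(-z)^{5/2}}+\mathcal{O}\big((-z)^{-4}\big),$$ $$p_n(z)=-\frac{n}{\sqrt2(-z)^{1/2}}-\frac{n^2}{2z^2}-\frac{5n(4n^2+1)\sqrt2}{32(-z)^{7/2}}+\mathcal{O}\big((-z)^{-5}\big),$$ $$q_n(z)=\frac{(-z)^{1/2}}{\sqrt2}+\frac{2n-1}{4z}-\frac{\sqrt2(12n^2-12n+5)}{32(-z)^{5/2}}+\mathcal{O}\big((-z)^{-4}\big).$$ 2. If $C_2=0$, as $|z|\to\infty$ with $|\arg(-z)|<\pi$, $$\sigma_n(z)=\frac{n(-z)^{1/2}}{\sqrt2}-\frac{n^2}{4z}-\frac{\sqrt2\,n(4n^2+1)}{32(-z)^{5/2}}+\mathcal{O}\big((-z)^{-4}\big),$$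 $$p_n(z)=\frac{n}{\sqrt2(-z)^{1/2}}-\frac{n^2}{2z^2}+\frac{5n(4n^2+1)\sqrt2}{32(-z)^{7/2}}+\mathcal{O}\big((-z)^{-5}\big),$$ $$q_n(z)=-\frac{(-z)^{1/2}}{\sqrt2}+\frac{2n-1}{4z}+\frac{\sqrt2(12n^2-12n+5)}{32(-z)^{5/2}}+\mathcal{O}\big((-z)^{-4}\big).$$
   Context: $\operatorname{Ai}$ and $\operatorname{Bi}$ are the standard Airy functions. All powers of $-z$ are principal branches, with $\arg(-z)\in(-\pi,\pi)$. Asymptotic statements "as $|z|\to\infty$ with $|\arg(-z)|<\theta_0$" are understood uniformly in every closed subsector $|\arg(-z)|\le\theta_0-\varepsilon$, $\varepsilon>0$. *)

theory Defs
  imports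
    "HOL-Complex_Analysis.Complex_Analysis"
    "HOL-Library.Landau_Symbols"
    "Jordan_Normal_Form.Determinant"
begin

text \<open>
  The Airy functions are defined by their Maclaurin series (DLMF 9.4.1, 9.4.3, 9.2.3--9.2.6).
  \<open>airy_f\<close> and \<open>airy_g\<close> are the entire solutions of \<open>w'' = z * w\<close> with
  \<open>(w 0, w' 0) = (1, 0)\<close> and \<open>(0, 1)\<close>; note that \<open>3 ^ k * pochhammer (1/3) k = 1 * 4 * \<dots> * (3 * k - 2)\<close>
  and \<open>3 ^ k * pochhammer (2/3) k = 2 * 5 * \<dots> * (3 * k - 1)\<close>.
\<close>

definition airy_f :: "complex \<Rightarrow> complex" where
  "airy_f z = (\<Sum>k. 3 ^ k * pochhammer (1/3) k / fact (3 * k) * z ^ (3 * k))"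

definition airy_g :: "complex \<Rightarrow> complex" where
  "airy_g z = (\<Sum>k. 3 ^ k * pochhammer (2/3) k / fact (3 * k + 1) * z ^ (3 * k + 1))"

definition Ai :: "complex \<Rightarrow> complex" where
  "Ai z = of_real (1 / (3 powr (2/3) * Gamma (2/3))) * airy_f z
        - of_real (1 / (3 powr (1/3) * Gamma (1/3))) * airy_g z"

definition Bi :: "complex \<Rightarrow> complex" where
  "Bi z = of_real (1 / (3 powr (1/6) * Gamma (2/3))) * airy_f z
        + of_real (3 powr (1/6) / Gamma (1/3)) * airy_g z"

definition phi :: "complex \<Rightarrow> complex \<Rightarrow> complex \<Rightarrow> complex" where
  "phi C1 C2 z = C1 * Ai (- of_real (2 powr (-1/3)) * z) + C2 * Bi (- of_real (2 powr (-1/3)) * z)"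

definition tau_n :: "complex \<Rightarrow> complex \<Rightarrow> nat \<Rightarrow> complex \<Rightarrow> complex" where
  "tau_n C1 C2 n z =
     (if n = 0 then 1
      else Determinant.det (Matrix.mat n n (\<lambda>(j, k). (deriv ^^ (j + k)) (phi C1 C2) z)))"

text \<open>
  \<open>logderiv f\<close> is the derivative of \<open>log f\<close>. A global logarithm need not exist, but
  wherever \<open>f \<noteq> 0\<close> every local holomorphic branch of \<open>log f\<close> has the derivative \<open>f' / f\<close>,
  as the two lemmas below state for the first and second derivatives. At a zero of \<open>f\<close> the value is \<open>0\<close>
  because of division by zero.
\<close>

definition logderiv :: "(complex \<Rightarrow> complex) \<Rightarrow> complex \<Rightarrow> complex" where
  "logderiv f z = deriv f z / f z"

lemma deriv_log_branch:
  assumes "open U" "z \<in> U" "L holomorphic_on U" "\<And>w. w \<in> U \<Longrightarrow> exp (L w) = f w"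
  shows "deriv L z = logderiv f z"
proof -
  have "(L has_field_derivative deriv L z) (at z)"
    using assms(1-3) holomorphic_derivI by blast
  then have "((\<lambda>w. exp (L w)) has_field_derivative exp (L z) * deriv L z) (at z)"
    by (auto intro!: derivative_eq_intros)
  then have "(f has_field_derivative f z * deriv L z) (at z)"
    using has_field_derivative_transform_within_open[OF _ assms(1,2), of _ _ f] assms(2,4) by fastforce
  then have "deriv f z = f z * deriv L z"
    by (rule DERIV_imp_deriv)
  moreover have "f z \<noteq> 0"
    using assms(2,4) exp_not_eq_zero by metis
  ultimately show ?thesis
    by (simp add: logderiv_def)
qed

lemma deriv2_log_branch:
  assumes "open U" "z \<in> U" "L holomorphic_on U" "\<And>w. w \<in> U \<Longrightarrow> exp (L w) = f w"
  shows "deriv (deriv L) z = deriv (logderiv f) z"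
proof (rule deriv_cong_ev)
  show "\<forall>\<^sub>F w in nhds z. deriv L w = logderiv f w"
    using eventually_nhds_in_open[OF assms(1,2)]
    by eventually_elim (rule deriv_log_branch[OF assms(1) _ assms(3,4)])
qed simp

definition sigma_n :: "complex \<Rightarrow> complex \<Rightarrow> nat \<Rightarrow> complex \<Rightarrow> complex" where
  "sigma_n C1 C2 n = logderiv (tau_n C1 C2 n)"

definition p_n :: "complex \<Rightarrow> complex \<Rightarrow> nat \<Rightarrow> complex \<Rightarrow> complex" where
  "p_n C1 C2 n z = - 2 * deriv (logderiv (tau_n C1 C2 n)) z"

text \<open>Only meant for \<open>n \<ge> 1\<close> (truncated subtraction).\<close>

definition q_n :: "complex \<Rightarrow> complex \<Rightarrow> nat \<Rightarrow> complex \<Rightarrow> complex" where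
  "q_n C1 C2 n = logderiv (\<lambda>z. tau_n C1 C2 (n - 1) z / tau_n C1 C2 n z)"

text \<open>
  \<open>sector_expansion \<theta>\<^sub>0 f g h\<close>: \<open>f z = g z + O(h z)\<close> as \<open>|z| \<rightarrow> \<infinity>\<close> with \<open>|arg (-z)| < \<theta>\<^sub>0\<close>, uniformly in
  every closed subsector \<open>|arg (-z)| \<le> \<theta>\<^sub>0 - \<epsilon>\<close>. The powers \<open>(-z) powr a\<close> used with it are principal,
  since \<open>powr\<close> on \<open>complex\<close> is defined through \<open>Ln\<close>.
\<close>

definition sector_expansion ::
    "real \<Rightarrow> (complex \<Rightarrow> complex) \<Rightarrow> (complex \<Rightarrow> complex) \<Rightarrow> (complex \<Rightarrow> complex) \<Rightarrow> bool" where
  "sector_expansion \<theta>\<^sub>0 f g h \<longleftrightarrow>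
     (\<forall>\<epsilon>>0. (\<lambda>z. f z - g z) \<in> O[inf at_infinity (principal {z. \<bar>Arg (- z)\<bar> \<le> \<theta>\<^sub>0 - \<epsilon>})](h))"

end

theory Submission
  imports Defs "HOL-Probability.Distributions" "HOL-Real_Asymp.Real_Asymp"
begin

text \<open>
  Write \<open>x = - z\<close>. The Toda equation \<open>(log \<tau>\<^sub>n)'' = \<tau>\<^sub>n\<^sub>+\<^sub>1 \<tau>\<^sub>n\<^sub>-\<^sub>1 / \<tau>\<^sub>n\<^sup>2\<close> turns into the recursion
  \<open>\<sigma>\<^sub>n\<^sub>+\<^sub>1 = 2 \<sigma>\<^sub>n - \<sigma>\<^sub>n\<^sub>-\<^sub>1 + \<sigma>\<^sub>n'' / \<sigma>\<^sub>n'\<close>. Its only nonlinear term is a logarithmic derivative, so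
  no precision is lost and an expansion of \<open>\<sigma>\<^sub>1 = \<phi>' / \<phi>\<close> with error \<open>O(x\<^sup>-\<^sup>4)\<close> propagates to
  every \<open>n\<close>; error terms may be differentiated because they are holomorphic (Cauchy's inequality).

  For \<open>\<sigma>\<^sub>1\<close> the Riccati equation \<open>\<sigma>' + \<sigma>\<^sup>2 = x / 2\<close> produces the expansion from the leading order
  alone. The leading order comes from
  \<open>Ai y = e\<^sup>-\<^sup>\<zeta> / (2 \<pi>) \<integral> exp (- k s\<^sup>2 - i s\<^sup>3 / 3) ds\<close> with \<open>k = y\<^sup>1\<^sup>/\<^sup>2\<close> and \<open>\<zeta> = 2/3 k\<^sup>3\<close>, an integral that converges
  on the whole slit plane. If \<open>C\<^sub>2 \<noteq> 0\<close>, the solution \<open>\<phi>\<close> is a combination of \<open>Ai y\<close> and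
  \<open>Ai (e\<^sup>2\<^sup>\<pi>\<^sup>i\<^sup>/\<^sup>3 y)\<close>, in which the second one occurs and dominates for \<open>|arg y| < \<pi>/3\<close>.
\<close>

section \<open>Expansions in sectors\<close>

text \<open>The exponents 1/2, -1, -5/2, -4 descend in steps of 3/2, so an error of order -4 means
  that three coefficients have to be tracked. A direct expansion of the determinant is hampered by
  cancellation: to leading order its matrix has rank one. The recursion avoids this, but it divides
  by sigma_n' and yields tau_n only once the determinant formula is available. Both needs are met by
  the expansion itself: the leading coefficient of sigma_n' is -n a / 2 with a^2 = 1/2, hence
  nonzero far out in every smaller sector, and tau_n is then a product of nonzero factors there. The
  parameter a treats both cases at once: 1/sqrt 2 for the recessive solution, -1/sqrt 2 for the
  dominant one. A second obstacle is that Ai is given by a Maclaurin series, from which no decay can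
  be read off. It is tied to the integral by two facts on the positive axis: Ai is bounded there and
  \<open>airy_f\<close> is not. The angle pi/3 has two sources: the rotated argument must stay in
  the slit plane, and exp (-2 zeta) must decay.\<close>

definition sector_at_infinity :: "real \<Rightarrow> complex filter" where
  "sector_at_infinity \<theta> = inf at_infinity (principal {z. \<bar>Arg (- z)\<bar> < \<theta>})"

text \<open>Real exponents make the modulus exactly |z|^a in every direction, so estimates need no
  factor depending on the argument. Differentiation in z brings a minus sign, because x =
  -z.\<close>

definition mpow :: "real \<Rightarrow> complex \<Rightarrow> complex" where
  "mpow a z = (- z) powr of_real a"

lemma eventually_sector_iff:
  "eventually P (sector_at_infinity \<theta>) \<longleftrightarrow> (\<exists>R>0. \<forall>z. \<bar>Arg (- z)\<bar> < \<theta> \<longrightarrow> norm z > R \<longrightarrow> P z)"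
proof
  assume "eventually P (sector_at_infinity \<theta>)"
  then obtain b where b: "\<And>z. b \<le> norm z \<Longrightarrow> \<bar>Arg (- z)\<bar> < \<theta> \<Longrightarrow> P z"
    by (auto simp: sector_at_infinity_def eventually_inf_principal eventually_at_infinity)
  show "\<exists>R>0. \<forall>z. \<bar>Arg (- z)\<bar> < \<theta> \<longrightarrow> norm z > R \<longrightarrow> P z"
    by (rule exI[of _ "max b 1"]) (auto intro: b)
next
  assume "\<exists>R>0. \<forall>z. \<bar>Arg (- z)\<bar> < \<theta> \<longrightarrow> norm z > R \<longrightarrow> P z"
  then obtain R where R: "R > 0" "\<And>z. \<bar>Arg (- z)\<bar> < \<theta> \<Longrightarrow> norm z > R \<Longrightarrow> P z" by blast
  show "eventually P (sector_at_infinity \<theta>)"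
    unfolding sector_at_infinity_def eventually_inf_principal eventually_at_infinity
    by (rule exI[of _ "R + 1"]) (auto intro: R(2))
qed

lemma eventually_sector_norm: "eventually (\<lambda>z. norm z > r) (sector_at_infinity \<theta>)"
  unfolding eventually_sector_iff by (rule exI[of _ "max r 1"]) auto

lemma eventually_sector_nonzero: "eventually (\<lambda>z. z \<noteq> 0) (sector_at_infinity \<theta>)"
  using eventually_sector_norm[of 0] by eventually_elim auto

lemma eventually_sector_arg: "eventually (\<lambda>z. \<bar>Arg (- z)\<bar> < \<theta>) (sector_at_infinity \<theta>)"
  by (auto simp: sector_at_infinity_def eventually_inf_principal)

lemma not_nonpos_Reals_Arg: "\<bar>Arg z\<bar> < pi \<Longrightarrow> z \<noteq> 0 \<Longrightarrow> z \<notin> \<real>\<^sub>\<le>\<^sub>0"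
  using Arg_eq_pi_iff[of z] by (auto simp: complex_nonpos_Reals_iff complex_is_Real_iff complex_eq_iff)

lemma norm_mpow: "z \<noteq> 0 \<Longrightarrow> norm (mpow a z) = norm z powr a"
  by (simp add: mpow_def norm_powr_real_powr')

lemma mpow_mult: "mpow a z * mpow b z = mpow (a + b) z"
  by (simp add: mpow_def powr_add)

lemma mpow_eq_0_iff [simp]: "mpow a z = 0 \<longleftrightarrow> z = 0"
  by (simp add: mpow_def)

lemma mpow_1: "mpow 1 z = - z"
  by (simp add: mpow_def)

lemma mpow_0: "z \<noteq> 0 \<Longrightarrow> mpow 0 z = 1"
  by (simp add: mpow_def)

lemma has_field_derivative_mpow:
  assumes "- z \<notin> \<real>\<^sub>\<le>\<^sub>0"
  shows "(mpow a has_field_derivative - of_real a * mpow (a - 1) z) (at z)"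
proof -
  have "((\<lambda>z. (- z) powr of_real a) has_field_derivative - of_real a * mpow (a - 1) z) (at z)"
    using assms unfolding mpow_def
    by (auto intro!: derivative_eq_intros simp: powr_diff field_simps)
  then show ?thesis
    unfolding mpow_def[abs_def] .
qed

section \<open>Geometry of sectors\<close>

definition sector :: "real \<Rightarrow> real \<Rightarrow> complex set" where
  "sector \<theta> R = {z. \<bar>Arg (- z)\<bar> < \<theta> \<and> norm z > R}"

text \<open>\<open>R \<ge> 0\<close> removes the origin, where \<open>Arg\<close> has the default
  value 0; \<open>\<theta> \<le> pi\<close> with the strict inequality removes the cut. On what
  remains \<open>Arg\<close> is continuous.\<close>

lemma open_sector:
  assumes "\<theta> \<le> pi" "R \<ge> 0"
  shows "open (sector \<theta> R)"
proof -
  have "sector \<theta> R = uminus -` {z. z \<notin> \<real>\<^sub>\<le>\<^sub>0 \<and> \<bar>Arg z\<bar> < \<theta>} \<inter> {z. norm z > R}"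
  proof (rule Set.set_eqI)
    fix z
    show "z \<in> sector \<theta> R \<longleftrightarrow> z \<in> uminus -` {z. z \<notin> \<real>\<^sub>\<le>\<^sub>0 \<and> \<bar>Arg z\<bar> < \<theta>} \<inter> {z. norm z > R}"
      using assms not_nonpos_Reals_Arg[of "- z"] by (cases "z = 0") (auto simp: sector_def)
  qed
  moreover have "open {z. z \<notin> \<real>\<^sub>\<le>\<^sub>0 \<and> \<bar>Arg z\<bar> < \<theta>}"
  proof -
    have "continuous_on (- \<real>\<^sub>\<le>\<^sub>0) (\<lambda>z. \<bar>Arg z\<bar>)"
      by (intro continuous_on_rabs continuous_at_imp_continuous_on ballI continuous_at_Arg) auto
    then have "open ((\<lambda>z. \<bar>Arg z\<bar>) -` {..<\<theta>} \<inter> - \<real>\<^sub>\<le>\<^sub>0)"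
      by (subst (asm) continuous_on_open_vimage) (auto simp: open_Compl)
    moreover have "(\<lambda>z. \<bar>Arg z\<bar>) -` {..<\<theta>} \<inter> - \<real>\<^sub>\<le>\<^sub>0 = {z. z \<notin> \<real>\<^sub>\<le>\<^sub>0 \<and> \<bar>Arg z\<bar> < \<theta>}"
      by auto
    ultimately show ?thesis by simp
  qed
  moreover have "open {z::complex. norm z > R}"
    by (intro open_Collect_less continuous_intros)
  ultimately show ?thesis
    by (simp only:) (intro open_Int open_vimage continuous_intros)
qed

text \<open>By homogeneity a disc around z may have radius proportional to |z|: write w = z v with v
  near 1, so that Arg(-w) = Arg(-z) + Arg v. Discs of this size make a derivative gain a full power
  of z in Cauchy's inequality.\<close>

lemma sector_ball_subset:
  assumes "\<theta> < \<theta>'" "\<theta>' \<le> pi"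
  obtains \<delta> where "\<delta> > 0" "\<delta> < 1"
    "\<And>z w R. z \<in> sector \<theta> (2 * R) \<Longrightarrow> R > 0 \<Longrightarrow> dist z w \<le> \<delta> * norm z \<Longrightarrow> w \<in> sector \<theta>' R"
proof -
  have "continuous (at 1) Arg" by (rule continuous_at_Arg) simp
  moreover have "\<theta>' - \<theta> > 0" using assms by simp
  ultimately obtain d where d: "d > 0" "\<And>w. norm (w - 1) < d \<Longrightarrow> \<bar>Arg w\<bar> < \<theta>' - \<theta>"
    unfolding continuous_at_eps_delta dist_norm by (metis Arg_1 diff_zero real_norm_def diff_gt_0_iff_gt)
  \<comment> \<open>The bound 1/2 gives |v| \<ge> 1/2, whence radius \<open>2 * R\<close> for z and
    \<open>R\<close> for w; halving d yields the strict inequality required by continuity.\<close>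
  define \<delta> where "\<delta> = min (d/2) (1/2)"
  have "w \<in> sector \<theta>' R" if z: "z \<in> sector \<theta> (2 * R)" and R: "R > 0" and w: "dist z w \<le> \<delta> * norm z" for z w R
  proof -
    have z0: "z \<noteq> 0" "norm z > 2 * R" "\<bar>Arg (- z)\<bar> < \<theta>" using z R by (auto simp: sector_def)
    define v where "v = w / z"
    have wv: "w = z * v" using z0 by (simp add: v_def)
    have "norm (v - 1) = dist z w / norm z"
      using z0 by (simp add: v_def dist_norm norm_minus_commute diff_divide_distrib flip: norm_divide)
    also have "\<dots> \<le> \<delta>" using w z0 by (simp add: divide_simps)
    finally have v: "norm (v - 1) \<le> \<delta>" .
    have Av: "\<bar>Arg v\<bar> < \<theta>' - \<theta>" using d v by (auto simp: \<delta>_def)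
    have "norm v \<ge> 1 / 2"
      using norm_triangle_ineq2[of 1 "1 - v"] v by (simp add: norm_minus_commute \<delta>_def)
    then have "norm z * (1 / 2) \<le> norm w" unfolding wv norm_mult by (intro mult_left_mono) auto
    then have "norm w > R" using z0 by simp
    moreover have "v \<noteq> 0" using \<open>norm v \<ge> 1 / 2\<close> by auto
    then have "Arg (- w) = Arg (- z) + Arg v"
      unfolding wv using z0 Av assms by (subst Arg_times[of "- z" v, simplified]) auto
    ultimately show ?thesis using z0 Av by (auto simp: sector_def)
  qed
  then show ?thesis using that[of \<delta>] d by (auto simp: \<delta>_def)
qed

text \<open>
  The class contains differentiability besides the bound, so that it is closed under \<open>deriv\<close>
  at the cost of shrinking the sector, which the quantifier over \<open>\<theta> < \<theta>\<^sub>0\<close> absorbs.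
\<close>

definition hO :: "real \<Rightarrow> real \<Rightarrow> (complex \<Rightarrow> complex) set" where
  "hO \<theta>\<^sub>0 a = {f. \<forall>\<theta><\<theta>\<^sub>0. (\<forall>\<^sub>F z in sector_at_infinity \<theta>. f field_differentiable at z)
      \<and> f \<in> O[sector_at_infinity \<theta>](mpow a)}"

text \<open>The threshold for |z| may depend on the smaller angle and may grow without bound as it
  approaches the limit angle; this is uniformity in closed subsectors.\<close>

definition eventually_sectors :: "real \<Rightarrow> (complex \<Rightarrow> bool) \<Rightarrow> bool" where
  "eventually_sectors \<theta>\<^sub>0 P \<longleftrightarrow> (\<forall>\<theta><\<theta>\<^sub>0. eventually P (sector_at_infinity \<theta>))"

lemma eventually_sectors_mono:
  "eventually_sectors \<theta>\<^sub>0 P \<Longrightarrow> (\<And>z. P z \<Longrightarrow> Q z) \<Longrightarrow> eventually_sectors \<theta>\<^sub>0 Q"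
  unfolding eventually_sectors_def using eventually_mono[of P _ Q] by blast

lemma eventually_sectors_conj:
  "eventually_sectors \<theta>\<^sub>0 P \<Longrightarrow> eventually_sectors \<theta>\<^sub>0 Q \<Longrightarrow> eventually_sectors \<theta>\<^sub>0 (\<lambda>z. P z \<and> Q z)"
  unfolding eventually_sectors_def by (auto intro: eventually_conj)

lemma hO_differentiable: "f \<in> hO \<theta>\<^sub>0 a \<Longrightarrow> eventually_sectors \<theta>\<^sub>0 (\<lambda>z. f field_differentiable at z)"
  by (auto simp: hO_def eventually_sectors_def)

lemma eventually_sectors_slit:
  assumes "\<theta>\<^sub>0 \<le> pi"
  shows "eventually_sectors \<theta>\<^sub>0 (\<lambda>z. z \<noteq> 0 \<and> - z \<notin> \<real>\<^sub>\<le>\<^sub>0)"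
  unfolding eventually_sectors_def
proof (intro allI impI)
  fix \<theta> assume "\<theta> < \<theta>\<^sub>0"
  then have "\<theta> < pi" using assms by simp
  show "\<forall>\<^sub>F z in sector_at_infinity \<theta>. z \<noteq> 0 \<and> - z \<notin> \<real>\<^sub>\<le>\<^sub>0"
    using eventually_sector_nonzero[of \<theta>] eventually_sector_arg[of \<theta>]
  proof eventually_elim
    case (elim z)
    then show ?case using not_nonpos_Reals_Arg[of "- z"] \<open>\<theta> < pi\<close> by auto
  qed
qed

text \<open>Sectors are open, so an identity valid far out holds near each point there and may be
  differentiated.\<close>

lemma eventually_sectors_nhds:
  assumes "\<theta>\<^sub>0 \<le> pi" "eventually_sectors \<theta>\<^sub>0 P"
  shows "eventually_sectors \<theta>\<^sub>0 (\<lambda>z. eventually P (nhds z))"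
  unfolding eventually_sectors_def
proof (intro allI impI)
  fix \<theta> assume th: "\<theta> < \<theta>\<^sub>0"
  then obtain R where R: "R > 0" "\<And>z. z \<in> sector \<theta> R \<Longrightarrow> P z"
    using assms(2) by (auto simp: eventually_sectors_def eventually_sector_iff sector_def)
  have "open (sector \<theta> R)" using th assms R by (intro open_sector) auto
  then have "\<forall>z. \<bar>Arg (- z)\<bar> < \<theta> \<longrightarrow> norm z > R \<longrightarrow> eventually P (nhds z)"
    using R(2) unfolding eventually_nhds by (auto simp: sector_def)
  then show "\<forall>\<^sub>F z in sector_at_infinity \<theta>. eventually P (nhds z)"
    using R(1) unfolding eventually_sector_iff by auto
qed

lemma eventually_sectors_elim:
  "eventually_sectors \<theta>\<^sub>0 P \<Longrightarrow> eventually_sectors \<theta>\<^sub>0 Q \<Longrightarrow> (\<And>z. P z \<Longrightarrow> Q z \<Longrightarrow> S z) \<Longrightarrow> eventually_sectors \<theta>\<^sub>0 S"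
  using eventually_sectors_mono[OF eventually_sectors_conj, of \<theta>\<^sub>0 P Q S] by blast

lemma hO_iff: "f \<in> hO \<theta>\<^sub>0 a \<longleftrightarrow> eventually_sectors \<theta>\<^sub>0 (\<lambda>z. f field_differentiable at z)
    \<and> (\<forall>\<theta><\<theta>\<^sub>0. f \<in> O[sector_at_infinity \<theta>](mpow a))"
  by (auto simp: hO_def eventually_sectors_def)

section \<open>Closure of the error classes under algebra and differentiation\<close>

lemma hO_add: "f \<in> hO \<theta>\<^sub>0 a \<Longrightarrow> g \<in> hO \<theta>\<^sub>0 a \<Longrightarrow> (\<lambda>z. f z + g z) \<in> hO \<theta>\<^sub>0 a"
  unfolding hO_iff
  using eventually_sectors_elim[of \<theta>\<^sub>0 "\<lambda>z. f field_differentiable at z" "\<lambda>z. g field_differentiable at z"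
      "\<lambda>z. (\<lambda>z. f z + g z) field_differentiable at z"]
  by (auto intro: sum_in_bigo field_differentiable_add)

lemma hO_diff: "f \<in> hO \<theta>\<^sub>0 a \<Longrightarrow> g \<in> hO \<theta>\<^sub>0 a \<Longrightarrow> (\<lambda>z. f z - g z) \<in> hO \<theta>\<^sub>0 a"
  unfolding hO_iff
  using eventually_sectors_elim[of \<theta>\<^sub>0 "\<lambda>z. f field_differentiable at z" "\<lambda>z. g field_differentiable at z"
      "\<lambda>z. (\<lambda>z. f z - g z) field_differentiable at z"]
  by (auto intro: sum_in_bigo field_differentiable_diff)

lemma hO_cmult: "f \<in> hO \<theta>\<^sub>0 a \<Longrightarrow> (\<lambda>z. c * f z) \<in> hO \<theta>\<^sub>0 a"
  unfolding hO_iff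
  by (auto elim!: eventually_sectors_mono intro!: field_differentiable_mult field_differentiable_const)

lemma hO_mult:
  assumes "f \<in> hO \<theta>\<^sub>0 a" "g \<in> hO \<theta>\<^sub>0 b"
  shows "(\<lambda>z. f z * g z) \<in> hO \<theta>\<^sub>0 (a + b)"
proof -
  have "(\<lambda>z. f z * g z) \<in> O[sector_at_infinity \<theta>](mpow (a + b))" if "\<theta> < \<theta>\<^sub>0" for \<theta>
  proof -
    have "(\<lambda>z. f z * g z) \<in> O[sector_at_infinity \<theta>](\<lambda>z. mpow a z * mpow b z)"
      using assms that by (intro landau_o.big.mult) (auto simp: hO_def)
    then show ?thesis by (simp add: mpow_mult)
  qed
  then show ?thesis
    using assms eventually_sectors_elim[of \<theta>\<^sub>0 "\<lambda>z. f field_differentiable at z"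
        "\<lambda>z. g field_differentiable at z" "\<lambda>z. (\<lambda>z. f z * g z) field_differentiable at z"]
    unfolding hO_iff by (auto intro: field_differentiable_mult)
qed

lemma hO_mono:
  assumes "f \<in> hO \<theta>\<^sub>0 a" "a \<le> b"
  shows "f \<in> hO \<theta>\<^sub>0 b"
proof -
  have "mpow a \<in> O[sector_at_infinity \<theta>](mpow b)" for \<theta>
  proof (rule bigoI[of _ 1])
    show "\<forall>\<^sub>F z in sector_at_infinity \<theta>. norm (mpow a z) \<le> 1 * norm (mpow b z)"
      using eventually_sector_norm[of 1] eventually_sector_nonzero
      by eventually_elim (use assms(2) in \<open>auto simp: norm_mpow intro!: powr_mono\<close>)
  qed
  then show ?thesis
    using assms(1) unfolding hO_def by (auto intro: landau_o.big.trans)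
qed

lemma hO_cong:
  assumes "\<theta>\<^sub>0 \<le> pi" "f \<in> hO \<theta>\<^sub>0 a" "eventually_sectors \<theta>\<^sub>0 (\<lambda>z. f z = g z)"
  shows "g \<in> hO \<theta>\<^sub>0 a"
  unfolding hO_def
proof (intro CollectI allI impI conjI)
  fix \<theta> assume th: "\<theta> < \<theta>\<^sub>0"
  have "\<forall>\<^sub>F z in sector_at_infinity \<theta>. \<forall>\<^sub>F w in nhds z. f w = g w"
    using eventually_sectors_nhds[OF assms(1,3)] th by (auto simp: eventually_sectors_def)
  moreover have "\<forall>\<^sub>F z in sector_at_infinity \<theta>. f field_differentiable at z"
    using assms(2) th by (auto simp: hO_def)
  ultimately show "\<forall>\<^sub>F z in sector_at_infinity \<theta>. g field_differentiable at z"
  proof eventually_elim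
    case (elim z)
    then show ?case
      unfolding field_differentiable_def using DERIV_cong_ev[OF refl elim(1) refl] by auto
  qed
  have "\<forall>\<^sub>F z in sector_at_infinity \<theta>. f z = g z"
    using assms(3) th by (auto simp: eventually_sectors_def)
  then show "g \<in> O[sector_at_infinity \<theta>](mpow a)"
    using assms(2) th landau_o.big.in_cong[of f g "sector_at_infinity \<theta>" "mpow a"] by (simp add: hO_def)
qed

lemma hO_mpow: "\<theta>\<^sub>0 \<le> pi \<Longrightarrow> mpow a \<in> hO \<theta>\<^sub>0 a"
  unfolding hO_iff field_differentiable_def
  by (auto intro!: eventually_sectors_mono[OF eventually_sectors_slit] exI has_field_derivative_mpow)

lemma hO_const:
  assumes "\<theta>\<^sub>0 \<le> pi"
  shows "(\<lambda>z. c) \<in> hO \<theta>\<^sub>0 0"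
  \<comment> \<open>\<open>mpow 0\<close> is 1 except at the origin, where it is 0.\<close>
  by (rule hO_cong[OF assms hO_cmult[OF hO_mpow[OF assms], of c 0]])
     (rule eventually_sectors_mono[OF eventually_sectors_slit[OF assms]], simp add: mpow_0)

text \<open>Cauchy's inequality on the circle of radius \<delta> |z|, which lies in a slightly
  larger sector where the bound is still available. On it |w| is comparable to |z|, and division by
  the radius lowers the exponent by one.\<close>

lemma hO_deriv:
  assumes "\<theta>\<^sub>0 \<le> pi" "f \<in> hO \<theta>\<^sub>0 a"
  shows "deriv f \<in> hO \<theta>\<^sub>0 (a - 1)"
  unfolding hO_def
proof (intro CollectI allI impI conjI)
  fix \<theta> assume th: "\<theta> < \<theta>\<^sub>0"
  define \<theta>' where "\<theta>' = (\<theta> + \<theta>\<^sub>0) / 2"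
  have th': "\<theta> < \<theta>'" "\<theta>' < \<theta>\<^sub>0" "\<theta>' \<le> pi" using th assms(1) by (auto simp: \<theta>'_def)
  obtain c where c: "c > 0" "\<forall>\<^sub>F z in sector_at_infinity \<theta>'. norm (f z) \<le> c * norm (mpow a z)"
    using assms(2) th' by (auto simp: hO_def elim: landau_o.bigE)
  have "\<forall>\<^sub>F z in sector_at_infinity \<theta>'. f field_differentiable at z"
    using assms(2) th' by (auto simp: hO_def)
  with c(2) have "\<forall>\<^sub>F z in sector_at_infinity \<theta>'. norm (f z) \<le> c * norm (mpow a z) \<and> f field_differentiable at z"
    by eventually_elim auto
  then obtain R where R: "R > 0" "\<And>z. z \<in> sector \<theta>' R \<Longrightarrow> norm (f z) \<le> c * norm (mpow a z)"
     "\<And>z. z \<in> sector \<theta>' R \<Longrightarrow> f field_differentiable at z"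
    by (auto simp: eventually_sector_iff sector_def)
  have hol: "f holomorphic_on sector \<theta>' R"
    using R(3) by (auto simp: holomorphic_on_def intro: field_differentiable_at_within)
  have op: "open (sector \<theta>' R)" using th' R by (intro open_sector) auto
  obtain \<delta> where \<delta>: "\<delta> > 0" "\<delta> < 1"
    "\<And>z w R. z \<in> sector \<theta> (2 * R) \<Longrightarrow> R > 0 \<Longrightarrow> dist z w \<le> \<delta> * norm z \<Longrightarrow> w \<in> sector \<theta>' R"
    using sector_ball_subset[OF th'(1,3)] by metis
  have ev: "\<forall>\<^sub>F z in sector_at_infinity \<theta>. z \<in> sector \<theta> (2 * R)"
    using eventually_sector_arg[of \<theta>] eventually_sector_norm[of "2 * R" \<theta>]
    by eventually_elim (auto simp: sector_def)
  show "\<forall>\<^sub>F z in sector_at_infinity \<theta>. deriv f field_differentiable at z"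
    using ev
  proof eventually_elim
    case (elim z)
    then have "z \<in> sector \<theta>' R" using \<delta>(3)[of z R z] R(1) \<delta>(1) by auto
    then show ?case
      using holomorphic_deriv[OF hol op] op holomorphic_on_imp_differentiable_at by blast
  qed
  \<comment> \<open>On the circle |w| lies between (1 - \<delta>) |z| and (1 + \<delta>) |z|; which
    end maximizes |w|^a depends on the sign of a, and the maximum serves both.\<close>
  define M where "M = max ((1 - \<delta>) powr a) ((1 + \<delta>) powr a)"
  have "M > 0" using \<delta> by (auto simp: M_def less_max_iff_disj)
  show "deriv f \<in> O[sector_at_infinity \<theta>](mpow (a - 1))"
  proof (rule bigoI)
    show "\<forall>\<^sub>F z in sector_at_infinity \<theta>. norm (deriv f z) \<le> c * M / \<delta> * norm (mpow (a - 1) z)"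
      using ev
    proof eventually_elim
      case (elim z)
      then have z: "z \<noteq> 0" "norm z > 0" using R(1) by (auto simp: sector_def)
      have sub: "cball z (\<delta> * norm z) \<subseteq> sector \<theta>' R"
        using \<delta>(3)[OF elim R(1)] by auto
      have bnd: "norm (f w) \<le> c * (M * norm z powr a)" if "norm (w - z) = \<delta> * norm z" for w
      proof -
        have wz: "w \<in> sector \<theta>' R" using sub that by (auto simp: dist_norm norm_minus_commute)
        then have "w \<noteq> 0" using R(1) by (auto simp: sector_def)
        have lo: "(1 - \<delta>) * norm z \<le> norm w"
          using norm_triangle_ineq2[of z "z - w"] that by (simp add: norm_minus_commute algebra_simps)
        have hi: "norm w \<le> (1 + \<delta>) * norm z"
          using norm_triangle_ineq[of z "w - z"] that by (simp add: algebra_simps)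
        have "norm w powr a \<le> M * norm z powr a"
        proof (cases "a \<ge> 0")
          case True
          have "norm w powr a \<le> ((1 + \<delta>) * norm z) powr a"
            using hi True by (intro powr_mono2) auto
          also have "\<dots> = (1 + \<delta>) powr a * norm z powr a" using \<delta> by (simp add: powr_mult)
          also have "\<dots> \<le> M * norm z powr a" by (intro mult_right_mono) (auto simp: M_def)
          finally show ?thesis .
        next
          case False
          have "norm w powr a \<le> ((1 - \<delta>) * norm z) powr a"
            using lo False \<delta> z by (intro powr_mono2') auto
          also have "\<dots> = (1 - \<delta>) powr a * norm z powr a" using \<delta> by (simp add: powr_mult)
          also have "\<dots> \<le> M * norm z powr a" by (intro mult_right_mono) (auto simp: M_def)
          finally show ?thesis .
        qed
        then have "c * norm w powr a \<le> c * (M * norm z powr a)" using c by (intro mult_left_mono) auto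
        then show ?thesis using R(2)[OF wz] \<open>w \<noteq> 0\<close> by (simp add: norm_mpow)
      qed
      have "norm ((deriv ^^ 1) f z) \<le> fact 1 * (c * (M * norm z powr a)) / (\<delta> * norm z) ^ 1"
      proof (rule Cauchy_inequality)
        show "f holomorphic_on ball z (\<delta> * norm z)"
          using hol sub ball_subset_cball by (meson holomorphic_on_subset order_trans)
        show "continuous_on (cball z (\<delta> * norm z)) f"
          using hol sub holomorphic_on_imp_continuous_on continuous_on_subset by metis
      qed (use \<delta> z bnd in \<open>auto simp: norm_minus_commute\<close>)
      also have "\<dots> = c * M / \<delta> * norm (mpow (a - 1) z)"
        using z by (simp add: norm_mpow powr_diff field_simps)
      finally show ?case by simp
    qed
  qed
qed

lemma hO_tendsto_0:
  assumes "f \<in> hO \<theta>\<^sub>0 a" "a < 0" "\<theta> < \<theta>\<^sub>0" "e > 0"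
  shows "\<forall>\<^sub>F z in sector_at_infinity \<theta>. norm (f z) < e"
proof -
  obtain c where c: "c > 0" "\<forall>\<^sub>F z in sector_at_infinity \<theta>. norm (f z) \<le> c * norm (mpow a z)"
    using assms by (auto simp: hO_def elim: landau_o.bigE)
  show ?thesis
    using c(2) eventually_sector_norm[of "max 1 ((e / c) powr (1 / a))"] eventually_sector_nonzero
  proof eventually_elim
    case (elim z)
    then have "norm z powr a < ((e / c) powr (1 / a)) powr a"
      using assms c by (intro powr_less_mono2_neg) auto
    also have "\<dots> = e / c" using assms c by (simp add: powr_powr)
    finally have "c * norm z powr a < e" using c by (simp add: field_simps)
    then show ?case using elim by (simp add: norm_mpow)
  qed
qed

text \<open>Far out |f| is at least half of |c|. The constant c disappears from the numerator of the
  logarithmic derivative, so only f - c is differentiated and the order drops to a - 1.\<close>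

lemma
  assumes th: "\<theta>\<^sub>0 \<le> pi" and f: "(\<lambda>z. f z - c) \<in> hO \<theta>\<^sub>0 a" and "a < 0" "c \<noteq> 0"
  shows hO_nonzero: "eventually_sectors \<theta>\<^sub>0 (\<lambda>z. f z \<noteq> 0)"
    and hO_inverse: "(\<lambda>z. inverse (f z)) \<in> hO \<theta>\<^sub>0 0"
    and hO_logderiv: "logderiv f \<in> hO \<theta>\<^sub>0 (a - 1)"
proof -
  have ev: "\<forall>\<^sub>F z in sector_at_infinity \<theta>. norm (f z) \<ge> norm c / 2" if "\<theta> < \<theta>\<^sub>0" for \<theta>
  proof -
    have "norm c / 2 > 0" using \<open>c \<noteq> 0\<close> by simp
    from hO_tendsto_0[OF f \<open>a < 0\<close> that this] show ?thesis
  proof eventually_elim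
    case (elim z)
    then show ?case using norm_triangle_ineq2[of c "c - f z"] by (simp add: norm_minus_commute)
  qed
  qed
  show nz: "eventually_sectors \<theta>\<^sub>0 (\<lambda>z. f z \<noteq> 0)"
    unfolding eventually_sectors_def using \<open>c \<noteq> 0\<close>
    by (auto intro!: eventually_mono[OF ev])
  have "f field_differentiable at z" if "(\<lambda>z. f z - c) field_differentiable at z" for z
    using field_differentiable_add[OF that field_differentiable_const[of c]] by simp
  then have fd: "eventually_sectors \<theta>\<^sub>0 (\<lambda>z. f field_differentiable at z)"
    by (rule eventually_sectors_mono[OF hO_differentiable[OF f]])
  show inv: "(\<lambda>z. inverse (f z)) \<in> hO \<theta>\<^sub>0 0"
    unfolding hO_def
  proof (intro CollectI allI impI conjI)
    fix \<theta> assume t: "\<theta> < \<theta>\<^sub>0"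
    have "\<forall>\<^sub>F z in sector_at_infinity \<theta>. f z \<noteq> 0" "\<forall>\<^sub>F z in sector_at_infinity \<theta>. f field_differentiable at z"
      using nz fd t by (auto simp: eventually_sectors_def)
    then show "\<forall>\<^sub>F z in sector_at_infinity \<theta>. (\<lambda>z. inverse (f z)) field_differentiable at z"
      by eventually_elim (auto intro: field_differentiable_inverse)
    show "(\<lambda>z. inverse (f z)) \<in> O[sector_at_infinity \<theta>](mpow 0)"
    proof (rule bigoI)
      show "\<forall>\<^sub>F z in sector_at_infinity \<theta>. norm (inverse (f z)) \<le> 2 / norm c * norm (mpow 0 z)"
        using ev[OF t] eventually_sector_nonzero
      proof eventually_elim
        case (elim z)
        moreover have "norm c > 0" using \<open>c \<noteq> 0\<close> by simp
        ultimately have "norm (f z) > 0" by linarith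
        then show ?case using elim \<open>norm c > 0\<close> unfolding norm_inverse by (simp add: mpow_0 divide_simps)
      qed
    qed
  qed
  have "(\<lambda>z. deriv (\<lambda>z. f z - c) z * inverse (f z)) \<in> hO \<theta>\<^sub>0 (a - 1 + 0)"
    by (intro hO_mult hO_deriv th f inv)
  moreover have "eventually_sectors \<theta>\<^sub>0 (\<lambda>z. deriv (\<lambda>z. f z - c) z * inverse (f z) = logderiv f z)"
    by (rule eventually_sectors_mono[OF fd]) (simp add: logderiv_def field_simps)
  ultimately show "logderiv f \<in> hO \<theta>\<^sub>0 (a - 1)"
    using hO_cong[OF th, of _ "a - 1" "logderiv f"] by simp
qed

text \<open>Giving up \<epsilon>/2 places the closed subsector inside an open one whose angle is
  still below the limit angle.\<close>

lemma hO_imp_sector_expansion: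
  assumes "(\<lambda>z. f z - g z) \<in> hO \<theta>\<^sub>0 a"
  shows "sector_expansion \<theta>\<^sub>0 f g (mpow a)"
  unfolding sector_expansion_def
proof (intro allI impI)
  fix \<epsilon> :: real assume "\<epsilon> > 0"
  then have "(\<lambda>z. f z - g z) \<in> O[sector_at_infinity (\<theta>\<^sub>0 - \<epsilon> / 2)](mpow a)"
    using assms by (auto simp: hO_def)
  moreover have "inf at_infinity (principal {z. \<bar>Arg (- z)\<bar> \<le> \<theta>\<^sub>0 - \<epsilon>}) \<le> sector_at_infinity (\<theta>\<^sub>0 - \<epsilon> / 2)"
    unfolding sector_at_infinity_def using \<open>\<epsilon> > 0\<close> by (intro inf_mono) auto
  ultimately show "(\<lambda>z. f z - g z) \<in> O[inf at_infinity (principal {z. \<bar>Arg (- z)\<bar> \<le> \<theta>\<^sub>0 - \<epsilon>})](mpow a)"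
    using landau_o.big.filter_mono by blast
qed

section \<open>Hankel determinants and the Toda recursion\<close>

text \<open>
  The unit lower triangular factor \<open>L\<close> of the Hankel matrix \<open>L D L\<^sup>T\<close> whose moments have the
  Jacobi continued fraction coefficients \<open>s\<close> and \<open>r\<close>.
\<close>

primrec stieltjes_mat :: "(nat \<Rightarrow> 'a::comm_ring_1) \<Rightarrow> (nat \<Rightarrow> 'a) \<Rightarrow> nat \<Rightarrow> nat \<Rightarrow> 'a" where
  "stieltjes_mat s r 0 = (\<lambda>j. if j = 0 then 1 else 0)"
| "stieltjes_mat s r (Suc m) = (\<lambda>j. (if j = 0 then 0 else stieltjes_mat s r m (j - 1))
     + s j * stieltjes_mat s r m j + r (Suc j) * stieltjes_mat s r m (Suc j))"

lemma stieltjes_mat_upper: "m < j \<Longrightarrow> stieltjes_mat s r m j = 0"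
  by (induction m arbitrary: j) auto

lemma stieltjes_mat_diag: "stieltjes_mat s r m m = 1"
  by (induction m) (auto simp: stieltjes_mat_upper)

text \<open>The rows arise by iterating a tridiagonal operator, and
  \<open>h (Suc j) = h j * r (Suc j)\<close> says that it is symmetric for the weights h. So one
  step after another can be moved from the first row to the second, until the first is row 0. The
  condition on K keeps the cut-off beyond the support of both rows.\<close>

lemma stieltjes_mat_hankel:
  assumes h: "\<And>j. h (Suc j) = h j * r (Suc j)" and "m + l \<le> K"
  shows "(\<Sum>j\<le>K. stieltjes_mat s r m j * h j * stieltjes_mat s r l j) = h 0 * stieltjes_mat s r (m + l) 0"
  using assms(2)
proof (induction m arbitrary: l)
  case 0
  have "(\<Sum>j\<le>K. stieltjes_mat s r 0 j * h j * stieltjes_mat s r l j)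
      = (\<Sum>j\<le>K. if j = 0 then h 0 * stieltjes_mat s r l 0 else 0)"
    by (rule sum.cong) auto
  then show ?case by simp
next
  case (Suc m)
  obtain K' where K: "K = Suc K'" using Suc.prems by (cases K) auto
  define a where "a = stieltjes_mat s r m"
  define b where "b = stieltjes_mat s r l"
  have a0: "a (Suc K) = 0" and b0: "b (Suc K) = 0"
    using Suc.prems by (auto simp: a_def b_def stieltjes_mat_upper)
  \<comment> \<open>Exchanging c and d swaps the first and the third sum and fixes the middle one;
    this is the symmetry.\<close>
  have shift: "(\<Sum>j\<le>K. ((if j = 0 then 0 else c (j - 1)) + s j * c j + r (Suc j) * c (Suc j)) * h j * d j)
     = (\<Sum>j\<le>K'. c j * h (Suc j) * d (Suc j)) + (\<Sum>j\<le>K. s j * c j * h j * d j)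
       + (\<Sum>j\<le>K'. c (Suc j) * h (Suc j) * d j)"
    if "c (Suc K) = 0" for c d :: "nat \<Rightarrow> 'a"
  proof -
    have "(\<Sum>j\<le>K. (if j = 0 then 0 else c (j - 1)) * h j * d j) = (\<Sum>j\<le>K'. c j * h (Suc j) * d (Suc j))"
      unfolding K by (subst sum.atMost_Suc_shift) simp
    moreover have "(\<Sum>j\<le>K. r (Suc j) * c (Suc j) * h j * d j) = (\<Sum>j\<le>K'. c (Suc j) * h (Suc j) * d j)"
      using that by (simp add: K h mult_ac)
    ultimately show ?thesis
      by (simp add: distrib_right sum.distrib)
  qed
  have "(\<Sum>j\<le>K. stieltjes_mat s r (Suc m) j * h j * b j) = (\<Sum>j\<le>K. stieltjes_mat s r (Suc l) j * h j * a j)"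
    unfolding stieltjes_mat.simps a_def[symmetric] b_def[symmetric]
    by (subst shift[of a b, OF a0], subst shift[of b a, OF b0]) (simp add: mult_ac add_ac)
  also have "\<dots> = (\<Sum>j\<le>K. a j * h j * stieltjes_mat s r (Suc l) j)"
    by (simp add: mult_ac)
  also have "\<dots> = h 0 * stieltjes_mat s r (m + Suc l) 0"
    unfolding a_def by (rule Suc.IH) (use Suc.prems in simp)
  finally show ?case by (simp add: b_def)
qed

lemma det_hankel_stieltjes:
  fixes h :: "nat \<Rightarrow> complex"
  assumes h: "\<And>j. h (Suc j) = h j * r (Suc j)"
  shows "Determinant.det (Matrix.mat n n (\<lambda>(j, k). h 0 * stieltjes_mat s r (j + k) 0)) = (\<Prod>j<n. h j)"
proof -
  define A where "A = Matrix.mat n n (\<lambda>(j, k). stieltjes_mat s r j k)"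
  define D where "D = Matrix.mat n n (\<lambda>(j, k). if j = k then h j else 0)"
  have [simp]: "A \<in> carrier_mat n n" "D \<in> carrier_mat n n"
    by (auto simp: A_def D_def)
  have AD: "A * D = Matrix.mat n n (\<lambda>(j, k). stieltjes_mat s r j k * h k)"
    by (rule eq_matI) (auto simp: A_def D_def scalar_prod_def if_distrib[of "\<lambda>x. _ * x"] cong: if_cong)
  have "Matrix.mat n n (\<lambda>(j, k). h 0 * stieltjes_mat s r (j + k) 0) = A * D * transpose_mat A"
  proof (rule eq_matI)
    fix i j assume "i < dim_row (A * D * transpose_mat A)" "j < dim_col (A * D * transpose_mat A)"
    then have ij: "i < n" "j < n" by (auto simp: A_def)
    have "(A * D * transpose_mat A) $$ (i, j)
        = (\<Sum>k\<in>{0..<n}. stieltjes_mat s r i k * h k * stieltjes_mat s r j k)"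
      using ij unfolding AD by (simp add: A_def scalar_prod_def)
    \<comment> \<open>The range is extended by zero entries, so that its upper end is at least i +
      j.\<close>
    also have "\<dots> = (\<Sum>k\<le>2*n. stieltjes_mat s r i k * h k * stieltjes_mat s r j k)"
      using ij by (intro sum.mono_neutral_left) (auto simp: stieltjes_mat_upper)
    also have "\<dots> = h 0 * stieltjes_mat s r (i + j) 0"
      by (rule stieltjes_mat_hankel[where h = h and r = r, OF h]) (use ij in simp)
    finally show "Matrix.mat n n (\<lambda>(j, k). h 0 * stieltjes_mat s r (j + k) 0) $$ (i, j)
        = (A * D * transpose_mat A) $$ (i, j)"
      using ij by simp
  qed (auto simp: A_def)
  then have "Determinant.det (Matrix.mat n n (\<lambda>(j, k). h 0 * stieltjes_mat s r (j + k) 0))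
      = Determinant.det A * Determinant.det D * Determinant.det A"
    by (simp add: det_mult[of _ n] det_transpose[of _ n] mult_carrier_mat[of _ n n _ n])
  moreover have "Determinant.det A = 1"
    by (subst det_lower_triangular[of n])
       (auto simp: A_def diag_mat_def stieltjes_mat_upper stieltjes_mat_diag prod.list_conv_set_nth)
  moreover have "Determinant.det D = (\<Prod>j<n. h j)"
    by (subst det_lower_triangular[of n])
       (auto simp: D_def diag_mat_def prod.list_conv_set_nth atLeast0LessThan)
  ultimately show ?thesis by simp
qed

text \<open>
  Obtained from the Toda equation: \<open>h\<^sub>n = \<tau>\<^sub>n\<^sub>+\<^sub>1 / \<tau>\<^sub>n\<close> satisfies \<open>h\<^sub>n = h\<^sub>n\<^sub>-\<^sub>1 \<sigma>\<^sub>n'\<close>.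
\<close>

fun toda_sigma :: "(complex \<Rightarrow> complex) \<Rightarrow> nat \<Rightarrow> complex \<Rightarrow> complex" where
  "toda_sigma u 0 = (\<lambda>z. 0)"
| "toda_sigma u (Suc 0) = logderiv u"
| "toda_sigma u (Suc (Suc n)) =
     (\<lambda>z. 2 * toda_sigma u (Suc n) z - toda_sigma u n z + logderiv (deriv (toda_sigma u (Suc n))) z)"

lemma logderiv_prod:
  assumes "finite A" "\<And>i. i \<in> A \<Longrightarrow> f i field_differentiable at z" "\<And>i. i \<in> A \<Longrightarrow> f i z \<noteq> 0"
  shows "(\<lambda>z. \<Prod>i\<in>A. f i z) field_differentiable at z \<and> logderiv (\<lambda>z. \<Prod>i\<in>A. f i z) z = (\<Sum>i\<in>A. logderiv (f i) z)"
  using assms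
proof (induction A rule: finite_induct)
  case (insert a A)
  let ?g = "\<lambda>z. \<Prod>i\<in>A. f i z"
  have fa: "f a field_differentiable at z" "f a z \<noteq> 0" and g: "?g field_differentiable at z"
    "logderiv ?g z = (\<Sum>i\<in>A. logderiv (f i) z)" "?g z \<noteq> 0"
    using insert by auto
  have "(\<lambda>z. f a z * ?g z) field_differentiable at z"
    using fa g by (intro field_differentiable_mult)
  moreover have "logderiv (\<lambda>z. f a z * ?g z) z = logderiv (f a) z + logderiv ?g z"
    using fa g(1,3) unfolding logderiv_def by (subst deriv_mult) (auto simp: divide_simps)
  ultimately show ?case
    using g(2) by (simp only: prod.insert[OF insert.hyps(1,2)] sum.insert[OF insert.hyps(1,2)] simp_thms)
qed (simp add: logderiv_def)

text \<open>No determinant identity enters. With s_j = sigma_(j+1) - sigma_j and r_j = sigma_j' the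
  recursion is the Toda lattice s_j' = r_(j+1) - r_j, r_j' = r_j (s_j - s_(j-1)). It implies that
  column j of the Stieltjes matrix has derivative r_(j+1) times column j + 1. Hence the m-th
  derivative of u is u times entry (m, 0), and the Hankel determinant of these moments is a product.
  The index range reflects that derivatives up to order 2 n are represented this way.\<close>

lemma hankel_det_toda:
  fixes u :: "complex \<Rightarrow> complex"
  assumes S: "open S" and u: "u holomorphic_on S" and u0: "\<And>z. z \<in> S \<Longrightarrow> u z \<noteq> 0"
    and hol: "\<And>j. j \<le> Suc (2*n) \<Longrightarrow> toda_sigma u j holomorphic_on S"
    and nz: "\<And>j z. 1 \<le> j \<Longrightarrow> j \<le> Suc (2*n) \<Longrightarrow> z \<in> S \<Longrightarrow> deriv (toda_sigma u j) z \<noteq> 0"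
    and z: "z \<in> S"
  defines "T \<equiv> \<lambda>z. Determinant.det (Matrix.mat n n (\<lambda>(j, k). (deriv ^^ (j + k)) u z))"
  shows "T field_differentiable at z" "T z \<noteq> 0" "logderiv T z = toda_sigma u n z"
proof -
  define s where "s = (\<lambda>z j. toda_sigma u (Suc j) z - toda_sigma u j z)"
  define r where "r = (\<lambda>z j. deriv (toda_sigma u j) z)"
  define h where "h = (\<lambda>z j. u z * (\<Prod>i<j. r z (Suc i)))"
  have dsig: "(toda_sigma u j has_field_derivative r z j) (at z)" if "j \<le> Suc (2*n)" "z \<in> S" for j z
    unfolding r_def using hol[OF that(1)] S that(2) by (rule holomorphic_derivI)
  have drhol: "deriv (toda_sigma u j) holomorphic_on S" if "j \<le> Suc (2*n)" for j
    using hol[OF that] S by (rule holomorphic_deriv)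
  have ds: "((\<lambda>z. s z j) has_field_derivative r z (Suc j) - r z j) (at z)" if "j \<le> 2*n" "z \<in> S" for j z
    unfolding s_def using that by (intro derivative_intros dsig) auto
  \<comment> \<open>\<open>toda_sigma\<close> is defined such that its recursion, solved for the
    logarithmic derivative, is this lattice equation.\<close>
  have dr: "((\<lambda>z. r z (Suc j)) has_field_derivative r z (Suc j) * (s z (Suc j) - s z j)) (at z)"
    if "j \<le> 2*n" "z \<in> S" for j z
  proof -
    have "((\<lambda>z. r z (Suc j)) has_field_derivative deriv (deriv (toda_sigma u (Suc j))) z) (at z)"
      unfolding r_def using drhol[of "Suc j"] that S by (intro holomorphic_derivI[of _ S]) auto
    also have "deriv (deriv (toda_sigma u (Suc j))) z = r z (Suc j) * (s z (Suc j) - s z j)"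
      using nz[of "Suc j" z] that by (simp add: s_def r_def logderiv_def field_simps)
    finally show ?thesis .
  qed
  have dL: "((\<lambda>z. stieltjes_mat (s z) (r z) m j) has_field_derivative
               r z (Suc j) * stieltjes_mat (s z) (r z) m (Suc j)) (at z)"
    if "m + j \<le> Suc (2*n)" "z \<in> S" for m j z
    using that
  proof (induction m arbitrary: j)
    case (Suc m)
    \<comment> \<open>\<open>toda_sigma u 0\<close> is constant; r_0 = 0 accounts for the missing
      entry to the left of column 0.\<close>
    have r0: "r z 0 = 0" by (simp add: r_def)
    show ?case
    proof (cases j)
      case 0
      show ?thesis using Suc.prems unfolding 0
        by (auto intro!: derivative_eq_intros Suc.IH ds dr simp: r0 algebra_simps)
    next
      case (Suc i)
      show ?thesis using Suc.prems unfolding Suc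
        by (auto intro!: derivative_eq_intros Suc.IH ds dr simp: algebra_simps)
    qed
  qed simp
  have s0: "s z 0 = logderiv u z" for z
    by (simp add: s_def)
  have du: "(deriv ^^ m) u z = u z * stieltjes_mat (s z) (r z) m 0" if "m \<le> 2*n" "z \<in> S" for m z
    using that
  proof (induction m arbitrary: z)
    case (Suc m)
    have "(deriv ^^ Suc m) u z = deriv ((deriv ^^ m) u) z" by simp
    also have "\<dots> = deriv (\<lambda>z. u z * stieltjes_mat (s z) (r z) m 0) z"
      using Suc.IH Suc.prems by (intro deriv_cong_ev eventually_mono[OF eventually_nhds_in_open[OF S]]) auto
    also have "\<dots> = u z * stieltjes_mat (s z) (r z) (Suc m) 0"
      using Suc.prems u0[of z]
      by (intro DERIV_imp_deriv)
         (auto intro!: derivative_eq_intros dL holomorphic_derivI[OF u S] simp: s0 logderiv_def field_simps)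
    finally show ?case .
  qed simp
  have T: "T z = (\<Prod>j<n. h z j)" if "z \<in> S" for z
  proof -
    have "Matrix.mat n n (\<lambda>(j, k). (deriv ^^ (j + k)) u z)
        = Matrix.mat n n (\<lambda>(j, k). h z 0 * stieltjes_mat (s z) (r z) (j + k) 0)"
      using that by (intro eq_matI) (auto simp: h_def du)
    then have "T z = Determinant.det (Matrix.mat n n (\<lambda>(j, k). h z 0 * stieltjes_mat (s z) (r z) (j + k) 0))"
      by (simp add: T_def)
    also have "\<dots> = (\<Prod>j<n. h z j)"
      by (rule det_hankel_stieltjes) (simp add: h_def)
    finally show ?thesis .
  qed
  have h0: "h z j \<noteq> 0" if "j \<le> n" for j
    using that u0[OF z] nz z by (auto simp: h_def r_def)
  have dh: "((\<lambda>z. h z j) has_field_derivative h z j * s z j) (at z)" if "j \<le> n" for j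
    using that
  proof (induction j)
    case 0
    show ?case using z u0[OF z] unfolding h_def
      by (auto intro!: derivative_eq_intros holomorphic_derivI[OF u S] simp: s0 logderiv_def)
  next
    case (Suc j)
    have "((\<lambda>z. h z j * r z (Suc j)) has_field_derivative h z j * r z (Suc j) * s z (Suc j)) (at z)"
      using Suc z by (auto intro!: derivative_eq_intros dr simp: algebra_simps)
    then show ?case by (simp add: h_def mult.assoc)
  qed
  have Tev: "\<forall>\<^sub>F w in nhds z. T w = (\<Prod>j<n. h w j)"
    using eventually_nhds_in_open[OF S z] by eventually_elim (rule T)
  have hd: "(\<lambda>z. h z j) field_differentiable at z" if "j < n" for j
    using dh[of j] that field_differentiable_def by auto
  have "(\<lambda>z. \<Prod>j<n. h z j) field_differentiable at z"
    using logderiv_prod[of "{..<n}" "\<lambda>j z. h z j" z] hd h0 by auto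
  then show "T field_differentiable at z"
    unfolding field_differentiable_def using DERIV_cong_ev[OF refl Tev refl] by blast
  show "T z \<noteq> 0"
    using T[OF z] h0 by auto
  have "logderiv T z = logderiv (\<lambda>z. \<Prod>j<n. h z j) z"
    unfolding logderiv_def using deriv_cong_ev[OF Tev refl] T[OF z] by simp
  also have "\<dots> = (\<Sum>j<n. logderiv (\<lambda>z. h z j) z)"
    using logderiv_prod[of "{..<n}" "\<lambda>j z. h z j" z] hd h0 by auto
  \<comment> \<open>The logarithmic derivative of h_j is s_j, and the sum of the s_j telescopes down
    to sigma_0 = 0.\<close>
  also have "\<dots> = (\<Sum>j<n. s z j)"
    using DERIV_imp_deriv[OF dh] h0 by (intro sum.cong) (auto simp: logderiv_def)
  also have "\<dots> = toda_sigma u n z"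
    unfolding s_def by (subst sum_lessThan_telescope) simp
  finally show "logderiv T z = toda_sigma u n z" .
qed

section \<open>Propagation of the expansion\<close>

lemma hO_congD:
  assumes "\<theta>\<^sub>0 \<le> pi" "f \<in> hO \<theta>\<^sub>0 a" "eventually_sectors \<theta>\<^sub>0 P" "\<And>z. P z \<Longrightarrow> f z = g z"
  shows "g \<in> hO \<theta>\<^sub>0 a"
  by (rule hO_cong[OF assms(1,2) eventually_sectors_mono[OF assms(3)]]) (rule assms(4))

lemma mpow_field_differentiable: "- z \<notin> \<real>\<^sub>\<le>\<^sub>0 \<Longrightarrow> mpow a field_differentiable at z"
  using has_field_derivative_mpow field_differentiable_def by blast

text \<open>The sign of a distinguishes the two cases. Since \<open>mpow (- 1) z\<close> is -1/z,
  the middle term is -n^2 / (4 z); for a = 1/sqrt 2 the factor 1 / (32 a) is sqrt 2 / 32.\<close>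

definition sigma_approx :: "complex \<Rightarrow> nat \<Rightarrow> complex \<Rightarrow> complex" where
  "sigma_approx a n z = of_nat n * a * mpow (1/2) z + of_nat n ^ 2 / 4 * mpow (- 1) z
     - of_nat n * (4 * of_nat n ^ 2 + 1) / (32 * a) * mpow (- 5/2) z"

lemma has_field_derivative_sigma_approx:
  assumes "- z \<notin> \<real>\<^sub>\<le>\<^sub>0"
  shows "(sigma_approx a n has_field_derivative
     - (of_nat n * a / 2) * mpow (- 1/2) z + of_nat n ^ 2 / 4 * mpow (- 2) z
     - 5/2 * (of_nat n * (4 * of_nat n ^ 2 + 1) / (32 * a)) * mpow (- 7/2) z) (at z)"
proof -
  define k where "k = of_nat n * (4 * of_nat n ^ 2 + 1) / (32 * a)"
  show ?thesis
    unfolding sigma_approx_def[abs_def] k_def[symmetric]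
    by (rule derivative_eq_intros has_field_derivative_mpow assms refl)+ (simp add: algebra_simps)
qed

text \<open>The leading power is divided out: W = x^(1/2) f' tends to c = -n a / 2, so f'' / f' = W'
  / W + x^(-1) / 2. Here W' / W is (3/2) (d / c) x^(-5/2) up to order -4, where d = n^2 / 4 comes
  from the middle term of f. The third term of f only enters the error.\<close>

lemma logderiv_deriv_expansion:
  assumes th: "\<theta>\<^sub>0 \<le> pi" and f: "(\<lambda>z. f z - sigma_approx a n z) \<in> hO \<theta>\<^sub>0 (- 4)"
    and a: "a \<noteq> 0" and n: "n \<ge> 1"
  shows "eventually_sectors \<theta>\<^sub>0 (\<lambda>z. deriv f z \<noteq> 0)"
    and "(\<lambda>z. logderiv (deriv f) z - (mpow (- 1) z / 2 - 3 * of_nat n / (4 * a) * mpow (- 5/2) z)) \<in> hO \<theta>\<^sub>0 (- 4)"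
proof -
  note slit = eventually_sectors_slit[OF th]
  define c where "c = - (of_nat n * a / 2)"
  define d :: complex where "d = of_nat n ^ 2 / 4"
  define e where "e = 5/2 * (of_nat n * (4 * of_nat n ^ 2 + 1) / (32 * a))"
  have c0: "c \<noteq> 0" using a n by (auto simp: c_def)
  have fd: "eventually_sectors \<theta>\<^sub>0 (\<lambda>z. (z \<noteq> 0 \<and> - z \<notin> \<real>\<^sub>\<le>\<^sub>0) \<and> f field_differentiable at z)"
  proof (rule eventually_sectors_elim[OF slit hO_differentiable[OF f]])
    fix z assume z: "z \<noteq> 0 \<and> - z \<notin> \<real>\<^sub>\<le>\<^sub>0" and "(\<lambda>z. f z - sigma_approx a n z) field_differentiable at z"
    moreover have "sigma_approx a n field_differentiable at z"
      using has_field_derivative_sigma_approx z field_differentiable_def by blast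
    ultimately show "(z \<noteq> 0 \<and> - z \<notin> \<real>\<^sub>\<le>\<^sub>0) \<and> f field_differentiable at z"
      using field_differentiable_add by fastforce
  qed
  have E1: "(\<lambda>z. deriv f z - (c * mpow (- 1/2) z + d * mpow (- 2) z)) \<in> hO \<theta>\<^sub>0 (- 7/2)"
  proof -
    \<comment> \<open>The derivative of the error has order -5; it is weakened to -7/2 so that the
      derivative of the third term can be absorbed.\<close>
    have "(\<lambda>z. deriv (\<lambda>z. f z - sigma_approx a n z) z) \<in> hO \<theta>\<^sub>0 (- 7/2)"
      by (rule hO_mono[OF hO_deriv[OF th f]]) simp
    then have "(\<lambda>z. deriv (\<lambda>z. f z - sigma_approx a n z) z - e * mpow (- 7/2) z) \<in> hO \<theta>\<^sub>0 (- 7/2)"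
      by (intro hO_diff hO_cmult hO_mpow th)
    then show ?thesis
    proof (rule hO_congD[OF th _ fd])
      fix z assume z: "(z \<noteq> 0 \<and> - z \<notin> \<real>\<^sub>\<le>\<^sub>0) \<and> f field_differentiable at z"
      have "deriv (\<lambda>z. f z - sigma_approx a n z) z = deriv f z - (c * mpow (- 1/2) z + d * mpow (- 2) z - e * mpow (- 7/2) z)"
        unfolding c_def d_def e_def
        by (rule DERIV_imp_deriv) (intro DERIV_diff has_field_derivative_sigma_approx, use z field_differentiable_derivI in auto)
      then show "deriv (\<lambda>z. f z - sigma_approx a n z) z - e * mpow (- 7/2) z
          = deriv f z - (c * mpow (- 1/2) z + d * mpow (- 2) z)" by simp
    qed
  qed
  define W where "W = (\<lambda>z. deriv f z * mpow (1/2) z)"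
  have E2: "(\<lambda>z. W z - (c + d * mpow (- 3/2) z)) \<in> hO \<theta>\<^sub>0 (- 3)"
  proof (rule hO_congD[OF th hO_mono[OF hO_mult[OF E1 hO_mpow[OF th, of "1/2"]]] slit])
    fix z :: complex assume z: "z \<noteq> 0 \<and> - z \<notin> \<real>\<^sub>\<le>\<^sub>0"
    show "(deriv f z - (c * mpow (- 1/2) z + d * mpow (- 2) z)) * mpow (1/2) z = W z - (c + d * mpow (- 3/2) z)"
      using z mpow_mult[of "- 1/2" z "1/2"] mpow_mult[of "- 2" z "1/2"]
      by (simp add: W_def algebra_simps mpow_0)
  qed simp
  have Wc: "(\<lambda>z. W z - c) \<in> hO \<theta>\<^sub>0 (- 3/2)"
  proof (rule hO_congD[OF th _ slit])
    show "(\<lambda>z. (W z - (c + d * mpow (- 3/2) z)) + d * mpow (- 3/2) z) \<in> hO \<theta>\<^sub>0 (- 3/2)"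
      by (intro hO_add hO_mono[OF E2] hO_cmult hO_mpow th) simp
  qed simp
  have Wnz: "eventually_sectors \<theta>\<^sub>0 (\<lambda>z. W z \<noteq> 0)" and Winv: "(\<lambda>z. inverse (W z)) \<in> hO \<theta>\<^sub>0 0"
    using hO_nonzero[OF th Wc _ c0] hO_inverse[OF th Wc _ c0] by simp_all
  show nz: "eventually_sectors \<theta>\<^sub>0 (\<lambda>z. deriv f z \<noteq> 0)"
    by (rule eventually_sectors_mono[OF Wnz]) (auto simp: W_def)
  have df: "eventually_sectors \<theta>\<^sub>0 (\<lambda>z. deriv f field_differentiable at z)"
  proof (rule eventually_sectors_elim[OF slit hO_differentiable[OF E1]])
    fix z assume z: "z \<noteq> 0 \<and> - z \<notin> \<real>\<^sub>\<le>\<^sub>0"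
      and *: "(\<lambda>z. deriv f z - (c * mpow (- 1/2) z + d * mpow (- 2) z)) field_differentiable at z"
    have "(\<lambda>z. (deriv f z - (c * mpow (- 1/2) z + d * mpow (- 2) z)) + (c * mpow (- 1/2) z + d * mpow (- 2) z))
        field_differentiable at z"
      by (intro field_differentiable_add * field_differentiable_mult field_differentiable_const mpow_field_differentiable)
         (use z in auto)
    then show "deriv f field_differentiable at z" by simp
  qed
  have ev: "eventually_sectors \<theta>\<^sub>0 (\<lambda>z. (z \<noteq> 0 \<and> - z \<notin> \<real>\<^sub>\<le>\<^sub>0) \<and> deriv f field_differentiable at z \<and> W z \<noteq> 0)"
    by (intro eventually_sectors_conj slit df Wnz)
  have dW: "deriv W z = deriv (\<lambda>z. W z - (c + d * mpow (- 3/2) z)) z + 3/2 * d * mpow (- 5/2) z"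
    if "- z \<notin> \<real>\<^sub>\<le>\<^sub>0" "deriv f field_differentiable at z" for z
  proof -
    have "W field_differentiable at z"
      unfolding W_def by (intro field_differentiable_mult that mpow_field_differentiable)
    then have "(W has_field_derivative deriv W z) (at z)" by (rule field_differentiable_derivI)
    then have "deriv (\<lambda>z. W z - (c + d * mpow (- 3/2) z)) z = deriv W z - (0 + d * (- of_real (- 3/2) * mpow (- 3/2 - 1) z))"
      by (intro DERIV_imp_deriv DERIV_diff DERIV_add DERIV_const DERIV_cmult has_field_derivative_mpow that)
    then show ?thesis by (simp add: algebra_simps)
  qed
  have E3: "(\<lambda>z. deriv W z - 3/2 * d * mpow (- 5/2) z) \<in> hO \<theta>\<^sub>0 (- 4)"
    by (rule hO_congD[OF th hO_mono[OF hO_deriv[OF th E2]] ev]) (auto simp: dW)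
  \<comment> \<open>W' / W minus its leading term is split into the error of W', divided by W, and a
    part carrying the deviation of W from c, of order -5/2 - 3/2 = -4.\<close>
  have "(\<lambda>z. (deriv W z - 3/2 * d * mpow (- 5/2) z) * inverse (W z)
          - 3/2 * d / c * (mpow (- 5/2) z * ((W z - c) * inverse (W z)))) \<in> hO \<theta>\<^sub>0 (- 4)"
  proof (intro hO_diff hO_cmult)
    show "(\<lambda>z. (deriv W z - 3/2 * d * mpow (- 5/2) z) * inverse (W z)) \<in> hO \<theta>\<^sub>0 (- 4)"
      using hO_mult[OF E3 Winv] by simp
    show "(\<lambda>z. mpow (- 5/2) z * ((W z - c) * inverse (W z))) \<in> hO \<theta>\<^sub>0 (- 4)"
      using hO_mult[OF hO_mpow[OF th, of "- 5/2"] hO_mult[OF Wc Winv]] by simp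
  qed
  then show "(\<lambda>z. logderiv (deriv f) z - (mpow (- 1) z / 2 - 3 * of_nat n / (4 * a) * mpow (- 5/2) z)) \<in> hO \<theta>\<^sub>0 (- 4)"
  proof (rule hO_congD[OF th _ ev])
    fix z assume z: "(z \<noteq> 0 \<and> - z \<notin> \<real>\<^sub>\<le>\<^sub>0) \<and> deriv f field_differentiable at z \<and> W z \<noteq> 0"
    have "deriv W z = deriv f z * (- of_real (1/2) * mpow (1/2 - 1) z) + deriv (deriv f) z * mpow (1/2) z"
      unfolding W_def using z
      by (intro DERIV_imp_deriv DERIV_mult' has_field_derivative_mpow field_differentiable_derivI) auto
    then have "deriv W z / W z = - (mpow (- 1/2) z / mpow (1/2) z) / 2 + logderiv (deriv f) z"
      using z by (simp add: W_def logderiv_def divide_simps)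
    also have "mpow (- 1/2) z / mpow (1/2) z = mpow (- 1) z"
      using z mpow_mult[of "-1" z "1/2"] by (simp add: divide_simps)
    finally have *: "deriv W z / W z = - mpow (- 1) z / 2 + logderiv (deriv f) z" by simp
    define k where "k = 3 * of_nat n / (4 * a)"
    have k: "3/2 * d = - (k * c)"
      using a n by (simp add: d_def c_def k_def power2_eq_square)
    have "(deriv W z - 3/2 * d * mpow (- 5/2) z) * inverse (W z)
          - 3/2 * d / c * (mpow (- 5/2) z * ((W z - c) * inverse (W z)))
        = deriv W z / W z + k * mpow (- 5/2) z"
      unfolding k using z c0 by (simp add: divide_simps) (simp add: algebra_simps)
    then show "(deriv W z - 3/2 * d * mpow (- 5/2) z) * inverse (W z)
          - 3/2 * d / c * (mpow (- 5/2) z * ((W z - c) * inverse (W z)))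
        = logderiv (deriv f) z - (mpow (- 1) z / 2 - 3 * of_nat n / (4 * a) * mpow (- 5/2) z)"
      unfolding * k_def by simp
  qed
qed

text \<open>Second differences in n decide: those of n, n^2 / 4 and n (4 n^2 + 1) / 32 are 0, 1/2
  and 3 n / 4, which match the coefficients delivered by the logarithmic derivative. Two consecutive
  indices are carried, since the recursion reaches back twice.\<close>

lemma toda_sigma_expansion:
  assumes th: "\<theta>\<^sub>0 \<le> pi" and u: "(\<lambda>z. logderiv u z - sigma_approx a 1 z) \<in> hO \<theta>\<^sub>0 (- 4)" and a: "a \<noteq> 0"
  shows "(\<lambda>z. toda_sigma u n z - sigma_approx a n z) \<in> hO \<theta>\<^sub>0 (- 4)"
proof -
  have "(\<lambda>z. toda_sigma u n z - sigma_approx a n z) \<in> hO \<theta>\<^sub>0 (- 4) \<and>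
        (\<lambda>z. toda_sigma u (Suc n) z - sigma_approx a (Suc n) z) \<in> hO \<theta>\<^sub>0 (- 4)"
  proof (induction n)
    case 0
    have "(\<lambda>z. 0 * mpow (- 4) z) \<in> hO \<theta>\<^sub>0 (- 4)" by (intro hO_cmult hO_mpow th)
    then show ?case using u by (simp add: sigma_approx_def)
  next
    case (Suc n)
    have "(\<lambda>z. 2 * (toda_sigma u (Suc n) z - sigma_approx a (Suc n) z) - (toda_sigma u n z - sigma_approx a n z)
       + (logderiv (deriv (toda_sigma u (Suc n))) z - (mpow (- 1) z / 2 - 3 * of_nat (Suc n) / (4 * a) * mpow (- 5/2) z)))
      \<in> hO \<theta>\<^sub>0 (- 4)"
      by (rule hO_add[OF hO_diff[OF hO_cmult[OF conjunct2[OF Suc]] conjunct1[OF Suc]]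
            logderiv_deriv_expansion(2)[OF th conjunct2[OF Suc] a]]) simp
    also have "(\<lambda>z. 2 * (toda_sigma u (Suc n) z - sigma_approx a (Suc n) z) - (toda_sigma u n z - sigma_approx a n z)
       + (logderiv (deriv (toda_sigma u (Suc n))) z - (mpow (- 1) z / 2 - 3 * of_nat (Suc n) / (4 * a) * mpow (- 5/2) z)))
      = (\<lambda>z. toda_sigma u (Suc (Suc n)) z - sigma_approx a (Suc (Suc n)) z)"
      using a by (intro ext) (simp add: sigma_approx_def field_simps power2_eq_square)
    finally show ?case using Suc by simp
  qed
  then show ?thesis by simp
qed

text \<open>
  With \<open>f = a x\<^sup>1\<^sup>/\<^sup>2 + x\<^sup>-\<^sup>1 / 4 + E\<close> the Riccati equation expresses \<open>2 a x\<^sup>1\<^sup>/\<^sup>2 E\<close> by \<open>x\<^sup>-\<^sup>2\<close> and terms smaller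
  than \<open>E\<close>; substituting the bound for \<open>E\<close> twice yields the next coefficient and the error.
\<close>

lemma riccati_expansion:
  assumes th: "\<theta>\<^sub>0 \<le> pi" and f: "(\<lambda>z. f z - (a * mpow (1/2) z + mpow (- 1) z / 4)) \<in> hO \<theta>\<^sub>0 (- 7/4)"
    and a: "a ^ 2 = 1 / 2"
    and riccati: "eventually_sectors \<theta>\<^sub>0 (\<lambda>z. f field_differentiable at z \<and> deriv f z + f z ^ 2 = mpow 1 z / 2)"
  shows "(\<lambda>z. f z - sigma_approx a 1 z) \<in> hO \<theta>\<^sub>0 (- 4)"
proof -
  define E where "E = (\<lambda>z. f z - (a * mpow (1/2) z + mpow (- 1) z / 4))"
  have a0: "a \<noteq> 0" using a by auto
  have ev: "eventually_sectors \<theta>\<^sub>0 (\<lambda>z. (z \<noteq> 0 \<and> - z \<notin> \<real>\<^sub>\<le>\<^sub>0) \<and> f field_differentiable at z \<and> deriv f z + f z ^ 2 = mpow 1 z / 2)"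
    by (intro eventually_sectors_conj[OF eventually_sectors_slit[OF th] riccati])
  \<comment> \<open>One pass improves the order by 3/2; b \<le> -1 keeps E^2 within the order b - 1
    of E'. From -7/4 the first pass reveals the term of order -5/2, and from there the second
    reaches -4.\<close>
  have step: "(\<lambda>z. E z + 5 / (32 * a) * mpow (- 5/2) z) \<in> hO \<theta>\<^sub>0 (b - 3/2)" if "E \<in> hO \<theta>\<^sub>0 b" "b \<le> - 1" for b
  proof -
    have "(\<lambda>z. - 1 / (2 * a) * (mpow (- 1/2) z * (deriv E z + E z * E z + 1 / 2 * (mpow (- 1) z * E z)))) \<in> hO \<theta>\<^sub>0 (- 1/2 + (b - 1))"
      using that(2) hO_mono[OF hO_mult[OF that(1,1)], of "b - 1"] hO_mono[OF hO_mult[OF hO_mpow[OF th, of "-1"] that(1)], of "b - 1"]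
      by (intro hO_cmult hO_mult hO_add hO_mpow hO_deriv th that(1)) simp_all
    then have "(\<lambda>z. - 1 / (2 * a) * (mpow (- 1/2) z * (deriv E z + E z * E z + 1 / 2 * (mpow (- 1) z * E z)))) \<in> hO \<theta>\<^sub>0 (b - 3/2)"
      by (rule hO_mono) simp
    then show ?thesis
    proof (rule hO_congD[OF th _ ev])
      fix z assume z: "(z \<noteq> 0 \<and> - z \<notin> \<real>\<^sub>\<le>\<^sub>0) \<and> f field_differentiable at z \<and> deriv f z + f z ^ 2 = mpow 1 z / 2"
      have dE: "deriv E z = deriv f z - (a * (- of_real (1/2) * mpow (1/2 - 1) z) + (- of_real (-1) * mpow (-1 - 1) z) / 4)"
        unfolding E_def using z
        by (intro DERIV_imp_deriv DERIV_diff DERIV_add DERIV_cdivide DERIV_cmult has_field_derivative_mpow)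
           (auto intro: field_differentiable_derivI)
      have m: "mpow 1 z = mpow (1/2) z * mpow (1/2) z" "mpow (- 1) z = mpow (- 1/2) z * mpow (- 1/2) z"
        "mpow (- 2) z = mpow (- 1/2) z * mpow (- 1/2) z * mpow (- 1/2) z * mpow (- 1/2) z"
        "mpow (- 5/2) z = mpow (- 1/2) z * mpow (- 1/2) z * mpow (- 1/2) z * mpow (- 1/2) z * mpow (- 1/2) z"
        "mpow (- 1/2) z * mpow (1/2) z = 1"
        using z by (simp_all add: mpow_mult mpow_0)
      define p where "p = mpow (1/2) z"
      define q where "q = mpow (- 1/2) z"
      have pq: "q * p = 1" using m(5) by (simp add: p_def q_def)
      have fE: "f z = E z + (a * p + q * q / 4)" by (simp add: E_def p_def m q_def)
      have "deriv f z = p * p / 2 - f z ^ 2" using z by (simp add: m p_def algebra_simps)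
      then have dE': "deriv E z = p * p / 2 - f z ^ 2 + a * q / 2 - q * q * q * q / 4"
        unfolding dE by (simp add: m p_def q_def)
      \<comment> \<open>The two bracketed differences vanish by a^2 = 1/2 and q p = 1: the first
        determines a, the second the coefficient 1/4. The constant -5/16 is -1/4 - 1/16, from the
        derivative and the square of x^(-1) / 4.\<close>
      have "q * (deriv E z + E z * E z + 1 / 2 * (q * q * E z))
          = (q * p) * p * (1 / 2 - a ^ 2) + a / 2 * q * q * (1 - q * p) - 5 / 16 * q ^ 5 - 2 * a * (q * p) * E z"
        unfolding dE' fE by (simp add: field_simps power2_eq_square eval_nat_numeral)
      also have "\<dots> = - 5 / 16 * q ^ 5 - 2 * a * E z"
        unfolding pq a by simp
      finally have "q * (deriv E z + E z * E z + 1 / 2 * (q * q * E z)) = - 5 / 16 * q ^ 5 - 2 * a * E z" .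
      moreover have "- 1 / (2 * a) * (- 5 / 16 * q ^ 5 - 2 * a * E z) = E z + 5 / (32 * a) * q ^ 5"
        using a0 by (simp add: field_simps)
      ultimately have "- 1 / (2 * a) * (q * (deriv E z + E z * E z + 1 / 2 * (q * q * E z))) = E z + 5 / (32 * a) * q ^ 5"
        by (simp only:)
      moreover have "mpow (- 5/2) z = q ^ 5"
        by (simp only: m(4) q_def) (simp add: eval_nat_numeral)
      ultimately show "- 1 / (2 * a) * (mpow (- 1/2) z * (deriv E z + E z * E z + 1 / 2 * (mpow (- 1) z * E z)))
          = E z + 5 / (32 * a) * mpow (- 5/2) z"
        by (simp only: m(2) q_def)
    qed
  qed
  have E: "E \<in> hO \<theta>\<^sub>0 (- 7/4)" using f by (simp add: E_def)
  have "(\<lambda>z. E z + 5 / (32 * a) * mpow (- 5/2) z) \<in> hO \<theta>\<^sub>0 (- 5/2)"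
    by (rule hO_mono[OF step[OF E]]) simp_all
  then have "(\<lambda>z. (E z + 5 / (32 * a) * mpow (- 5/2) z) - 5 / (32 * a) * mpow (- 5/2) z) \<in> hO \<theta>\<^sub>0 (- 5/2)"
    by (intro hO_diff hO_cmult hO_mpow th)
  then have "E \<in> hO \<theta>\<^sub>0 (- 5/2)" by simp
  from step[OF this] have "(\<lambda>z. E z + 5 / (32 * a) * mpow (- 5/2) z) \<in> hO \<theta>\<^sub>0 (- 4)" by simp
  then show ?thesis by (simp add: E_def sigma_approx_def algebra_simps)
qed

section \<open>The Airy series\<close>

text \<open>Comparison of coefficients in w'' = z w; \<open>a 2 = 0\<close> is this equation at the
  origin.\<close>

lemma airy_powser:
  fixes a :: "nat \<Rightarrow> complex"
  assumes summable: "\<And>z. summable (\<lambda>n. a n * z ^ n)"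
    and a2: "a 2 = 0" and rec: "\<And>n. of_nat (n + 2) * of_nat (n + 3) * a (n + 3) = a n"
  defines "w \<equiv> \<lambda>z. \<Sum>n. a n * z ^ n"
  shows "w field_differentiable at z" "(deriv w has_field_derivative z * w z) (at z)"
    "w 0 = a 0" "deriv w 0 = a 1"
proof -
  have d1: "(w has_field_derivative (\<Sum>n. diffs a n * z ^ n)) (at z)" for z
    unfolding w_def by (rule termdiffs_strong_converges_everywhere[OF summable])
  then have dw: "deriv w = (\<lambda>z. \<Sum>n. diffs a n * z ^ n)"
    by (intro ext DERIV_imp_deriv)
  have s1: "summable (\<lambda>n. diffs a n * z ^ n)" for z
    by (rule termdiff_converges_all[OF summable])
  have s2: "summable (\<lambda>n. diffs (diffs a) n * z ^ n)" for z
    by (rule termdiff_converges_all[OF s1])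
  have "(\<Sum>n. diffs (diffs a) n * z ^ n) = (\<Sum>n. diffs (diffs a) (Suc n) * z ^ Suc n) + diffs (diffs a) 0 * z ^ 0"
    using suminf_split_head[OF s2[of z]] by simp
  also have "diffs (diffs a) 0 = 0" using a2 by (simp add: diffs_def numeral_2_eq_2)
  also have "(\<Sum>n. diffs (diffs a) (Suc n) * z ^ Suc n) = (\<Sum>n. z * (a n * z ^ n))"
  proof (rule suminf_cong)
    fix n
    have "diffs (diffs a) (Suc n) = of_nat (n + 2) * of_nat (n + 3) * a (n + 3)"
      by (simp add: diffs_def eval_nat_numeral algebra_simps)
    then show "diffs (diffs a) (Suc n) * z ^ Suc n = z * (a n * z ^ n)"
      unfolding rec by simp
  qed
  also have "\<dots> = z * w z" unfolding w_def by (rule suminf_mult[OF summable])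
  finally have "(\<Sum>n. diffs (diffs a) n * z ^ n) = z * w z" by simp
  then show "(deriv w has_field_derivative z * w z) (at z)"
    using termdiffs_strong_converges_everywhere[OF s1, of z] unfolding dw by simp
  show "w field_differentiable at z" using d1 field_differentiable_def by blast
  show "w 0 = a 0" by (simp add: w_def)
  show "deriv w 0 = a 1" unfolding dw by (simp add: diffs_def)
qed

section \<open>The two Maclaurin series\<close>

definition airy_f_coeff :: "nat \<Rightarrow> complex" where
  "airy_f_coeff k = 3 ^ k * pochhammer (1/3) k / fact (3 * k)"

definition airy_g_coeff :: "nat \<Rightarrow> complex" where
  "airy_g_coeff k = 3 ^ k * pochhammer (2/3) k / fact (3 * k + 1)"

lemma fact_3Suc: "(fact (3 * Suc k) :: complex) = (3 * of_nat k + 3) * (3 * of_nat k + 2) * (3 * of_nat k + 1) * fact (3 * k)"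
proof -
  have "3 * Suc k = Suc (Suc (Suc (3 * k)))" by simp
  then show ?thesis by (simp only: fact_Suc) (simp add: algebra_simps)
qed

lemma fact_3Suc_1: "(fact (3 * Suc k + 1) :: complex) = (3 * of_nat k + 4) * (3 * of_nat k + 3) * (3 * of_nat k + 2) * fact (3 * k + 1)"
proof -
  have "3 * Suc k + 1 = Suc (Suc (Suc (3 * k + 1)))" by simp
  then show ?thesis by (simp only: fact_Suc) (simp add: algebra_simps)
qed

lemma of_nat_plus_nonzero: "(3 * of_nat k + numeral m :: complex) \<noteq> 0" "(3 * of_nat k + 1 :: complex) \<noteq> 0"
proof -
  have "(3 * of_nat k + numeral m :: complex) = of_nat (3 * k + numeral m)" by simp
  then show "(3 * of_nat k + numeral m :: complex) \<noteq> 0" by (metis add_is_0 of_nat_eq_0_iff zero_neq_numeral)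
  have "(3 * of_nat k + 1 :: complex) = of_nat (3 * k + 1)" by simp
  then show "(3 * of_nat k + 1 :: complex) \<noteq> 0" by (metis add_is_0 of_nat_eq_0_iff zero_neq_one)
qed

lemma airy_f_coeff_Suc: "airy_f_coeff (Suc k) * ((3 * of_nat k + 2) * (3 * of_nat k + 3)) = airy_f_coeff k"
  unfolding airy_f_coeff_def fact_3Suc pochhammer_Suc
  using of_nat_plus_nonzero(1)[of k] of_nat_plus_nonzero(2)[of k]
  by (simp add: divide_simps)

lemma airy_g_coeff_Suc: "airy_g_coeff (Suc k) * ((3 * of_nat k + 3) * (3 * of_nat k + 4)) = airy_g_coeff k"
  unfolding airy_g_coeff_def fact_3Suc_1 pochhammer_Suc
  using of_nat_plus_nonzero(1)[of k]
  by (simp add: divide_simps)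

text \<open>Coarse, but enough for convergence in the whole plane by comparison with the series of
  exp (|z|^3).\<close>

lemma airy_coeff_bound:
  fixes c :: "nat \<Rightarrow> complex"
  assumes "norm (c 0) \<le> 1" "\<And>k. norm (c (Suc k)) * (3 * real k + 2) * (3 * real k + 3) \<le> norm (c k)"
  shows "norm (c k) \<le> 1 / fact k"
proof (induction k)
  case (Suc k)
  have "norm (c (Suc k)) * (real k + 1) \<le> norm (c (Suc k)) * ((3 * real k + 2) * (3 * real k + 3))"
    by (intro mult_left_mono) (auto simp: algebra_simps)
  also have "\<dots> \<le> norm (c k)" using assms(2)[of k] by (simp add: mult.assoc)
  also have "\<dots> \<le> 1 / fact k" by (rule Suc.IH)
  finally have "norm (c (Suc k)) \<le> 1 / fact k / (real k + 1)"
    by (subst pos_le_divide_eq) auto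
  then show ?case by (simp add: mult.commute add.commute)
qed (use assms in simp)

lemma norm_linear_of_nat: "norm (3 * of_nat k + numeral m :: complex) = 3 * real k + numeral m"
proof -
  have "(3 * of_nat k + numeral m :: complex) = of_nat (3 * k + numeral m)" by simp
  then show ?thesis by (metis norm_of_nat of_nat_add of_nat_mult of_nat_numeral)
qed

lemma norm_airy_f_coeff: "norm (airy_f_coeff k) \<le> 1 / fact k"
proof (rule airy_coeff_bound)
  fix k
  have "norm (airy_f_coeff (Suc k) * ((3 * of_nat k + 2) * (3 * of_nat k + 3))) = norm (airy_f_coeff k)"
    by (simp only: airy_f_coeff_Suc)
  then show "norm (airy_f_coeff (Suc k)) * (3 * real k + 2) * (3 * real k + 3) \<le> norm (airy_f_coeff k)"
    by (simp add: norm_mult norm_linear_of_nat mult.assoc)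
qed (simp add: airy_f_coeff_def)

lemma norm_airy_g_coeff: "norm (airy_g_coeff k) \<le> 1 / fact k"
proof (rule airy_coeff_bound)
  fix k
  have "norm (airy_g_coeff (Suc k)) * (3 * real k + 2) * (3 * real k + 3)
      \<le> norm (airy_g_coeff (Suc k)) * (3 * real k + 3) * (3 * real k + 4)"
    unfolding mult.assoc by (intro mult_left_mono) (auto simp: algebra_simps)
  also have "\<dots> = norm (airy_g_coeff (Suc k) * ((3 * of_nat k + 3) * (3 * of_nat k + 4)))"
    by (simp add: norm_mult norm_linear_of_nat mult.assoc)
  also have "\<dots> = norm (airy_g_coeff k)" by (simp only: airy_g_coeff_Suc)
  finally show "norm (airy_g_coeff (Suc k)) * (3 * real k + 2) * (3 * real k + 3) \<le> norm (airy_g_coeff k)" .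
qed (simp add: airy_g_coeff_def)

lemma summable_cube_powser:
  fixes c :: "nat \<Rightarrow> complex"
  assumes "\<And>k. norm (c k) \<le> 1 / fact k"
  shows "summable (\<lambda>k. c k * z ^ (3 * k + i))"
proof (rule summable_comparison_test)
  show "summable (\<lambda>k. norm z ^ i * (inverse (fact k) * (norm z ^ 3) ^ k))"
    by (intro summable_mult summable_exp)
  show "\<exists>N. \<forall>k\<ge>N. norm (c k * z ^ (3 * k + i)) \<le> norm z ^ i * (inverse (fact k) * (norm z ^ 3) ^ k)"
  proof (intro exI allI impI)
    fix k :: nat
    have "norm (c k) * norm z ^ (3 * k + i) \<le> 1 / fact k * norm z ^ (3 * k + i)"
      using assms by (intro mult_right_mono) auto
    also have "\<dots> = norm z ^ i * (inverse (fact k) * (norm z ^ 3) ^ k)"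
      by (simp add: power_add power_mult divide_inverse)
    finally show "norm (c k * z ^ (3 * k + i)) \<le> norm z ^ i * (inverse (fact k) * (norm z ^ 3) ^ k)"
      by (simp add: norm_mult norm_power)
  qed
qed

text \<open>Padding with zeros turns a series in z^(3 k + i) into an ordinary power series, to which
  termwise differentiation applies.\<close>

lemma cube_powser:
  fixes c :: "nat \<Rightarrow> complex"
  assumes bound: "\<And>k. norm (c k) \<le> 1 / fact k" and "i < 3"
  defines "a \<equiv> \<lambda>n. if n mod 3 = i then c (n div 3) else 0"
  shows "summable (\<lambda>n. a n * z ^ n)" "(\<Sum>n. a n * z ^ n) = (\<Sum>k. c k * z ^ (3 * k + i))"
proof -
  have mono: "strict_mono (\<lambda>k::nat. 3 * k + i)" by (auto simp: strict_mono_def)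
  have zero: "a n * z ^ n = 0" if "n \<notin> range (\<lambda>k. 3 * k + i)" for n
  proof -
    have "n mod 3 \<noteq> i"
    proof
      assume "n mod 3 = i"
      then have "n = 3 * (n div 3) + i" using mult_div_mod_eq[of 3 n] by simp
      then show False using that by blast
    qed
    then show ?thesis by (simp add: a_def)
  qed
  have eq: "(\<lambda>k. a (3 * k + i) * z ^ (3 * k + i)) = (\<lambda>k. c k * z ^ (3 * k + i))"
    using \<open>i < 3\<close> by (simp add: a_def)
  show "summable (\<lambda>n. a n * z ^ n)"
    using summable_mono_reindex[where f = "\<lambda>n. a n * z ^ n", OF mono zero] summable_cube_powser[OF bound, of z i] unfolding eq by simp
  show "(\<Sum>n. a n * z ^ n) = (\<Sum>k. c k * z ^ (3 * k + i))"
    using suminf_mono_reindex[where f = "\<lambda>n. a n * z ^ n", OF mono zero] unfolding eq by simp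
qed

lemma mod_div_3_add: "(n + 3) mod 3 = n mod (3::nat)" "(n + 3) div 3 = Suc (n div (3::nat))"
  by simp_all

lemma
  shows airy_f_differentiable: "airy_f field_differentiable at z"
    and airy_f_ode: "(deriv airy_f has_field_derivative z * airy_f z) (at z)"
    and airy_f_0: "airy_f 0 = 1" and deriv_airy_f_0: "deriv airy_f 0 = 0"
proof -
  define a where "a = (\<lambda>n. if n mod 3 = 0 then airy_f_coeff (n div 3) else 0)"
  have eq: "(\<lambda>z. \<Sum>n. a n * z ^ n) = airy_f"
    using cube_powser(2)[OF norm_airy_f_coeff, of 0] by (auto simp: a_def airy_f_def airy_f_coeff_def)
  have "of_nat (n + 2) * of_nat (n + 3) * a (n + 3) = a n" for n
  proof (cases "n mod 3 = 0")
    case True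
    then obtain k where "n = 3 * k" by (auto elim: dvdE)
    then show ?thesis using airy_f_coeff_Suc[of k] by (simp add: a_def mod_div_3_add algebra_simps)
  qed (simp add: a_def mod_div_3_add)
  note rec = this
  have s: "summable (\<lambda>n. a n * z ^ n)" for z
    unfolding a_def by (rule cube_powser(1)[OF norm_airy_f_coeff]) simp
  have a: "a 0 = 1" "a 1 = 0" "a 2 = 0"
    by (simp_all add: a_def airy_f_coeff_def)
  note * = airy_powser[OF s a(3) rec, unfolded eq fun_cong[OF eq] a]
  show "airy_f field_differentiable at z" "(deriv airy_f has_field_derivative z * airy_f z) (at z)"
    "airy_f 0 = 1" "deriv airy_f 0 = 0"
    by (rule *)+
qed

lemma
  shows airy_g_differentiable: "airy_g field_differentiable at z"
    and airy_g_ode: "(deriv airy_g has_field_derivative z * airy_g z) (at z)"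
    and airy_g_0: "airy_g 0 = 0" and deriv_airy_g_0: "deriv airy_g 0 = 1"
proof -
  define a where "a = (\<lambda>n. if n mod 3 = 1 then airy_g_coeff (n div 3) else 0)"
  have eq: "(\<lambda>z. \<Sum>n. a n * z ^ n) = airy_g"
    using cube_powser(2)[OF norm_airy_g_coeff, of 1] by (auto simp: a_def airy_g_def airy_g_coeff_def)
  have "of_nat (n + 2) * of_nat (n + 3) * a (n + 3) = a n" for n
  proof (cases "n mod 3 = 1")
    case True
    define k where "k = n div 3"
    have "n = 3 * k + 1" using True mult_div_mod_eq[of 3 n] by (simp add: k_def)
    then have "of_nat (n + 2) * of_nat (n + 3) = (3 * of_nat k + 3) * (3 * of_nat k + 4 :: complex)"
      by (simp add: add.commute)
    moreover have "a n = airy_g_coeff k" "a (n + 3) = airy_g_coeff (Suc k)"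
      using True by (simp_all only: a_def k_def mod_div_3_add if_True simp_thms)
    ultimately show ?thesis by (metis airy_g_coeff_Suc mult.commute)
  qed (simp add: a_def mod_div_3_add)
  note rec = this
  have s: "summable (\<lambda>n. a n * z ^ n)" for z
    unfolding a_def by (rule cube_powser(1)[OF norm_airy_g_coeff]) simp
  have a: "a 0 = 0" "a 1 = 1" "a 2 = 0"
    by (simp_all add: a_def airy_g_coeff_def)
  note * = airy_powser[OF s a(3) rec, unfolded eq fun_cong[OF eq] a]
  show "airy_g field_differentiable at z" "(deriv airy_g has_field_derivative z * airy_g z) (at z)"
    "airy_g 0 = 0" "deriv airy_g 0 = 1"
    by (rule *)+
qed

text \<open>Source of the connection formula: rotating the argument by a third root of unity changes
  only the weight of \<open>airy_g\<close>.\<close>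

lemma airy_f_rotate: "\<omega> ^ 3 = 1 \<Longrightarrow> airy_f (\<omega> * z) = airy_f z"
  by (simp add: airy_f_def power_mult_distrib power_mult)

lemma airy_g_rotate:
  assumes "\<omega> ^ 3 = 1"
  shows "airy_g (\<omega> * z) = \<omega> * airy_g z"
proof -
  have "summable (\<lambda>k. airy_g_coeff k * z ^ (3 * k + 1))"
    by (rule summable_cube_powser[OF norm_airy_g_coeff])
  then have "\<omega> * (\<Sum>k. airy_g_coeff k * z ^ (3 * k + 1)) = (\<Sum>k. \<omega> * (airy_g_coeff k * z ^ (3 * k + 1)))"
    by (rule suminf_mult[symmetric])
  also have "\<dots> = (\<Sum>k. airy_g_coeff k * (\<omega> * z) ^ (3 * k + 1))"
    using assms by (intro suminf_cong) (simp add: power_mult_distrib power_mult power_add)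
  finally show ?thesis by (simp add: airy_g_def airy_g_coeff_def)
qed

section \<open>Wronskians and the solution space of the Airy equation\<close>

lemma wronskian_constant:
  assumes "open S" "connected S"
    and u: "\<And>z. z \<in> S \<Longrightarrow> (u has_field_derivative u' z) (at z)"
    and u': "\<And>z. z \<in> S \<Longrightarrow> (u' has_field_derivative z * u z) (at z)"
    and v: "\<And>z. z \<in> S \<Longrightarrow> (v has_field_derivative v' z) (at z)"
    and v': "\<And>z. z \<in> S \<Longrightarrow> (v' has_field_derivative z * v z) (at z)"
  shows "\<exists>c::complex. \<forall>z\<in>S. u z * v' z - u' z * v z = c"
proof -
  have "((\<lambda>z. u z * v' z - u' z * v z) has_field_derivative 0) (at z)" if "z \<in> S" for z
    by (rule derivative_eq_intros u u' v v' that refl)+ (simp add: algebra_simps)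
  then have "(\<lambda>z. u z * v' z - u' z * v z) constant_on S"
    by (intro has_field_derivative_0_imp_constant_on assms)
  then show ?thesis by (auto simp: constant_on_def)
qed

lemma airy_wronskian: "airy_f z * deriv airy_g z - deriv airy_f z * airy_g z = 1"
proof -
  have "\<exists>c. \<forall>z\<in>UNIV. airy_f z * deriv airy_g z - deriv airy_f z * airy_g z = c"
    by (rule wronskian_constant)
       (auto intro: field_differentiable_derivI airy_f_differentiable airy_g_differentiable airy_f_ode airy_g_ode)
  then obtain c where c: "\<And>z. airy_f z * deriv airy_g z - deriv airy_f z * airy_g z = c" by auto
  from c[of 0] c[of z] show ?thesis by (simp add: airy_f_0 airy_g_0 deriv_airy_f_0 deriv_airy_g_0)
qed

text \<open>Wronskians replace a uniqueness theorem: those of u with \<open>airy_g\<close> and with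
  \<open>airy_f\<close> are constant, and since the Wronskian of these two is 1, Cramer's rule
  recovers u.\<close>

lemma airy_solution_decompose:
  assumes "open S" "connected S"
    and u: "\<And>z. z \<in> S \<Longrightarrow> (u has_field_derivative u' z) (at z)"
    and u': "\<And>z. z \<in> S \<Longrightarrow> (u' has_field_derivative z * u z) (at z)"
  obtains \<alpha> \<beta> where "\<And>z. z \<in> S \<Longrightarrow> u z = \<alpha> * airy_f z + \<beta> * airy_g z"
proof -
  obtain \<alpha> where \<alpha>: "\<And>z. z \<in> S \<Longrightarrow> u z * deriv airy_g z - u' z * airy_g z = \<alpha>"
    using wronskian_constant[OF assms field_differentiable_derivI[OF airy_g_differentiable] airy_g_ode] by auto
  obtain \<beta> where \<beta>: "\<And>z. z \<in> S \<Longrightarrow> u z * deriv airy_f z - u' z * airy_f z = \<beta>"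
    using wronskian_constant[OF assms field_differentiable_derivI[OF airy_f_differentiable] airy_f_ode] by auto
  have "u z = \<alpha> * airy_f z + (- \<beta>) * airy_g z" if "z \<in> S" for z
  proof -
    have "\<alpha> * airy_f z + (- \<beta>) * airy_g z = u z * (airy_f z * deriv airy_g z - deriv airy_f z * airy_g z)"
      unfolding \<alpha>[OF that, symmetric] \<beta>[OF that, symmetric] by (simp add: algebra_simps)
    then show ?thesis by (simp add: airy_wronskian)
  qed
  then show ?thesis using that by blast
qed

text \<open>All coefficients are nonnegative, so a single term is a lower bound; k = 1 suffices
  because only unboundedness is needed.\<close>

lemma airy_f_ge: 
  assumes "y > 0"
  shows "norm (airy_f (of_real y)) \<ge> y ^ 3 / 6"
proof -
  have s: "summable (\<lambda>k. airy_f_coeff k * of_real y ^ (3 * k + 0))"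
    by (rule summable_cube_powser[OF norm_airy_f_coeff])
  have nn: "0 \<le> Re (airy_f_coeff k * of_real y ^ (3 * k + 0))" for k
  proof -
    have "airy_f_coeff k * of_real y ^ (3 * k + 0) = of_real (3 ^ k * pochhammer (1/3) k / fact (3 * k) * y ^ (3 * k))"
      by (simp add: airy_f_coeff_def pochhammer_of_real[symmetric])
    also have "Re \<dots> \<ge> 0"
      unfolding Re_complex_of_real using assms by (intro mult_nonneg_nonneg divide_nonneg_nonneg pochhammer_nonneg) auto
    finally show ?thesis .
  qed
  have "(\<Sum>k\<in>{1}. Re (airy_f_coeff k * of_real y ^ (3 * k + 0))) \<le> (\<Sum>k. Re (airy_f_coeff k * of_real y ^ (3 * k + 0)))"
    by (intro sum_le_suminf summable_Re s nn) auto
  also have "\<dots> = Re (airy_f (of_real y))"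
    using sums_unique[OF sums_Re[OF summable_sums[OF s]]] by (simp add: airy_f_def airy_f_coeff_def)
  also have "\<dots> \<le> norm (airy_f (of_real y))" by (rule complex_Re_le_cmod)
  finally show ?thesis
    by (simp add: airy_f_coeff_def fact_numeral flip: of_real_power)
qed

section \<open>The integral along the line of steepest descent\<close>

lemma normal_density_eq_gaussian:
  assumes "a > 0"
  shows "normal_density 0 (1 / sqrt (2 * a)) s = sqrt (a / pi) * exp (- a * s ^ 2)"
  using assms by (simp add: normal_density_def real_sqrt_divide power_divide)

lemma integrable_abs_power_gaussian:
  assumes "a > 0"
  shows "integrable lborel (\<lambda>s::real. \<bar>s\<bar> ^ m * exp (- a * s ^ 2))"
proof -
  have \<sigma>: "1 / sqrt (2 * a) > 0" using assms by simp
  have "integrable lborel (\<lambda>s. normal_density 0 (1 / sqrt (2 * a)) s * \<bar>s\<bar> ^ m)"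
  proof (cases "even m")
    case True
    then obtain k where m: "m = 2 * k" by (elim evenE)
    show ?thesis
      using integrable.intros[OF normal_moment_even[OF \<sigma>, of 0 k]]
      by (simp add: m power_mult)
  next
    case False
    then obtain k where m: "m = 2 * k + 1" by (elim oddE)
    show ?thesis
      using integrable.intros[OF normal_moment_abs_odd[OF \<sigma>, of 0 k]] by (simp add: m)
  qed
  then have "integrable lborel (\<lambda>s. sqrt (a / pi) * (\<bar>s\<bar> ^ m * exp (- a * s ^ 2)))"
    unfolding normal_density_eq_gaussian[OF assms] by (simp add: mult_ac)
  then have "sqrt (a / pi) = 0 \<or> integrable lborel (\<lambda>s::real. \<bar>s\<bar> ^ m * exp (- a * s ^ 2))"
    by (simp only: integrable_mult_left_iff)
  then show ?thesis using assms by auto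
qed

lemma integral_abs_cube_gaussian:
  fixes a :: real
  assumes "a > 0"
  shows "(\<integral>s. \<bar>s\<bar> ^ 3 * exp (- a * s ^ 2) \<partial>lborel) = 1 / a ^ 2"
proof -
  have \<sigma>: "1 / sqrt (2 * a) > 0" using assms by simp
  have "sqrt (a / pi) * (\<integral>s. \<bar>s\<bar> ^ 3 * exp (- a * s ^ 2) \<partial>lborel)
      = (\<integral>s. sqrt (a / pi) * (\<bar>s\<bar> ^ 3 * exp (- a * s ^ 2)) \<partial>lborel)"
    by simp
  also have "\<dots> = (\<integral>s. normal_density 0 (1 / sqrt (2 * a)) s * \<bar>s - 0\<bar> ^ (2 * 1 + 1) \<partial>lborel)"
    unfolding normal_density_eq_gaussian[OF assms]
    by (intro Bochner_Integration.integral_cong refl) (simp add: eval_nat_numeral)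
  also have "\<dots> = 2 ^ 1 * (1 / sqrt (2 * a)) ^ (2 * 1 + 1) * fact 1 * sqrt (2 / pi)"
    by (rule has_bochner_integral_integral_eq[OF normal_moment_abs_odd[OF \<sigma>]])
  also have "\<dots> = sqrt (a / pi) * (1 / a ^ 2)"
    using assms by (simp add: real_sqrt_mult real_sqrt_divide field_simps eval_nat_numeral)
  finally have "sqrt (a / pi) * (\<integral>s. \<bar>s\<bar> ^ 3 * exp (- a * s ^ 2) \<partial>lborel) = sqrt (a / pi) * (1 / a ^ 2)" .
  moreover have "sqrt (a / pi) \<noteq> 0" using assms by simp
  ultimately show ?thesis by (rule mult_left_cancel[THEN iffD1, rotated])
qed

text \<open>
  The integrand of the contour integral of \<open>exp (t\<^sup>3 / 3 - y t)\<close> on \<open>t = k + i s\<close>, \<open>k\<^sup>2 = y\<close>, without the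
  factor \<open>exp (- 2/3 k\<^sup>3)\<close>. The parameter \<open>b\<close> is \<open>1\<close>; the value \<open>0\<close> gives the Gaussian used for comparison.
\<close>

definition airy_kernel :: "real \<Rightarrow> complex \<Rightarrow> real \<Rightarrow> complex" where
  "airy_kernel b k s = exp (- k * of_real s ^ 2 - \<i> * of_real b * of_real s ^ 3 / 3)"

text \<open>Powers of s are included since differentiation in k multiplies the integrand by -s^2. In
  k the integrals are holomorphic for Re k > 0; the branch point in y enters only through k =
  \<open>csqrt y\<close>.\<close>

definition airy_int :: "real \<Rightarrow> nat \<Rightarrow> complex \<Rightarrow> complex" where
  "airy_int b m k = (\<integral>s. of_real s ^ m * airy_kernel b k s \<partial>lborel)"

text \<open>For real s and b the cubic term is purely imaginary, so the modulus is a Gaussian with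
  rate Re k. This gives convergence for Re k > 0, which is the whole slit plane in y = k^2.\<close>

lemma norm_airy_kernel: "norm (airy_kernel b k s) = exp (- Re k * s ^ 2)"
proof -
  have "- k * of_real s ^ 2 - \<i> * of_real b * of_real s ^ 3 / 3 = - (k * of_real (s ^ 2)) - \<i> * of_real (b * s ^ 3 / 3)"
    by simp
  then show ?thesis unfolding airy_kernel_def norm_exp_eq_Re by (simp del: of_real_power of_real_mult of_real_divide)
qed

lemma isCont_airy_kernel: "isCont (airy_kernel b k) s"
  unfolding airy_kernel_def[abs_def] by (intro continuous_intros) simp

lemma integrable_airy_kernel:
  assumes "Re k > 0"
  shows "integrable lborel (\<lambda>s. of_real s ^ m * airy_kernel b k s)"
proof (rule Bochner_Integration.integrable_bound[OF integrable_abs_power_gaussian[OF assms, of m]])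
  have "continuous_on UNIV (\<lambda>s. of_real s ^ m * airy_kernel b k s)"
    by (intro continuous_at_imp_continuous_on ballI continuous_intros isCont_airy_kernel)
  then show "(\<lambda>s. of_real s ^ m * airy_kernel b k s) \<in> borel_measurable lborel"
    by (simp add: borel_measurable_continuous_onI)
qed (simp add: norm_mult norm_power norm_airy_kernel)

text \<open>Reduces differentiation under the integral sign to one Taylor estimate, without a limit
  inside the integral.\<close>

lemma DERIV_quadratic_remainder:
  fixes f :: "complex \<Rightarrow> complex"
  assumes "d > 0" and bound: "\<And>h. norm h < d \<Longrightarrow> norm (f (x + h) - f x - D * h) \<le> B * norm h ^ 2"
  shows "(f has_field_derivative D) (at x)"
proof -
  have "((\<lambda>h. (f (x + h) - f x) / h - D) \<longlongrightarrow> 0) (at 0)"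
  proof (rule Lim_null_comparison)
    show "\<forall>\<^sub>F h in at 0. norm ((f (x + h) - f x) / h - D) \<le> \<bar>B\<bar> * norm h"
      unfolding eventually_at
    proof (intro exI[of _ d] conjI ballI impI assms)
      fix h :: complex assume h: "h \<noteq> 0 \<and> dist h 0 < d"
      have "norm ((f (x + h) - f x) / h - D) * norm h = norm (f (x + h) - f x - D * h)"
      proof -
        have "((f (x + h) - f x) / h - D) * h = f (x + h) - f x - D * h"
          using h by (subst left_diff_distrib) simp
        then show ?thesis by (metis norm_mult)
      qed
      also have "\<dots> \<le> B * norm h ^ 2" using h by (intro bound) simp
      also have "\<dots> \<le> (\<bar>B\<bar> * norm h) * norm h"
        unfolding power2_eq_square mult.assoc by (intro mult_right_mono) auto
      finally show "norm ((f (x + h) - f x) / h - D) \<le> \<bar>B\<bar> * norm h"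
        using h by simp
    qed
    have "((\<lambda>h::complex. \<bar>B\<bar> * norm h) \<longlongrightarrow> \<bar>B\<bar> * norm (0::complex)) (at 0)"
      by (intro tendsto_intros)
    then show "((\<lambda>h::complex. \<bar>B\<bar> * norm h) \<longlongrightarrow> 0) (at 0)" by simp
  qed
  then show ?thesis
    unfolding DERIV_def by (rule LIM_zero_cancel)
qed

lemma has_field_derivative_airy_int:
  assumes k: "Re k > 0"
  shows "(airy_int b m has_field_derivative - airy_int b (m + 2) k) (at k)"
proof (rule DERIV_quadratic_remainder)
  \<comment> \<open>Half of the Gaussian rate is given up: for |h| < a the growth exp (a s^2) of the
    Taylor remainder still leaves exp (-a s^2).\<close>
  define a where "a = Re k / 2"
  define B where "B = (\<integral>s. \<bar>s\<bar> ^ (m + 4) * exp (- a * s ^ 2) \<partial>lborel)"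
  show a: "a > 0" using k by (simp add: a_def)
  fix h :: complex assume h: "norm h < a"
  have k': "Re (k + h) > 0" using h abs_Re_le_cmod[of h] k by (simp add: a_def)
  let ?E = "airy_kernel b"
  define A where "A = (\<lambda>m k s. of_real s ^ m * ?E k s)"
  have A: "integrable lborel (A m k)" if "Re k > 0" for m k
    unfolding A_def by (rule integrable_airy_kernel[OF that])
  define R where "R = (\<lambda>s. A m (k + h) s - A m k s + h * A (m + 2) k s)"
  have int: "integrable lborel R"
    unfolding R_def by (intro Bochner_Integration.integrable_add Bochner_Integration.integrable_diff
        integrable_mult_right A k k')
  have A': "airy_int b m k = (\<integral>s. A m k s \<partial>lborel)" for m k
    by (simp only: A_def airy_int_def)
  have "airy_int b m (k + h) - airy_int b m k - (- airy_int b (m + 2) k) * h = (\<integral>s. R s \<partial>lborel)"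
    unfolding R_def A' using A[OF k] A[OF k'] by simp
  also have "norm \<dots> \<le> (\<integral>s. norm h ^ 2 * (\<bar>s\<bar> ^ (m + 4) * exp (- a * s ^ 2)) \<partial>lborel)"
  proof (rule Bochner_Integration.integral_norm_bound_integral)
    show "integrable lborel (\<lambda>s. norm h ^ 2 * (\<bar>s\<bar> ^ (m + 4) * exp (- a * s ^ 2)))"
      by (intro integrable_mult_right integrable_abs_power_gaussian a)
    fix s :: real
    define w where "w = - h * of_real s ^ 2"
    have "?E (k + h) s = ?E k s * exp w"
      unfolding airy_kernel_def w_def exp_add[symmetric] by (simp add: algebra_simps)
    \<comment> \<open>The sum over i \<le> 1 is 1 + w, so \<open>R s\<close> contains the
      second-order remainder of exp w.\<close>
    then have "R s = of_real s ^ m * ?E k s * (exp w - (\<Sum>i\<le>1. w ^ i / fact i))"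
      by (simp add: R_def A_def w_def algebra_simps power_add power2_eq_square)
    also have "norm \<dots> \<le> \<bar>s\<bar> ^ m * exp (- Re k * s ^ 2) * (exp \<bar>Re w\<bar> * norm w ^ Suc 1 / fact 1)"
      unfolding norm_mult norm_airy_kernel norm_power norm_of_real
      by (intro mult_left_mono Taylor_exp) auto
    also have "\<dots> \<le> \<bar>s\<bar> ^ m * exp (- Re k * s ^ 2) * (exp (a * s ^ 2) * (norm h * s ^ 2) ^ 2)"
    proof -
      have nw: "norm w = norm h * s ^ 2" by (simp add: w_def norm_mult norm_power)
      have "\<bar>Re w\<bar> \<le> norm h * s ^ 2" using abs_Re_le_cmod[of w] by (simp add: nw)
      also have "\<dots> \<le> a * s ^ 2" using h by (intro mult_right_mono) auto
      finally show ?thesis by (intro mult_left_mono) (auto simp: nw eval_nat_numeral intro!: mult_right_mono)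
    qed
    also have "\<dots> = norm h ^ 2 * (\<bar>s\<bar> ^ (m + 4) * (exp (- Re k * s ^ 2) * exp (a * s ^ 2)))"
      by (simp add: power_add power_mult_distrib flip: power_mult)
    also have "exp (- Re k * s ^ 2) * exp (a * s ^ 2) = exp (- a * s ^ 2)"
      unfolding exp_add[symmetric] by (simp add: a_def field_simps)
    finally show "norm (R s) \<le> norm h ^ 2 * (\<bar>s\<bar> ^ (m + 4) * exp (- a * s ^ 2))" .
  qed fact
  also have "\<dots> = B * norm h ^ 2" by (simp add: B_def)
  finally show "norm (airy_int b m (k + h) - airy_int b m k - (- airy_int b (m + 2) k) * h) \<le> B * norm h ^ 2" .
qed

lemma airy_kernel_tendsto_0:
  assumes k: "Re k > 0" and F: "filterlim (\<lambda>s::real. s ^ 2) at_top F"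
  shows "((\<lambda>s. of_real s ^ m * airy_kernel b k s) \<longlongrightarrow> 0) F"
proof (rule Lim_null_comparison)
  define a where "a = Re k"
  have a: "a > 0" using k by (simp add: a_def)
  show "\<forall>\<^sub>F s in F. norm (of_real s ^ m * airy_kernel b k s) \<le> (1 / a ^ m) * ((a * s ^ 2) ^ m / exp (a * s ^ 2))"
    using filterlim_at_top_dense[THEN iffD1, OF F, rule_format, of 1]
  proof eventually_elim
    case (elim s)
    then have "1 \<le> \<bar>s\<bar>" using abs_square_less_1[of s] by linarith
    then have "\<bar>s\<bar> ^ m \<le> \<bar>s\<bar> ^ (2 * m)" by (intro power_increasing) auto
    then have "\<bar>s\<bar> ^ m * exp (- a * s ^ 2) \<le> (s ^ 2) ^ m * exp (- a * s ^ 2)"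
      by (intro mult_right_mono) (auto simp: power_mult)
    also have "\<dots> = (1 / a ^ m) * ((a * s ^ 2) ^ m / exp (a * s ^ 2))"
      using a by (simp add: power_mult_distrib exp_minus field_simps)
    finally show ?case by (simp add: norm_mult norm_power norm_airy_kernel a_def)
  qed
  have "filterlim (\<lambda>s. a * s ^ 2) at_top F"
    by (rule filterlim_tendsto_pos_mult_at_top[OF tendsto_const a F])
  from filterlim_compose[OF tendsto_power_div_exp_0 this]
  show "((\<lambda>s. (1 / a ^ m) * ((a * s ^ 2) ^ m / exp (a * s ^ 2))) \<longlongrightarrow> 0) F"
    by (intro tendsto_mult_right_zero)
qed

text \<open>The derivative of s^m times the kernel integrates to 0. For m = 0 the truncated index m
  - 1 is multiplied by 0.\<close>

lemma airy_int_by_parts: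
  assumes k: "Re k > 0"
  shows "of_nat m * airy_int b (m - 1) k - 2 * k * airy_int b (m + 1) k - \<i> * of_real b * airy_int b (m + 2) k = 0"
proof -
  let ?E = "airy_kernel b k"
  define F where "F = (\<lambda>s. of_real s ^ m * ?E s)"
  define A where "A = (\<lambda>m s. of_real s ^ m * ?E s)"
  have A: "integrable lborel (A m)" for m
    unfolding A_def by (rule integrable_airy_kernel[OF k])
  have A': "airy_int b m k = (\<integral>s. A m s \<partial>lborel)" for m
    by (simp only: A_def airy_int_def)
  define f where "f = (\<lambda>s. of_nat m * A (m - 1) s - 2 * k * A (m + 1) s - \<i> * of_real b * A (m + 2) s)"
  have int: "integrable lborel f"
    unfolding f_def by (intro Bochner_Integration.integrable_diff integrable_mult_right A)
  have "((\<lambda>w. w ^ m * exp (- k * w ^ 2 - \<i> * of_real b * w ^ 3 / 3)) has_field_derivative f s) (at (of_real s))" for s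
    unfolding f_def A_def airy_kernel_def
    by (auto intro!: derivative_eq_intros simp: algebra_simps power_add eval_nat_numeral)
  then have F: "(F has_vector_derivative f s) (at s)" for s
    unfolding F_def airy_kernel_def by (rule has_vector_derivative_real_field)
  have lim: "filterlim (\<lambda>s::real. s ^ 2) at_top at_top" "filterlim (\<lambda>s::real. s ^ 2) at_top at_bot"
    by real_asymp+
  have "(LBINT s=-\<infinity>..\<infinity>. f s) = 0 - 0"
  proof (rule interval_integral_FTC_integrable)
    show "set_integrable lborel (einterval (- \<infinity>) \<infinity>) f"
      using int by (simp add: set_integrable_def)
    show "isCont f s" for s
      unfolding f_def A_def by (intro continuous_intros isCont_airy_kernel)
    show "((F \<circ> real_of_ereal) \<longlongrightarrow> 0) (at_right (- \<infinity>))"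
      unfolding ereal_tendsto_simps F_def by (rule airy_kernel_tendsto_0[OF k lim(2)])
    show "((F \<circ> real_of_ereal) \<longlongrightarrow> 0) (at_left \<infinity>)"
      unfolding ereal_tendsto_simps F_def by (rule airy_kernel_tendsto_0[OF k lim(1)])
  qed (simp_all add: F)
  then have "(\<integral>s. f s \<partial>lborel) = 0"
    by (simp add: interval_lebesgue_integral_def set_lebesgue_integral_def)
  then show ?thesis
    unfolding f_def A' using A by (simp del: One_nat_def add_2_eq_Suc add_2_eq_Suc')
qed

text \<open>Integration by parts for m = 0, 1, 2 eliminates the odd moments. Up to the exponential
  factor, the left-hand side is 4 k^2 times the defect of exp (-2/3 k^3) I_0(k) in the Airy equation
  with variable y = k^2.\<close>

lemma airy_int_ode:
  assumes k: "Re k > 0"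
  shows "4 * k ^ 2 * airy_int 1 2 k - 2 * k * airy_int 1 0 k + airy_int 1 4 k + airy_int 1 2 k / k = 0"
proof -
  have k0: "k \<noteq> 0" using k by auto
  define I where "I = (\<lambda>m. airy_int 1 m k)"
  have 0: "- (2 * k * I 1) = \<i> * I 2"
    using airy_int_by_parts[OF k, of 0 1] by (simp add: I_def del: One_nat_def add_2_eq_Suc add_2_eq_Suc')
  have 1: "\<i> * I 3 = I 0 - 2 * k * I 2"
    using airy_int_by_parts[OF k, of 1 1] by (simp add: I_def algebra_simps del: One_nat_def add_2_eq_Suc add_2_eq_Suc')
  have "2 * I 1 - 2 * k * I 3 - \<i> * I 4 = 0"
    using airy_int_by_parts[OF k, of 2 1] by (simp add: I_def algebra_simps del: add_2_eq_Suc add_2_eq_Suc')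
  then have "\<i> * (2 * I 1 - 2 * k * I 3 - \<i> * I 4) = 0" by simp
  then have "I 4 = 2 * k * (\<i> * I 3) - \<i> * (2 * I 1)"
    by (simp add: algebra_simps)
  moreover have "2 * I 1 = - (\<i> * I 2) / k" unfolding 0[symmetric] using k0 by simp
  ultimately have "4 * k ^ 2 * I 2 - 2 * k * I 0 + I 4 + I 2 / k = 0"
    unfolding 1 by (simp add: algebra_simps power2_eq_square)
  then show ?thesis by (simp add: I_def)
qed

text \<open>This is 2 pi Ai; the normalization is dropped, as a nonzero multiple of Ai is all that
  is used.\<close>

definition airy_decay :: "complex \<Rightarrow> complex" where
  "airy_decay y = exp (- 2/3 * csqrt y ^ 3) * airy_int 1 0 (csqrt y)"

lemma airy_decay_decompose:
  obtains \<alpha> \<beta> where "\<And>y. y \<notin> \<real>\<^sub>\<le>\<^sub>0 \<Longrightarrow> airy_decay y = \<alpha> * airy_f y + \<beta> * airy_g y"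
proof -
  define S :: "complex set" where "S = - \<real>\<^sub>\<le>\<^sub>0"
  \<comment> \<open>The derivative by dk/dy = 1 / (2 k): the exponential factor contributes -k, and
    I_0 becomes -I_2 / (2 k).\<close>
  define u' where "u' = (\<lambda>y. exp (- 2/3 * csqrt y ^ 3) *
      (- csqrt y * airy_int 1 0 (csqrt y) - airy_int 1 2 (csqrt y) / (2 * csqrt y)))"
  have S: "open S" "connected S"
  proof -
    have "(\<real>\<^sub>\<le>\<^sub>0 :: complex set) = of_real ` {..0}" by (auto simp: nonpos_Reals_def)
    then show "connected S"
      using starlike_imp_connected[OF starlike_slotted_complex_plane_left[of 0]] by (simp add: S_def)
  qed (simp add: S_def open_Compl)
  have K: "Re (csqrt y) > 0" "csqrt y \<noteq> 0" "csqrt y ^ 2 = y"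
    "(csqrt has_field_derivative inverse (2 * csqrt y)) (at y)" if "y \<in> S" for y
  proof -
    show "Re (csqrt y) > 0"
    proof (rule ccontr)
      assume "\<not> Re (csqrt y) > 0"
      then have "csqrt y = \<i> * of_real (Im (csqrt y))"
        using csqrt_principal[of y] by (simp add: complex_eq_iff)
      then have "y = of_real (- (Im (csqrt y) ^ 2))"
        by (metis power2_csqrt power_mult_distrib power2_i of_real_power of_real_minus mult_minus1)
      then show False using that nonpos_Reals_of_real_iff[of "- (Im (csqrt y) ^ 2)"] by (metis ComplD S_def neg_le_0_iff_le zero_le_power2)
    qed
    then show "csqrt y \<noteq> 0" by auto
    show "(csqrt has_field_derivative inverse (2 * csqrt y)) (at y)"
      using that by (intro has_field_derivative_csqrt) (auto simp: S_def)
  qed simp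
  have dI: "((\<lambda>y. airy_int 1 m (csqrt y)) has_field_derivative
      (- airy_int 1 (m + 2) (csqrt y)) * inverse (2 * csqrt y)) (at y)" if "y \<in> S" for m y
    by (rule DERIV_chain2[OF has_field_derivative_airy_int[OF K(1)[OF that]] K(4)[OF that]])
  have dE: "((\<lambda>y. exp (- 2/3 * csqrt y ^ 3)) has_field_derivative - csqrt y * exp (- 2/3 * csqrt y ^ 3)) (at y)"
    if "y \<in> S" for y
  proof -
    have "((\<lambda>k. exp (- 2/3 * k ^ 3)) has_field_derivative exp (- 2/3 * csqrt y ^ 3) * (- 2/3 * (of_nat 3 * csqrt y ^ 2))) (at (csqrt y))"
      by (auto intro!: derivative_eq_intros)
    from DERIV_chain2[OF this K(4)[OF that]] show ?thesis
      using K(2)[OF that] by (simp add: field_simps eval_nat_numeral)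
  qed
  have 1: "(airy_decay has_field_derivative u' y) (at y)" if "y \<in> S" for y
    unfolding airy_decay_def[abs_def] u'_def
    using DERIV_mult'[OF dE dI, OF that that, of 0] K(2)[OF that]
    by (simp add: field_simps numeral_2_eq_2)
  have 2: "(u' has_field_derivative y * airy_decay y) (at y)" if "y \<in> S" for y
  proof -
    define k where "k = csqrt y"
    have k0: "k \<noteq> 0" and yk: "y = k ^ 2" and Rk: "Re k > 0" using K that by (auto simp: k_def)
    define I where "I = (\<lambda>m. airy_int 1 m k)"
    have "(u' has_field_derivative
        exp (- 2/3 * k ^ 3) * ((- k * (- I 2 * inverse (2 * k)) + (- inverse (2 * k)) * I 0)
          - ((- I 4 * inverse (2 * k)) * (2 * k) - I 2 * (2 * inverse (2 * k))) / ((2 * k) * (2 * k)))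
        + (- k * exp (- 2/3 * k ^ 3)) * (- k * I 0 - I 2 / (2 * k))) (at y)"
    proof -
      have 0: "((\<lambda>y. airy_int 1 0 (csqrt y)) has_field_derivative - I 2 * inverse (2 * k)) (at y)"
        using dI[OF that, of 0] by (simp add: I_def k_def numeral_2_eq_2)
      have 2: "((\<lambda>y. airy_int 1 2 (csqrt y)) has_field_derivative - I 4 * inverse (2 * k)) (at y)"
        using dI[OF that, of 2] by (simp add: I_def k_def del: add_2_eq_Suc add_2_eq_Suc')
      have "2 * csqrt y \<noteq> 0" using K(2)[OF that] by simp
      from DERIV_mult'[OF dE[OF that] DERIV_diff[OF DERIV_mult'[OF DERIV_minus[OF K(4)[OF that]] 0]
          DERIV_divide[OF 2 DERIV_cmult[OF K(4)[OF that], of 2] this]]]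
      show ?thesis unfolding u'_def k_def I_def .
    qed
    also have "exp (- 2/3 * k ^ 3) * ((- k * (- I 2 * inverse (2 * k)) + (- inverse (2 * k)) * I 0)
          - ((- I 4 * inverse (2 * k)) * (2 * k) - I 2 * (2 * inverse (2 * k))) / ((2 * k) * (2 * k)))
        + (- k * exp (- 2/3 * k ^ 3)) * (- k * I 0 - I 2 / (2 * k))
      = exp (- 2/3 * k ^ 3) * (k ^ 2 * I 0 + I 2 - I 0 / (2 * k) + I 4 / (4 * k ^ 2) + I 2 / (4 * k ^ 3))"
      using k0 by (simp add: field_simps eval_nat_numeral)
    also have "k ^ 2 * I 0 + I 2 - I 0 / (2 * k) + I 4 / (4 * k ^ 2) + I 2 / (4 * k ^ 3)
       = k ^ 2 * I 0 + (4 * k ^ 2 * I 2 - 2 * k * I 0 + I 4 + I 2 / k) / (4 * k ^ 2)"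
      using k0 by (simp add: field_simps eval_nat_numeral)
    also have "\<dots> = y * I 0"
      using airy_int_ode[OF Rk] by (simp add: I_def yk)
    finally show ?thesis by (simp add: airy_decay_def I_def k_def mult_ac)
  qed
  show ?thesis
    using airy_solution_decompose[OF S 1 2] that unfolding S_def by auto
qed

text \<open>From I_0' = -I_2 and, by parts, I_0 = 2 k I_2, the product of I_0 and the square root of
  k has derivative 0 in the half-plane. The real Gaussian integral at k = 1 fixes the
  constant.\<close>

lemma airy_int_gaussian:
  assumes k: "Re k > 0"
  shows "airy_int 0 0 k = of_real (sqrt pi) / csqrt k"
proof -
  define S where "S = {k. Re k > 0}"
  have nS: "k \<in> S \<Longrightarrow> k \<notin> \<real>\<^sub>\<le>\<^sub>0 \<and> csqrt k \<noteq> 0" for k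
    by (auto simp: S_def complex_nonpos_Reals_iff)
  have conv: "convex S" unfolding S_def by (rule convex_halfspace_Re_gt)
  have "((\<lambda>k. airy_int 0 0 k * csqrt k) has_field_derivative 0) (at k)" if "k \<in> S" for k
  proof -
    have "((\<lambda>k. airy_int 0 0 k * csqrt k) has_field_derivative
        airy_int 0 0 k * inverse (2 * csqrt k) + (- airy_int 0 (0 + 2) k) * csqrt k) (at k)"
      using that nS by (intro DERIV_mult' has_field_derivative_airy_int has_field_derivative_csqrt) (auto simp: S_def)
    also have "airy_int 0 0 k = 2 * k * airy_int 0 2 k"
      using airy_int_by_parts[of k 1 0] that by (simp add: S_def del: One_nat_def add_2_eq_Suc add_2_eq_Suc')
    also have "2 * k * airy_int 0 2 k * inverse (2 * csqrt k) + (- airy_int 0 (0 + 2) k) * csqrt k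
       = airy_int 0 2 k * (k - csqrt k ^ 2) / csqrt k"
      using nS[OF that] by (simp add: field_simps power2_eq_square del: power2_csqrt One_nat_def add_2_eq_Suc add_2_eq_Suc')
    finally show ?thesis by simp
  qed
  then have "\<exists>c. \<forall>k\<in>S. airy_int 0 0 k * csqrt k = c"
    by (intro has_field_derivative_zero_constant[OF conv]) (auto intro: has_field_derivative_at_within)
  then obtain c where c: "\<And>k. k \<in> S \<Longrightarrow> airy_int 0 0 k * csqrt k = c" by blast
  have "airy_int 0 0 1 = integral\<^sup>L lborel (\<lambda>s. of_real (exp (- (s ^ 2))))"
    unfolding airy_int_def airy_kernel_def by (intro Bochner_Integration.integral_cong refl) (simp add: exp_of_real[symmetric])
  also have "\<dots> = of_real (integral\<^sup>L lborel (\<lambda>s. exp (- (s ^ 2))))" by (rule integral_complex_of_real)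
  also have "integral\<^sup>L lborel (\<lambda>s::real. exp (- (s ^ 2))) = sqrt pi"
    using has_bochner_integral_integral_eq[OF has_bochner_integral_even_function[OF gaussian_moment_0]] by simp
  finally have "c = of_real (sqrt pi)" using c[of 1] by (simp add: S_def)
  then show ?thesis using c[of k] nS[of k] k by (simp add: S_def field_simps)
qed

text \<open>The kernels differ by a factor exp (i t) with t = -s^3 / 3, and |exp (i t) - 1| \<le>
  |t|; the absolute third moment of the Gaussian gives the bound. Where Re k is comparable to |k|,
  the relative error has order |k|^(-3/2).\<close>

lemma airy_int_approx:
  assumes k: "Re k > 0"
  shows "norm (airy_int 1 0 k - of_real (sqrt pi) / csqrt k) \<le> 1 / Re k ^ 2"
proof -
  have "airy_int 1 0 k - airy_int 0 0 k = (\<integral>s. of_real s ^ 0 * airy_kernel 1 k s - of_real s ^ 0 * airy_kernel 0 k s \<partial>lborel)"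
    unfolding airy_int_def by (intro Bochner_Integration.integral_diff[symmetric] integrable_airy_kernel k)
  also have "norm \<dots> \<le> (\<integral>s. \<bar>s\<bar> ^ 3 * exp (- Re k * s ^ 2) \<partial>lborel)"
  proof (rule Bochner_Integration.integral_norm_bound_integral)
    show "integrable lborel (\<lambda>s. of_real s ^ 0 * airy_kernel 1 k s - of_real s ^ 0 * airy_kernel 0 k s)"
      by (intro Bochner_Integration.integrable_diff integrable_airy_kernel k)
    fix s :: real
    have "airy_kernel 1 k s - airy_kernel 0 k s = airy_kernel 0 k s * (exp (\<i> * of_real (- (s ^ 3) / 3)) - 1)"
      by (simp add: airy_kernel_def algebra_simps exp_add[symmetric])
    also have "norm \<dots> \<le> exp (- Re k * s ^ 2) * \<bar>- (s ^ 3) / 3\<bar>"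
      unfolding norm_mult norm_airy_kernel
      using dist_exp_i_1[of "- (s ^ 3) / 3"] abs_sin_le_one abs_sin_x_le_abs_x[of "- (s ^ 3) / 3 / 2"]
      by (intro mult_left_mono) (simp_all add: power_abs)
    also have "\<dots> \<le> \<bar>s\<bar> ^ 3 * exp (- Re k * s ^ 2)"
      by (simp add: power_abs)
    finally show "norm (of_real s ^ 0 * airy_kernel 1 k s - of_real s ^ 0 * airy_kernel 0 k s) \<le> \<bar>s\<bar> ^ 3 * exp (- Re k * s ^ 2)"
      by simp
  qed (intro integrable_abs_power_gaussian k)
  also have "\<dots> = 1 / Re k ^ 2" by (rule integral_abs_cube_gaussian[OF k])
  finally show ?thesis by (simp add: airy_int_gaussian[OF k])
qed

section \<open>The recessive solution\<close>

lemma integrable_on_cmult_exp_minus: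
  fixes f :: "real \<Rightarrow> real"
  shows "(\<lambda>r. c * exp (- r)) integrable_on {0::real..}"
  using has_integral_mult_right[OF has_integral_exp_minus_to_infinity[of 1 0], of c] by auto

text \<open>The substitution t = r^3 / 3 leads to Euler's integral for Gamma at (n + 1) / 3. It is
  carried out on the open half-line, since for n < 2 the power of t is singular at 0; the end point
  is a null set.\<close>

lemma has_integral_power_exp_cube:
  "((\<lambda>r::real. r ^ n * exp (- (r ^ 3) / 3)) has_integral
     3 powr ((real n - 2) / 3) * Gamma ((real n + 1) / 3)) {0..}"
proof -
  define x where "x = (real n + 1) / 3"
  have x: "x > 0" by (simp add: x_def)
  define f where "f = (\<lambda>t::real. t powr (x - 1) / exp t)"
  define g where "g = (\<lambda>r::real. r ^ 3 / 3)"
  have im: "g ` {0<..} = {0<..}"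
  proof (intro equalityI subsetI)
    fix t :: real assume t: "t \<in> {0<..}"
    then have "t = g (root 3 (3 * t))" by (simp add: g_def)
    moreover have "root 3 (3 * t) \<in> {0<..}" using t by simp
    ultimately show "t \<in> g ` {0<..}" by blast
  qed (auto simp: g_def)
  have "(f has_integral Gamma x) {0..}"
    unfolding f_def using Gamma_integral_real[OF x] .
  then have fi: "(f has_integral Gamma x) {0<..}"
    by (rule has_integral_spike_set_eq[THEN iffD1, rotated -1]) (auto intro: negligible_subset[of "{0}"])
  have f_abs: "f absolutely_integrable_on {0<..}"
    by (rule nonnegative_absolutely_integrable_1) (use fi in \<open>auto simp: f_def integrable_on_def\<close>)
  have "(\<lambda>r. \<bar>r ^ 2\<bar> * f (g r)) absolutely_integrable_on {0<..} \<and> integral {0<..} (\<lambda>r. \<bar>r ^ 2\<bar> * f (g r)) = Gamma x"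
  proof -
    have "(\<lambda>r. \<bar>r ^ 2\<bar> * f (g r)) absolutely_integrable_on {0<..} \<and> integral {0<..} (\<lambda>r. \<bar>r ^ 2\<bar> * f (g r)) = Gamma x
       \<longleftrightarrow> f absolutely_integrable_on (g ` {0<..}) \<and> integral (g ` {0<..}) f = Gamma x"
    proof (rule has_absolute_integral_change_of_variables_1')
      show "inj_on g {0<..}" by (auto simp: inj_on_def g_def power_eq_iff_eq_base)
      show "(g has_field_derivative r ^ 2) (at r within {0<..})" for r
        unfolding g_def by (auto intro!: derivative_eq_intros)
    qed simp
    then show ?thesis using f_abs fi im by (simp add: integral_unique)
  qed
  then have "((\<lambda>r. \<bar>r ^ 2\<bar> * f (g r)) has_integral Gamma x) {0<..}"
    by (metis absolutely_integrable_on_def has_integral_integral)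
  then have "((\<lambda>r. 3 powr (x - 1) * (\<bar>r ^ 2\<bar> * f (g r))) has_integral 3 powr (x - 1) * Gamma x) {0<..}"
    by (rule has_integral_mult_right)
  then have "((\<lambda>r. r ^ n * exp (- (r ^ 3) / 3)) has_integral 3 powr (x - 1) * Gamma x) {0<..}"
  proof (rule has_integral_eq[rotated])
    fix r :: real assume r: "r \<in> {0<..}"
    have "g r powr (x - 1) = (r powr 3) powr (x - 1) / 3 powr (x - 1)"
      using r by (simp add: g_def powr_divide)
    also have "(r powr 3) powr (x - 1) = r powr (real n - 2)"
    proof -
      have "3 * (x - 1) = real n - 2" by (simp add: x_def)
      then show ?thesis by (simp only: powr_powr)
    qed
    also have "\<dots> = r ^ n / r ^ 2"
      using r by (simp add: powr_diff powr_realpow)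
    finally show "3 powr (x - 1) * (\<bar>r ^ 2\<bar> * f (g r)) = r ^ n * exp (- (r ^ 3) / 3)"
      using r by (simp add: f_def g_def exp_minus field_simps)
  qed
  then have "((\<lambda>r. r ^ n * exp (- (r ^ 3) / 3)) has_integral 3 powr (x - 1) * Gamma x) {0..}"
    by (rule has_integral_spike_set_eq[THEN iffD1, rotated -1]) (auto intro: negligible_subset[of "{0}"])
  moreover have "x - 1 = (real n - 2) / 3" by (simp add: x_def field_simps)
  ultimately show ?thesis unfolding x_def[symmetric] by (simp only:)
qed

text \<open>The integral of r^n exp (-r^3 / 3) over r \<ge> 0.\<close>

definition airy_moment :: "nat \<Rightarrow> real" where
  "airy_moment n = 3 powr ((real n - 2) / 3) * Gamma ((real n + 1) / 3)"

text \<open>The functional equation of Gamma produces the numerator of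
  \<open>airy_f_coeff m\<close>: integrating (y r)^(3 m) / (3 m)! against the weight reproduces the
  series of f up to the factor \<open>airy_moment 0\<close>.\<close>

lemma airy_moment_0_mod_3: "airy_moment (3 * m) = 3 ^ m * pochhammer (1/3) m * airy_moment 0"
proof -
  have "pochhammer (1/3) m = Gamma (1/3 + real m) / Gamma (1/3)"
    by (rule pochhammer_Gamma) (auto elim!: nonpos_Ints_cases)
  moreover have "Gamma (1/3 :: real) \<noteq> 0" by (rule less_imp_neq[OF Gamma_real_pos, symmetric]) simp
  moreover have "3 powr ((real (3 * m) - 2) / 3) = (3 ^ m * 3 powr (- 2/3) :: real)"
  proof -
    have "(real (3 * m) - 2) / 3 = real m + (- 2/3)" by (simp add: field_simps)
    then show ?thesis by (simp only: powr_add powr_realpow)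
  qed
  moreover have e: "(real (3 * m) + 1) / 3 = 1/3 + real m" by (simp add: field_simps)
  ultimately show ?thesis unfolding airy_moment_def e by simp
qed

lemma airy_moment_1_mod_3: "airy_moment (3 * m + 1) = 3 ^ m * pochhammer (2/3) m * airy_moment 1"
proof -
  have "pochhammer (2/3) m = Gamma (2/3 + real m) / Gamma (2/3)"
    by (rule pochhammer_Gamma) (auto elim!: nonpos_Ints_cases)
  moreover have "Gamma (2/3 :: real) \<noteq> 0" by (rule less_imp_neq[OF Gamma_real_pos, symmetric]) simp
  moreover have "3 powr ((real (3 * m + 1) - 2) / 3) = (3 ^ m * 3 powr (- 1/3) :: real)"
  proof -
    have "(real (3 * m + 1) - 2) / 3 = real m + (- 1/3)" by (simp add: field_simps)
    then show ?thesis by (simp only: powr_add powr_realpow)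
  qed
  moreover have e: "(real (3 * m + 1) + 1) / 3 = 2/3 + real m" by (simp add: field_simps)
  ultimately show ?thesis unfolding airy_moment_def e by simp
qed

definition cube_root_1 :: complex where
  "cube_root_1 = cis (2 * pi / 3)"

lemma cube_root_1_eq: "cube_root_1 = Complex (- 1/2) (sqrt 3 / 2)"
  using cos_120 sin_120 by (simp add: cube_root_1_def complex_eq_iff)

lemma cube_root_1_cube: "cube_root_1 ^ 3 = 1"
  unfolding cube_root_1_def Complex.DeMoivre by simp

lemma cube_root_1_sum: "cube_root_1 ^ 2 = - 1 - cube_root_1"
  by (simp add: cube_root_1_eq power2_eq_square complex_eq_iff)

lemma cube_root_1_neq_1: "cube_root_1 \<noteq> 1"
  by (simp add: cube_root_1_eq complex_eq_iff)

text \<open>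
  With \<open>\<omega>\<close> the cube root of unity, \<open>h t = (exp (\<omega> t) - \<omega> exp (\<omega>\<^sup>2 t)) / (1 - \<omega>)\<close> has the Taylor series
  \<open>\<Sum> t\<^sup>3\<^sup>m / (3 m)! - t\<^sup>3\<^sup>m\<^sup>+\<^sup>1 / (3 m + 1)!\<close>, so the combination is the integral of
  \<open>exp (- r\<^sup>3 / 3) h (y r)\<close> over \<open>r \<ge> 0\<close>, and \<open>h\<close> is bounded there.
\<close>

lemma bounded_moment_combination:
  assumes y: "y > 0"
  shows "norm (of_real (airy_moment 0) * airy_f (of_real y) - of_real (airy_moment 1) * airy_g (of_real y))
     \<le> 3 * (norm (1 / (1 - cube_root_1)) + norm (cube_root_1 / (1 - cube_root_1)))"
proof -
  define \<omega> where "\<omega> = cube_root_1"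
  define p where "p = 1 / (1 - \<omega>)"
  define q where "q = - \<omega> / (1 - \<omega>)"
  \<comment> \<open>c n is 1, -1 or 0 for n mod 3 equal to 0, 1 or 2, and c n / n! are the Taylor
    coefficients of h.\<close>
  define c where "c = (\<lambda>n. p * \<omega> ^ n + q * (\<omega> ^ 2) ^ n)"
  define w where "w = (\<lambda>r::real. exp (- (r ^ 3) / 3))"
  define summand where "summand = (\<lambda>n (r::real). c n * of_real (y ^ n / fact n) * of_real (r ^ n * w r))"
  define H where "H = (\<lambda>r::real. of_real (w r) * (p * exp (\<omega> * of_real (y * r)) + q * exp (\<omega> ^ 2 * of_real (y * r))))"
  define K where "K = norm p + norm q"
  have \<omega>1: "\<omega> \<noteq> 1" and \<omega>2: "\<omega> ^ 2 = - 1 - \<omega>" and \<omega>3: "\<omega> ^ 3 = 1"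
    by (auto simp: \<omega>_def cube_root_1_neq_1 cube_root_1_sum cube_root_1_cube)
  have n\<omega>: "norm \<omega> = 1" by (simp add: \<omega>_def cube_root_1_def)
  have Re\<omega>: "Re \<omega> = - 1/2" "Re (\<omega> ^ 2) = - 1/2"
    by (simp_all add: \<omega>2) (simp_all add: \<omega>_def cube_root_1_eq)
  have K: "K \<ge> 0" by (simp add: K_def)
  have summand_int: "(summand n has_integral c n * of_real (y ^ n / fact n * airy_moment n)) {0..}" for n
  proof -
    have "((\<lambda>r. of_real (r ^ n * w r) :: complex) has_integral of_real (airy_moment n)) {0..}"
      unfolding w_def airy_moment_def by (rule has_integral_of_real[OF has_integral_power_exp_cube])
    from has_integral_mult_right[OF this, of "c n * of_real (y ^ n / fact n)"]
    show ?thesis by (simp only: summand_def[abs_def] of_real_mult mult.assoc)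
  qed
  have summand_sums: "(\<lambda>n. summand n r) sums H r" for r
  proof -
    have "(\<lambda>n. (a * of_real (y * r)) ^ n /\<^sub>R fact n) sums exp (a * of_real (y * r))" for a :: complex
      by (rule exp_converges)
    then have "(\<lambda>n. of_real (w r) * (p * ((\<omega> * of_real (y * r)) ^ n /\<^sub>R fact n) + q * ((\<omega> ^ 2 * of_real (y * r)) ^ n /\<^sub>R fact n))) sums H r"
      unfolding H_def by (intro sums_mult sums_add)
    also have "(\<lambda>n. of_real (w r) * (p * ((\<omega> * of_real (y * r)) ^ n /\<^sub>R fact n) + q * ((\<omega> ^ 2 * of_real (y * r)) ^ n /\<^sub>R fact n))) = (\<lambda>n. summand n r)"
      by (intro ext) (simp add: summand_def c_def power_mult_distrib scaleR_conv_of_real field_simps)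
    finally show ?thesis .
  qed
  \<comment> \<open>This majorant depends on y and only serves to exchange sum and integral. Up to r
    = 3 (y + 1) + 1 the term (y + 1) r is at most the exponent chosen; beyond, r^2 \<ge> 3 (y + 1)
    lets the cubic win.\<close>
  define C where "C = exp ((y + 1) * (3 * (y + 1) + 1))"
  have w_bound: "w r * exp (y * r) \<le> C * exp (- r)" if "r \<ge> 0" for r
  proof -
    have "(y + 1) * r - r ^ 3 / 3 \<le> (y + 1) * (3 * (y + 1) + 1)"
    proof (cases "r \<le> 3 * (y + 1) + 1")
      case True
      then have "(y + 1) * r \<le> (y + 1) * (3 * (y + 1) + 1)" using y by (intro mult_left_mono) auto
      moreover have "r ^ 3 / 3 \<ge> 0" using that by simp
      ultimately show ?thesis by linarith
    next
      case False
      then have "r \<ge> 1" "3 * (y + 1) \<le> r" using y by auto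
      then have "3 * (y + 1) * 1 \<le> r * r" using y by (intro mult_mono) auto
      then have "3 * (y + 1) * r \<le> r * r * r" using that by (intro mult_right_mono) auto
      then have "(y + 1) * r - r ^ 3 / 3 \<le> 0" by (simp add: power3_eq_cube algebra_simps)
      also have "0 \<le> (y + 1) * (3 * (y + 1) + 1)" using y by simp
      finally show ?thesis .
    qed
    then have "- (r ^ 3) / 3 + y * r \<le> (y + 1) * (3 * (y + 1) + 1) + - r" by (simp add: algebra_simps)
    then show ?thesis by (simp add: w_def C_def flip: exp_add)
  qed
  have partial_bound: "norm (\<Sum>n<N. summand n r) \<le> K * C * exp (- r)" if "r \<in> {0..}" for N r
  proof -
    have r: "r \<ge> 0" using that by simp
    have cb: "norm (c n) \<le> K" for n
      unfolding c_def K_def by (rule order_trans[OF norm_triangle_ineq]) (simp add: norm_mult norm_power n\<omega>)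
    have "norm (\<Sum>n<N. summand n r) \<le> (\<Sum>n<N. K * w r * ((y * r) ^ n /\<^sub>R fact n))"
    proof (rule sum_norm_le)
      fix n
      have "norm (summand n r) = norm (c n) * (w r * ((y * r) ^ n / fact n))"
        using r y by (simp add: summand_def norm_mult norm_divide norm_power w_def power_mult_distrib)
      also have "\<dots> \<le> K * (w r * ((y * r) ^ n / fact n))"
        using cb r y by (intro mult_right_mono) (auto simp: w_def)
      finally show "norm (summand n r) \<le> K * w r * ((y * r) ^ n /\<^sub>R fact n)"
        by (simp add: field_simps)
    qed
    also have "\<dots> = K * w r * (\<Sum>n<N. (y * r) ^ n /\<^sub>R fact n)" by (simp add: sum_distrib_left)
    also have "\<dots> \<le> K * w r * exp (y * r)"
    proof (rule mult_left_mono)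
      show "(\<Sum>n<N. (y * r) ^ n /\<^sub>R fact n) \<le> exp (y * r)"
        unfolding exp_def using r y by (intro sum_le_suminf summable_exp_generic) auto
    qed (use K in \<open>simp add: w_def\<close>)
    also have "\<dots> = K * (w r * exp (y * r))" by simp
    also have "\<dots> \<le> K * (C * exp (- r))" using w_bound[OF r] K by (intro mult_left_mono)
    finally show ?thesis by (simp add: mult.assoc)
  qed
  have dom: "(\<lambda>r. K * C * exp (- r)) integrable_on {0::real..}"
    by (rule integrable_on_cmult_exp_minus)
  have psum: "((\<lambda>r. \<Sum>n<N. summand n r) has_integral (\<Sum>n<N. c n * of_real (y ^ n / fact n * airy_moment n))) {0..}" for N
    by (intro has_integral_sum summand_int) auto
  have conv: "\<And>r. r \<in> {0..} \<Longrightarrow> (\<lambda>N. \<Sum>n<N. summand n r) \<longlonglongrightarrow> H r"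
    using summand_sums by (simp add: sums_def)
  note dc = dominated_convergence[OF has_integral_integrable[OF psum] dom partial_bound conv]
  have "(\<lambda>n. c n * of_real (y ^ n / fact n * airy_moment n)) sums integral {0..} H"
    using dc(2) unfolding integral_unique[OF psum] by (simp add: sums_def)
  \<comment> \<open>A block of three terms holds one term of f, one of g and a zero.\<close>
  from sums_group[OF this, of 3]
  have grouped: "(\<lambda>m. \<Sum>n\<in>{m * 3..<m * 3 + 3}. c n * of_real (y ^ n / fact n * airy_moment n)) sums integral {0..} H"
    by simp
  have c0: "c (3 * m) = 1" and c1: "c (3 * m + 1) = - 1" and c2: "c (3 * m + 2) = 0" for m
  proof -
    have p: "p - \<omega> * p = 1" and q: "q = - \<omega> * p"
      using \<omega>1 by (simp_all add: p_def q_def divide_simps)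
    have e: "\<omega> ^ (3 * m + i) = \<omega> ^ i" "(\<omega> ^ 2) ^ (3 * m + i) = (\<omega> ^ 2) ^ i" for i
    proof -
      show "\<omega> ^ (3 * m + i) = \<omega> ^ i" by (simp add: power_add power_mult \<omega>3)
      have "(\<omega> ^ 2) ^ 3 = 1" using \<omega>3 by (metis power_mult mult.commute power_one)
      then show "(\<omega> ^ 2) ^ (3 * m + i) = (\<omega> ^ 2) ^ i" by (simp add: power_add power_mult)
    qed
    show "c (3 * m) = 1"
      using e[of 0] p by (simp add: c_def q)
    have "q * \<omega> ^ 2 = - p * \<omega> ^ 3"
      by (simp add: q power2_eq_square power3_eq_cube)
    then have "p * \<omega> ^ 1 + q * (\<omega> ^ 2) ^ 1 = - (p - \<omega> * p)"
      by (simp add: \<omega>3)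
    then show "c (3 * m + 1) = - 1"
      unfolding c_def e p .
    have "q * (\<omega> ^ 2) ^ 2 = - (p * \<omega> ^ 2 * \<omega> ^ 3)"
      by (simp add: q power2_eq_square power3_eq_cube)
    then show "c (3 * m + 2) = 0"
      unfolding c_def e by (simp add: \<omega>3)
  qed
  have "(\<Sum>n\<in>{m * 3..<m * 3 + 3}. c n * of_real (y ^ n / fact n * airy_moment n))
      = of_real (airy_moment 0) * (airy_f_coeff m * of_real y ^ (3 * m + 0)) - of_real (airy_moment 1) * (airy_g_coeff m * of_real y ^ (3 * m + 1))" for m
  proof -
    have "{m * 3..<m * 3 + 3} = {3 * m, 3 * m + 1, 3 * m + 2}" by auto
    then have "(\<Sum>n\<in>{m * 3..<m * 3 + 3}. c n * of_real (y ^ n / fact n * airy_moment n))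
      = of_real (y ^ (3 * m) / fact (3 * m) * airy_moment (3 * m)) - of_real (y ^ (3 * m + 1) / fact (3 * m + 1) * airy_moment (3 * m + 1))"
      using c0[of m] c1[of m] c2[of m] by simp
    also have "\<dots> = of_real (airy_moment 0) * (airy_f_coeff m * of_real y ^ (3 * m + 0)) - of_real (airy_moment 1) * (airy_g_coeff m * of_real y ^ (3 * m + 1))"
      unfolding airy_moment_0_mod_3 airy_moment_1_mod_3
      by (simp add: airy_f_coeff_def airy_g_coeff_def pochhammer_of_real[symmetric] mult_ac del: fact_Suc)
    finally show ?thesis .
  qed
  with grouped have 1: "(\<lambda>m. of_real (airy_moment 0) * (airy_f_coeff m * of_real y ^ (3 * m + 0)) - of_real (airy_moment 1) * (airy_g_coeff m * of_real y ^ (3 * m + 1))) sums integral {0..} H"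
    by simp
  have "(\<lambda>m. of_real (airy_moment 0) * (airy_f_coeff m * of_real y ^ (3 * m + 0)) - of_real (airy_moment 1) * (airy_g_coeff m * of_real y ^ (3 * m + 1)))
     sums (of_real (airy_moment 0) * airy_f (of_real y) - of_real (airy_moment 1) * airy_g (of_real y))"
    using summable_sums[OF summable_cube_powser[OF norm_airy_f_coeff, of "of_real y" 0]]
      summable_sums[OF summable_cube_powser[OF norm_airy_g_coeff, of "of_real y" 1]]
    by (intro sums_diff sums_mult) (simp_all add: airy_f_def airy_f_coeff_def airy_g_def airy_g_coeff_def)
  from sums_unique2[OF this 1]
  have "norm (of_real (airy_moment 0) * airy_f (of_real y) - of_real (airy_moment 1) * airy_g (of_real y)) = norm (integral {0..} H)"
    by simp
  also have "\<dots> \<le> integral {0..} (\<lambda>r. 3 * K * exp (- r))"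
  proof (rule Henstock_Kurzweil_Integration.integral_norm_bound_integral[OF dc(1) integrable_on_cmult_exp_minus])
    fix r :: real assume "r \<in> {0..}"
    then have r: "r \<ge> 0" by simp
    \<comment> \<open>Uniformity in y arises here: \<omega> and its square have real part -1/2, so
      both exponentials are at most 1.\<close>
    have "norm (p * exp (\<omega> * of_real (y * r)) + q * exp (\<omega> ^ 2 * of_real (y * r))) \<le> norm p * exp (- 1/2 * (y * r)) + norm q * exp (- 1/2 * (y * r))"
      by (rule order_trans[OF norm_triangle_ineq]) (simp add: norm_mult Re\<omega>)
    also have "\<dots> \<le> norm p * 1 + norm q * 1"
      using r y by (intro add_mono mult_left_mono) auto
    finally have h: "norm (p * exp (\<omega> * of_real (y * r)) + q * exp (\<omega> ^ 2 * of_real (y * r))) \<le> K" by (simp add: K_def)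
    have "r - r ^ 3 / 3 \<le> 1"
    proof -
      have "0 \<le> (r - 1) ^ 2 * (r + 2)" using r by simp
      then show ?thesis by (simp add: power2_eq_square power3_eq_cube algebra_simps)
    qed
    then have "w r \<le> exp 1 * exp (- r)" by (simp add: w_def flip: exp_add)
    also have "\<dots> \<le> 3 * exp (- r)" using exp_le by (intro mult_right_mono) auto
    finally have "w r * norm (p * exp (\<omega> * of_real (y * r)) + q * exp (\<omega> ^ 2 * of_real (y * r))) \<le> (3 * exp (- r)) * K"
      using h by (intro mult_mono) auto
    then show "norm (H r) \<le> 3 * K * exp (- r)"
      by (simp add: H_def norm_mult w_def mult_ac)
  qed
  also have "\<dots> = 3 * K"
    using integral_unique[OF has_integral_mult_right[OF has_integral_exp_minus_to_infinity[of 1 0], of "3 * K"]] by simp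
  also have "\<dots> = 3 * (norm (1 / (1 - cube_root_1)) + norm (cube_root_1 / (1 - cube_root_1)))"
    by (simp add: K_def p_def q_def \<omega>_def norm_divide)
  finally show ?thesis .
qed

text \<open>Ai up to the positive factor Gamma(1/3) Gamma(2/3); in this form the coefficients are
  moments.\<close>

definition airy_recessive :: "complex \<Rightarrow> complex" where
  "airy_recessive y = of_real (airy_moment 0) * airy_f y - of_real (airy_moment 1) * airy_g y"

lemma airy_moment_pos: "airy_moment n > 0"
  unfolding airy_moment_def by (intro mult_pos_pos Gamma_real_pos) auto

lemma norm_airy_decay_le:
  assumes "y \<ge> 1"
  shows "norm (airy_decay (of_real y)) \<le> sqrt pi + 1"
proof -
  define k where "k = sqrt y"
  have k: "k \<ge> 1" using assms by (simp add: k_def)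
  have csq: "csqrt (of_real y) = of_real k" using assms by (simp add: k_def csqrt_of_real_nonneg)
  have "norm (airy_int 1 0 (of_real k)) \<le> norm (of_real (sqrt pi) / csqrt (of_real k)) + 1 / k ^ 2"
    using airy_int_approx[of "of_real k"] norm_triangle_sub[of "airy_int 1 0 (of_real k)" "of_real (sqrt pi) / csqrt (of_real k)"] k
    by simp
  also have "norm (of_real (sqrt pi) / csqrt (of_real k)) = sqrt pi / sqrt k"
    using k by (simp add: norm_divide csqrt_of_real_nonneg)
  also have "sqrt pi / sqrt k \<le> sqrt pi / 1" using k by (intro divide_left_mono) auto
  also have "1 / k ^ 2 \<le> 1" using k by simp
  finally have 1: "norm (airy_int 1 0 (of_real k)) \<le> sqrt pi + 1" by simp
  have "norm (exp (- 2/3 * of_real k ^ 3 :: complex)) = exp (- 2/3 * k ^ 3)"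
    by (simp flip: of_real_power)
  also have "\<dots> \<le> 1" using k by simp
  finally have "norm (exp (- 2/3 * of_real k ^ 3 :: complex)) * norm (airy_int 1 0 (of_real k)) \<le> 1 * (sqrt pi + 1)"
    using 1 by (intro mult_mono) auto
  then show ?thesis by (simp add: airy_decay_def csq norm_mult)
qed

text \<open>At k = 1 the Gaussian approximation has error at most 1, less than sqrt pi.\<close>

lemma airy_decay_1_nonzero: "airy_decay 1 \<noteq> 0"
proof
  assume "airy_decay 1 = 0"
  then have "airy_int 1 0 1 = 0" by (simp add: airy_decay_def)
  then have "sqrt pi \<le> 1" using airy_int_approx[of 1] by simp
  then show False using pi_gt3 by simp
qed

text \<open>
  Both functions are bounded on the positive axis; were they independent, \<open>airy_f\<close> would be
  bounded there, too.
\<close>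

lemma airy_recessive_eq_decay:
  obtains \<kappa> where "\<kappa> \<noteq> 0" "\<And>y. y \<notin> \<real>\<^sub>\<le>\<^sub>0 \<Longrightarrow> airy_recessive y = \<kappa> * airy_decay y"
proof -
  define M0 M1 where "M0 = (of_real (airy_moment 0) :: complex)" and "M1 = (of_real (airy_moment 1) :: complex)"
  have M: "M0 \<noteq> 0" using airy_moment_pos[of 0] by (simp add: M0_def)
  obtain \<alpha> \<beta> where dec: "\<And>y. y \<notin> \<real>\<^sub>\<le>\<^sub>0 \<Longrightarrow> airy_decay y = \<alpha> * airy_f y + \<beta> * airy_g y"
    using airy_decay_decompose by blast
  define B where "B = 3 * (norm (1 / (1 - cube_root_1)) + norm (cube_root_1 / (1 - cube_root_1)))"
  define D where "D = norm \<beta> * B + norm M1 * (sqrt pi + 1)"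
  have D0: "D \<ge> 0" by (auto simp: D_def B_def intro!: add_nonneg_nonneg mult_nonneg_nonneg)
  \<comment> \<open>\<beta> \<open>airy_recessive\<close> + M1 \<open>airy_decay\<close> cancels
    \<open>airy_g\<close> and leaves a multiple of the unbounded \<open>airy_f\<close>, whose
    coefficient must therefore vanish.\<close>
  have bound: "norm (\<beta> * M0 + \<alpha> * M1) * (y ^ 3 / 6) \<le> D" if y: "y \<ge> 1" for y :: real
  proof -
    have "norm (\<beta> * M0 + \<alpha> * M1) * (y ^ 3 / 6) \<le> norm (\<beta> * M0 + \<alpha> * M1) * norm (airy_f (of_real y))"
      using airy_f_ge[of y] y by (intro mult_left_mono) auto
    also have "\<dots> = norm (\<beta> * airy_recessive (of_real y) + M1 * airy_decay (of_real y))"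
      using y by (subst dec) (auto simp: airy_recessive_def M0_def M1_def algebra_simps norm_mult[symmetric])
    also have "\<dots> \<le> norm \<beta> * norm (airy_recessive (of_real y)) + norm M1 * norm (airy_decay (of_real y))"
      by (rule order_trans[OF norm_triangle_ineq]) (simp add: norm_mult)
    also have "\<dots> \<le> D"
      unfolding D_def B_def airy_recessive_def using y
      by (intro add_mono mult_left_mono bounded_moment_combination norm_airy_decay_le) auto
    finally show ?thesis .
  qed
  have lin: "\<beta> * M0 + \<alpha> * M1 = 0"
  proof (rule ccontr)
    assume n: "\<beta> * M0 + \<alpha> * M1 \<noteq> 0"
    define n where "n = norm (\<beta> * M0 + \<alpha> * M1)"
    have n: "n > 0" using n by (simp add: n_def)
    define y where "y = 1 + 6 * (D + 1) / n"
    have y: "y \<ge> 1" using n D0 by (simp add: y_def)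
    have "6 * (D + 1) / n \<le> y" by (simp add: y_def)
    also have "y \<le> y ^ 3" using y by (metis power_increasing power_one_right one_le_numeral)
    finally have "6 * (D + 1) \<le> y ^ 3 * n" using n by (simp add: pos_divide_le_eq)
    moreover have "n * y ^ 3 \<le> 6 * D" using bound[OF y] unfolding n_def[symmetric] by simp
    ultimately show False by (simp add: mult.commute)
  qed
  have eq: "M0 * airy_decay y = \<alpha> * airy_recessive y" if "y \<notin> \<real>\<^sub>\<le>\<^sub>0" for y
  proof -
    have "M0 * airy_decay y = \<alpha> * M0 * airy_f y + (\<beta> * M0) * airy_g y"
      unfolding dec[OF that] by (simp add: algebra_simps)
    also have "\<beta> * M0 = - \<alpha> * M1" using lin by (simp add: add_eq_0_iff2)
    finally show ?thesis by (simp add: airy_recessive_def M0_def M1_def algebra_simps)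
  qed
  have "\<alpha> \<noteq> 0" using eq[of 1] airy_decay_1_nonzero M by auto
  then show ?thesis
    using that[of "M0 / \<alpha>"] eq M by (simp add: field_simps)
qed

text \<open>
  The square root of \<open>exp (2 i \<rho>) b\<^sup>2 (- z)\<close>.
\<close>

definition sqrt_arg :: "real \<Rightarrow> real \<Rightarrow> complex \<Rightarrow> complex" where
  "sqrt_arg \<rho> b z = exp (\<i> * of_real \<rho> + of_real (ln b) + Ln (- z) / 2)"

section \<open>Behaviour of the integral in sectors\<close>

lemma mpow_eq_exp: "z \<noteq> 0 \<Longrightarrow> mpow a z = exp (of_real a * Ln (- z))"
  by (simp add: mpow_def powr_def)

text \<open>The argument of k = \<open>sqrt_arg \<rho> b z\<close> is \<rho> + Arg(-z) / 2, whose
  modulus stays away from pi/2 if |Arg(-z)| stays below pi - 2 \<rho>. There Re k is at least a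
  multiple of |z|^(1/2), and the error 1 / (Re k)^2 times |z|^(1/4) has order -3/4.\<close>

lemma airy_int_sqrt_arg_expansion:
  assumes \<rho>: "\<rho> \<ge> 0" and b: "b > 0"
  obtains c where "c \<noteq> 0" "(\<lambda>z. mpow (1/4) z * airy_int 1 0 (sqrt_arg \<rho> b z) - c) \<in> hO (pi - 2 * \<rho>) (- 3/4)"
proof -
  \<comment> \<open>\<open>csqrt k\<close> is v times \<open>mpow (1/4) z\<close>, so c is the limit
    of the normalized integral.\<close>
  define v where "v = exp ((\<i> * of_real \<rho> + of_real (ln b)) / 2)"
  define c where "c = of_real (sqrt pi) / v"
  have v0: "v \<noteq> 0" by (simp add: v_def)
  have c0: "c \<noteq> 0" using v0 by (simp add: c_def)
  have th: "pi - 2 * \<rho> \<le> pi" using \<rho> by simp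
  have main: "\<exists>\<delta>>0. \<forall>z. \<bar>Arg (- z)\<bar> < \<theta> \<longrightarrow> z \<noteq> 0 \<longrightarrow> Re (sqrt_arg \<rho> b z) \<ge> \<delta> * norm z powr (1/2)
      \<and> csqrt (sqrt_arg \<rho> b z) = v * mpow (1/4) z" if "\<theta> < pi - 2 * \<rho>" for \<theta>
  proof (cases "\<theta> \<le> 0")
    case True
    then show ?thesis by (intro exI[of _ 1]) auto
  next
    case False
    have ang: "\<rho> + \<theta> / 2 < pi / 2" using that by simp
    have cospos: "cos (\<rho> + \<theta> / 2) > 0" using ang False \<rho> by (intro cos_gt_zero_pi) auto
    show ?thesis
    proof (intro exI[of _ "b * cos (\<rho> + \<theta> / 2)"] conjI allI impI)
      show "0 < b * cos (\<rho> + \<theta> / 2)" using b cospos by simp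
      fix z assume z: "\<bar>Arg (- z)\<bar> < \<theta>" "z \<noteq> 0"
      define t where "t = \<rho> + Arg (- z) / 2"
      have t: "\<bar>t\<bar> \<le> \<rho> + \<theta> / 2" using z \<rho> by (simp add: t_def)
      define w where "w = \<i> * of_real \<rho> + of_real (ln b) + Ln (- z) / 2"
      have Imw: "Im w = t" using z by (simp add: w_def t_def Arg_eq_Im_Ln)
      have Rew: "exp (Re w) = b * norm z powr (1/2)"
        using z b by (simp add: w_def exp_add powr_def)
      have "Re (sqrt_arg \<rho> b z) = b * norm z powr (1/2) * cos t"
        unfolding sqrt_arg_def w_def[symmetric] by (simp only: Re_exp Imw Rew)
      moreover have "cos (\<rho> + \<theta> / 2) \<le> cos \<bar>t\<bar>" using t ang by (intro cos_monotone_0_pi_le) auto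
      then have "b * norm z powr (1/2) * cos (\<rho> + \<theta> / 2) \<le> b * norm z powr (1/2) * cos t"
        using b by (intro mult_left_mono) auto
      ultimately show "Re (sqrt_arg \<rho> b z) \<ge> b * cos (\<rho> + \<theta> / 2) * norm z powr (1/2)"
        by (simp only: mult_ac)
      have "csqrt (sqrt_arg \<rho> b z) = exp (Ln (exp w) / 2)"
        unfolding sqrt_arg_def w_def[symmetric] by (rule csqrt_exp_Ln) simp
      also have "Ln (exp w) = w" using t ang by (intro Ln_exp) (auto simp: Imw)
      also have "exp (w / 2) = v * mpow (1/4) z"
        unfolding mpow_eq_exp[OF z(2)] v_def exp_add[symmetric] w_def by (simp add: field_simps)
      finally show "csqrt (sqrt_arg \<rho> b z) = v * mpow (1/4) z" .
    qed
  qed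
  have "(\<lambda>z. mpow (1/4) z * airy_int 1 0 (sqrt_arg \<rho> b z) - c) \<in> hO (pi - 2 * \<rho>) (- 3/4)"
    unfolding hO_def
  proof (intro CollectI allI impI conjI)
    fix \<theta> assume \<theta>: "\<theta> < pi - 2 * \<rho>"
    obtain \<delta> where \<delta>: "\<delta> > 0" "\<And>z. \<bar>Arg (- z)\<bar> < \<theta> \<Longrightarrow> z \<noteq> 0 \<Longrightarrow> Re (sqrt_arg \<rho> b z) \<ge> \<delta> * norm z powr (1/2)"
      "\<And>z. \<bar>Arg (- z)\<bar> < \<theta> \<Longrightarrow> z \<noteq> 0 \<Longrightarrow> csqrt (sqrt_arg \<rho> b z) = v * mpow (1/4) z"
      using main[OF \<theta>] by blast
    have pos: "Re (sqrt_arg \<rho> b z) > 0" if "\<bar>Arg (- z)\<bar> < \<theta>" "z \<noteq> 0" for z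
    proof -
      have "0 < \<delta> * norm z powr (1/2)" using \<delta>(1) that by simp
      then show ?thesis using \<delta>(2)[OF that] by linarith
    qed
    have ev: "\<forall>\<^sub>F z in sector_at_infinity \<theta>. z \<noteq> 0 \<and> \<bar>Arg (- z)\<bar> < \<theta> \<and> - z \<notin> \<real>\<^sub>\<le>\<^sub>0"
      using eventually_sectors_slit[OF th] \<theta> eventually_sector_arg[of \<theta>]
      by (auto simp: eventually_sectors_def elim: eventually_elim2)
    show "\<forall>\<^sub>F z in sector_at_infinity \<theta>. (\<lambda>z. mpow (1/4) z * airy_int 1 0 (sqrt_arg \<rho> b z) - c) field_differentiable at z"
      using ev
    proof eventually_elim
      case (elim z)
      have "(\<lambda>z. - z) field_differentiable at z" by (intro derivative_intros)
      moreover have "Ln field_differentiable at (- z)" using elim by (intro field_differentiable_at_Ln) auto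
      ultimately have "(\<lambda>z. Ln (- z)) field_differentiable at z"
        using field_differentiable_compose[of "\<lambda>z. - z" z Ln] by (simp add: o_def)
      then have "(\<lambda>z. \<i> * of_real \<rho> + of_real (ln b) + Ln (- z) / 2) field_differentiable at z"
        by (intro field_differentiable_add field_differentiable_const field_differentiable_divide) auto
      then have "sqrt_arg \<rho> b field_differentiable at z"
        unfolding sqrt_arg_def[abs_def] field_differentiable_def using DERIV_fun_exp by blast
      moreover have "airy_int 1 0 field_differentiable at (sqrt_arg \<rho> b z)"
        using has_field_derivative_airy_int[OF pos] elim field_differentiable_def by blast
      ultimately have "(\<lambda>z. airy_int 1 0 (sqrt_arg \<rho> b z)) field_differentiable at z"
        using field_differentiable_compose by (fastforce simp: o_def)
      then show ?case
        using elim by (intro field_differentiable_diff field_differentiable_mult field_differentiable_const mpow_field_differentiable) auto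
    qed
    show "(\<lambda>z. mpow (1/4) z * airy_int 1 0 (sqrt_arg \<rho> b z) - c) \<in> O[sector_at_infinity \<theta>](mpow (- 3/4))"
    proof (rule bigoI)
      show "\<forall>\<^sub>F z in sector_at_infinity \<theta>. norm (mpow (1/4) z * airy_int 1 0 (sqrt_arg \<rho> b z) - c)
          \<le> 1 / \<delta> ^ 2 * norm (mpow (- 3/4) z)"
        using ev
      proof eventually_elim
        case (elim z)
        then have z: "z \<noteq> 0" "\<bar>Arg (- z)\<bar> < \<theta>" by auto
        define K where "K = sqrt_arg \<rho> b z"
        have K: "Re K \<ge> \<delta> * norm z powr (1/2)" "Re K > 0" using \<delta>(2)[OF z(2,1)] pos[OF z(2,1)] by (auto simp: K_def)
        have "mpow (1/4) z * airy_int 1 0 K - c = mpow (1/4) z * (airy_int 1 0 K - of_real (sqrt pi) / csqrt K)"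
          using z \<delta>(3)[OF z(2,1)] v0 by (simp add: c_def K_def field_simps)
        also have "norm \<dots> \<le> norm (mpow (1/4) z) * (1 / Re K ^ 2)"
          unfolding norm_mult by (intro mult_left_mono airy_int_approx K) auto
        also have "\<dots> \<le> norm (mpow (1/4) z) * (1 / (\<delta> * norm z powr (1/2)) ^ 2)"
          using K \<delta>(1) z by (intro mult_left_mono divide_left_mono power_mono mult_pos_pos zero_less_power) auto
        also have "(\<delta> * norm z powr (1/2)) ^ 2 = \<delta> ^ 2 * norm z powr 1"
          by (simp add: power_mult_distrib powr_half_sqrt)
        also have "norm (mpow (1/4) z) * (1 / (\<delta> ^ 2 * norm z powr 1)) = 1 / \<delta> ^ 2 * (norm z powr (1/4) / norm z powr 1)"
          using z by (simp add: norm_mpow)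
        also have "norm z powr (1/4) / norm z powr 1 = norm (mpow (- 3/4) z)"
          unfolding powr_diff[symmetric] using z by (simp add: norm_mpow)
        finally show ?case by (simp add: K_def)
      qed
    qed
  qed
  then show ?thesis using that c0 by blast
qed

text \<open>For |Arg(-z)| < \<theta> < pi/3 the argument of x^(3/2) stays away from pi/2, so its
  real part is at least a positive multiple of |x|^(3/2). Exponential decay is weakened to exp (-X)
  \<le> 1 / X, which suffices for the error classes.\<close>

lemma hO_exp_decay:
  assumes t: "t > 0"
  shows "(\<lambda>z. exp (- of_real t * mpow (3/2) z)) \<in> hO (pi / 3) (- 3/2)"
  unfolding hO_def
proof (intro CollectI allI impI conjI)
  fix \<theta> :: real assume \<theta>: "\<theta> < pi / 3"
  have slit: "\<forall>\<^sub>F z in sector_at_infinity \<theta>. z \<noteq> 0 \<and> - z \<notin> \<real>\<^sub>\<le>\<^sub>0"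
    using eventually_sectors_slit[of "pi / 3"] \<theta> by (auto simp: eventually_sectors_def)
  then show "\<forall>\<^sub>F z in sector_at_infinity \<theta>. (\<lambda>z. exp (- of_real t * mpow (3/2) z)) field_differentiable at z"
  proof eventually_elim
    case (elim z)
    have "((\<lambda>z. exp (- of_real t * mpow (3/2) z)) has_field_derivative
        exp (- of_real t * mpow (3/2) z) * (- of_real t * (- of_real (3/2) * mpow (3/2 - 1) z))) (at z)"
      using elim by (intro DERIV_fun_exp DERIV_cmult has_field_derivative_mpow) auto
    then show ?case using field_differentiable_def by blast
  qed
  define \<delta> where "\<delta> = t * cos (3/2 * \<theta>)"
  show "(\<lambda>z. exp (- of_real t * mpow (3/2) z)) \<in> O[sector_at_infinity \<theta>](mpow (- 3/2))"
  proof (rule bigoI)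
    show "\<forall>\<^sub>F z in sector_at_infinity \<theta>. norm (exp (- of_real t * mpow (3/2) z)) \<le> 1 / \<delta> * norm (mpow (- 3/2) z)"
      using slit eventually_sector_arg[of \<theta>]
    proof eventually_elim
      case (elim z)
      then have z: "z \<noteq> 0" by simp
      have ang: "\<bar>3/2 * Arg (- z)\<bar> \<le> 3/2 * \<theta>" "3/2 * \<theta> < pi / 2" "3/2 * \<theta> > 0"
        using elim \<theta> by auto
      have cospos: "cos (3/2 * \<theta>) > 0" using ang by (intro cos_gt_zero_pi) auto
      define x where "x = norm z powr (3/2)"
      have x: "x > 0" using z by (simp add: x_def)
      have "Re (mpow (3/2) z) = x * cos (3/2 * Arg (- z))"
        using z by (simp add: mpow_eq_exp Re_exp Arg_eq_Im_Ln x_def powr_def)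
      moreover have "cos (3/2 * \<theta>) \<le> cos \<bar>3/2 * Arg (- z)\<bar>" using ang by (intro cos_monotone_0_pi_le) auto
      then have "x * cos (3/2 * \<theta>) \<le> x * cos (3/2 * Arg (- z))"
        unfolding cos_abs_real using x by (intro mult_left_mono) auto
      ultimately have "x * cos (3/2 * \<theta>) \<le> Re (mpow (3/2) z)" by simp
      then have "t * (x * cos (3/2 * \<theta>)) \<le> t * Re (mpow (3/2) z)" using t by (intro mult_left_mono) auto
      then have "norm (exp (- of_real t * mpow (3/2) z)) \<le> exp (- (\<delta> * x))"
        by (simp add: \<delta>_def mult_ac)
      also have "\<dots> \<le> 1 / (\<delta> * x)"
      proof -
        have "\<delta> * x > 0" using t cospos x by (simp add: \<delta>_def)
        moreover have "\<delta> * x \<le> exp (\<delta> * x)" using exp_ge_add_one_self[of "\<delta> * x"] by linarith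
        ultimately show ?thesis by (simp add: exp_minus field_simps)
      qed
      also have "\<dots> = 1 / \<delta> * norm (mpow (- 3/2) z)"
        using z by (simp add: norm_mpow x_def powr_minus field_simps)
      finally show ?case .
    qed
  qed
qed

lemma hO_antimono_angle: "f \<in> hO \<theta>\<^sub>0 a \<Longrightarrow> \<theta>\<^sub>1 \<le> \<theta>\<^sub>0 \<Longrightarrow> f \<in> hO \<theta>\<^sub>1 a"
  unfolding hO_def by auto

section \<open>Expansions of the tau functions\<close>

text \<open>The scaling factor c has cube -1/2, which turns w'' = y w into phi'' = -(z / 2)
  phi.\<close>

lemma phi_differentiable_ode:
  shows "phi C1 C2 field_differentiable at z"
    and "(deriv (phi C1 C2) has_field_derivative - (z / 2) * phi C1 C2 z) (at z)"
proof -
  define c where "c = - complex_of_real (2 powr (-1/3))"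
  have c3: "c ^ 3 = - 1/2"
  proof -
    have "(2 powr (-1/3)) ^ 3 = (1/2 :: real)"
    proof -
      have "(2 powr (-1/3)) ^ 3 = (2::real) powr ((-1/3) * real 3)" by (subst powr_power) auto
      also have "\<dots> = 1/2" by (simp add: powr_minus)
      finally show ?thesis .
    qed
    then have "complex_of_real (2 powr (-1/3)) ^ 3 = 1/2" by (metis of_real_power of_real_divide of_real_1 of_real_numeral)
    then show ?thesis by (simp add: c_def)
  qed
  obtain \<alpha> \<beta> where p: "\<And>z. phi C1 C2 z = \<alpha> * airy_f (c * z) + \<beta> * airy_g (c * z)"
  proof
    fix z
    show "phi C1 C2 z = (C1 * of_real (1 / (3 powr (2/3) * Gamma (2/3))) + C2 * of_real (1 / (3 powr (1/6) * Gamma (2/3)))) * airy_f (c * z)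
       + (- C1 * of_real (1 / (3 powr (1/3) * Gamma (1/3))) + C2 * of_real (3 powr (1/6) / Gamma (1/3))) * airy_g (c * z)"
    proof -
      have "C1 * (k1 * F - k2 * G) + C2 * (k3 * F + k4 * G) = (C1 * k1 + C2 * k3) * F + (- C1 * k2 + C2 * k4) * G"
        for k1 k2 k3 k4 F G :: complex
        by (simp add: algebra_simps)
      then show ?thesis unfolding phi_def Ai_def Bi_def c_def .
    qed
  qed
  have sc: "((\<lambda>z. c * z) has_field_derivative c) (at z)" for z
    using DERIV_cmult_Id[of c] by simp
  have f1: "((\<lambda>z. airy_f (c * z)) has_field_derivative deriv airy_f (c * z) * c) (at z)" for z
    by (rule DERIV_chain2[OF field_differentiable_derivI[OF airy_f_differentiable] sc])
  have g1: "((\<lambda>z. airy_g (c * z)) has_field_derivative deriv airy_g (c * z) * c) (at z)" for z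
    by (rule DERIV_chain2[OF field_differentiable_derivI[OF airy_g_differentiable] sc])
  have d: "(phi C1 C2 has_field_derivative \<alpha> * (deriv airy_f (c * z) * c) + \<beta> * (deriv airy_g (c * z) * c)) (at z)" for z
    unfolding p[abs_def] by (intro DERIV_add DERIV_cmult f1 g1)
  then show "phi C1 C2 field_differentiable at z" using field_differentiable_def by blast
  have dd: "deriv (phi C1 C2) = (\<lambda>z. \<alpha> * (deriv airy_f (c * z) * c) + \<beta> * (deriv airy_g (c * z) * c))"
    using d by (intro ext DERIV_imp_deriv)
  have f2: "((\<lambda>z. deriv airy_f (c * z)) has_field_derivative (c * z * airy_f (c * z)) * c) (at z)"
    by (rule DERIV_chain2[OF airy_f_ode sc])
  have g2: "((\<lambda>z. deriv airy_g (c * z)) has_field_derivative (c * z * airy_g (c * z)) * c) (at z)"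
    by (rule DERIV_chain2[OF airy_g_ode sc])
  have "(deriv (phi C1 C2) has_field_derivative
     \<alpha> * ((c * z * airy_f (c * z)) * c * c) + \<beta> * ((c * z * airy_g (c * z)) * c * c)) (at z)"
    unfolding dd by (intro DERIV_add DERIV_cmult DERIV_cmult_right f2 g2)
  also have "\<alpha> * ((c * z * airy_f (c * z)) * c * c) + \<beta> * ((c * z * airy_g (c * z)) * c * c) = c ^ 3 * z * phi C1 C2 z"
    unfolding p by (simp add: algebra_simps power3_eq_cube)
  finally show "(deriv (phi C1 C2) has_field_derivative - (z / 2) * phi C1 C2 z) (at z)"
    unfolding c3 by simp
qed

text \<open>The logarithmic derivative of the product that tends to c removes c and sharpens the
  error from -3/4 to -7/4; the exponential and the fourth root contribute the two explicit terms.
  This is the input of \<open>riccati_expansion\<close>, whose equation is the linear equation for u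
  rewritten for u' / u.\<close>

lemma logderiv_expansion_of_wkb:
  fixes u :: "complex \<Rightarrow> complex" and a :: complex
  assumes th: "\<theta>\<^sub>0 \<le> pi" and a: "a ^ 2 = 1/2" and c: "c \<noteq> 0"
    and G: "(\<lambda>z. u z * exp (2/3 * a * mpow (3/2) z) * mpow (1/4) z - c) \<in> hO \<theta>\<^sub>0 (- 3/4)"
    and u: "\<And>z. u field_differentiable at z"
    and ode: "\<And>z. (deriv u has_field_derivative - (z / 2) * u z) (at z)"
  shows "eventually_sectors \<theta>\<^sub>0 (\<lambda>z. u z \<noteq> 0)"
    and "(\<lambda>z. logderiv u z - sigma_approx a 1 z) \<in> hO \<theta>\<^sub>0 (- 4)"
proof -
  define g where "g = (\<lambda>z. u z * exp (2/3 * a * mpow (3/2) z) * mpow (1/4) z)"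
  have g: "(\<lambda>z. g z - c) \<in> hO \<theta>\<^sub>0 (- 3/4)" using G by (simp add: g_def)
  have gnz: "eventually_sectors \<theta>\<^sub>0 (\<lambda>z. g z \<noteq> 0)"
    by (rule hO_nonzero[OF th g _ c]) simp
  show unz: "eventually_sectors \<theta>\<^sub>0 (\<lambda>z. u z \<noteq> 0)"
    by (rule eventually_sectors_mono[OF gnz]) (auto simp: g_def)
  have ev: "eventually_sectors \<theta>\<^sub>0 (\<lambda>z. (z \<noteq> 0 \<and> - z \<notin> \<real>\<^sub>\<le>\<^sub>0) \<and> u z \<noteq> 0)"
    by (rule eventually_sectors_conj[OF eventually_sectors_slit[OF th] unz])
  have "logderiv g \<in> hO \<theta>\<^sub>0 (- 7/4)"
    using hO_logderiv[OF th g _ c] by simp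
  then have "(\<lambda>z. logderiv u z - (a * mpow (1/2) z + mpow (- 1) z / 4)) \<in> hO \<theta>\<^sub>0 (- 7/4)"
  proof (rule hO_congD[OF th _ ev])
    fix z assume z: "(z \<noteq> 0 \<and> - z \<notin> \<real>\<^sub>\<le>\<^sub>0) \<and> u z \<noteq> 0"
    define E where "E = exp (2/3 * a * mpow (3/2) z)"
    have "((\<lambda>z. exp (2/3 * a * mpow (3/2) z)) has_field_derivative E * (2/3 * a * (- of_real (3/2) * mpow (3/2 - 1) z))) (at z)"
      unfolding E_def using z by (intro DERIV_fun_exp DERIV_cmult has_field_derivative_mpow) auto
    then have "((\<lambda>z. exp (2/3 * a * mpow (3/2) z)) has_field_derivative - a * mpow (1/2) z * E) (at z)"
      by (simp add: mult_ac)
    then have "(g has_field_derivative (u z * E) * (- of_real (1/4) * mpow (1/4 - 1) z)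
        + (u z * (- a * mpow (1/2) z * E) + deriv u z * E) * mpow (1/4) z) (at z)"
      unfolding g_def E_def using z
      by (intro DERIV_mult' has_field_derivative_mpow field_differentiable_derivI[OF u]) auto
    then have "deriv g z = (u z * E) * (- of_real (1/4) * mpow (1/4 - 1) z)
        + (u z * (- a * mpow (1/2) z * E) + deriv u z * E) * mpow (1/4) z"
      by (rule DERIV_imp_deriv)
    moreover have "mpow (1/4 - 1) z = mpow (- 1) z * mpow (1/4) z" by (simp add: mpow_mult)
    moreover have "E \<noteq> 0" by (simp add: E_def)
    moreover have "g z = u z * E * mpow (1/4) z" by (simp add: g_def E_def)
    ultimately show "logderiv g z = logderiv u z - (a * mpow (1/2) z + mpow (- 1) z / 4)"
      using z by (simp add: logderiv_def field_simps)
  qed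
  then show "(\<lambda>z. logderiv u z - sigma_approx a 1 z) \<in> hO \<theta>\<^sub>0 (- 4)"
  proof (rule riccati_expansion[OF th _ a])
    show "eventually_sectors \<theta>\<^sub>0 (\<lambda>z. logderiv u field_differentiable at z \<and> deriv (logderiv u) z + logderiv u z ^ 2 = mpow 1 z / 2)"
    proof (rule eventually_sectors_mono[OF unz])
      fix z assume z: "u z \<noteq> 0"
      have d: "(logderiv u has_field_derivative (- (z / 2) * u z * u z - deriv u z * deriv u z) / (u z * u z)) (at z)"
        unfolding logderiv_def[abs_def] by (intro DERIV_divide ode field_differentiable_derivI[OF u] z)
      then have "logderiv u field_differentiable at z" using field_differentiable_def by blast
      moreover have "deriv (logderiv u) z + logderiv u z ^ 2 = mpow 1 z / 2"
        unfolding DERIV_imp_deriv[OF d] mpow_1 logderiv_def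
        using z by (simp add: field_simps power2_eq_square)
      ultimately show "logderiv u field_differentiable at z \<and> deriv (logderiv u) z + logderiv u z ^ 2 = mpow 1 z / 2" by blast
    qed
  qed
qed

section \<open>The rotated solution and the connection formula\<close>

lemma cube_root_1_exp: "cube_root_1 = exp (\<i> * of_real (2 * pi / 3))"
  by (simp add: cube_root_1_def cis_conv_exp)

definition airy_scale :: real where
  "airy_scale = 2 powr (-1/3)"

lemma airy_scale_pos: "airy_scale > 0"
  by (simp add: airy_scale_def)

text \<open>The condition on \<open>Arg\<close> makes the logarithm of y additive, and 2/3 y^(3/2)
  becomes cos (3 \<rho>) (sqrt 2 / 3) x^(3/2). For \<rho> = pi/3 the sign of the exponent is
  reversed, so the recessive function turns into a growing one.\<close>

lemma airy_decay_rotated: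
  assumes z: "z \<noteq> 0" and \<rho>: "\<rho> = 0 \<or> \<rho> = pi / 3" and Arg: "\<bar>Arg (- z)\<bar> < pi - 2 * \<rho>"
  defines "y \<equiv> exp (\<i> * of_real (2 * \<rho>)) * (- of_real airy_scale * z)"
  shows "y \<notin> \<real>\<^sub>\<le>\<^sub>0"
    and "airy_decay y = exp (- (cos (3 * \<rho>) * (sqrt 2 / 3)) * mpow (3/2) z) * airy_int 1 0 (sqrt_arg \<rho> (sqrt airy_scale) z)"
proof -
  have b: "airy_scale > 0" by (rule airy_scale_pos)
  define L where "L = \<i> * of_real (2 * \<rho>) + (of_real (ln airy_scale) + Ln (- z))"
  have "exp (of_real (ln airy_scale)) = (of_real airy_scale :: complex)"
    using b by (simp add: exp_of_real)
  then have "exp L = y"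
    using z by (simp add: L_def exp_add y_def)
  moreover have ImL: "Im L = 2 * \<rho> + Arg (- z)"
    using z by (simp add: L_def Arg_eq_Im_Ln)
  moreover have rho0: "\<rho> \<ge> 0" using \<rho> pi_gt_zero by (elim disjE) linarith+
  ultimately have Ly: "Ln y = L"
    using Arg by (intro Ln_unique) auto
  have y0: "y \<noteq> 0" using \<open>exp L = y\<close> by auto
  have "\<bar>Arg y\<bar> < pi"
    using y0 Ly ImL Arg rho0 by (simp add: Arg_eq_Im_Ln)
  then show "y \<notin> \<real>\<^sub>\<le>\<^sub>0" using y0 by (rule not_nonpos_Reals_Arg)
  have csq: "csqrt y = sqrt_arg \<rho> (sqrt airy_scale) z"
    unfolding csqrt_exp_Ln[OF y0] Ly sqrt_arg_def using b
    by (simp add: L_def ln_sqrt field_simps)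
  have "csqrt y ^ 3 = exp (of_nat 3 * (L / 2))"
    unfolding csqrt_exp_Ln[OF y0] Ly exp_of_nat_mult ..
  also have "of_nat 3 * (L / 2) = \<i> * of_real (3 * \<rho>) + of_real (3 / 2 * ln airy_scale) + of_real (3/2) * Ln (- z)"
    by (simp add: L_def field_simps)
  also have "exp \<dots> = cis (3 * \<rho>) * of_real (airy_scale powr (3/2)) * mpow (3/2) z"
  proof -
    have "exp (of_real (3 / 2 * ln airy_scale)) = (of_real (airy_scale powr (3/2)) :: complex)"
      unfolding exp_of_real using b by (simp add: powr_def)
    then show ?thesis by (simp only: exp_add mpow_eq_exp[OF z] cis_conv_exp)
  qed
  also have "cis (3 * \<rho>) = of_real (cos (3 * \<rho>))"
    using \<rho>
  proof
    assume "\<rho> = pi / 3"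
    then have "3 * \<rho> = pi" by simp
    then show ?thesis by (simp only: cis_pi cos_pi of_real_minus of_real_1)
  qed simp
  also have "airy_scale powr (3/2) = 1 / sqrt 2"
  proof -
    have "airy_scale powr (3/2) = 2 powr (- (1/2))"
      by (simp add: airy_scale_def powr_powr)
    also have "\<dots> = 1 / sqrt 2"
      by (subst powr_minus) (simp add: powr_half_sqrt inverse_eq_divide)
    finally show ?thesis .
  qed
  finally have cube: "csqrt y ^ 3 = of_real (cos (3 * \<rho>)) * of_real (1 / sqrt 2) * mpow (3/2) z" .
  have "2 / 3 * (1 / sqrt 2) = sqrt 2 / (3::real)"
    by (simp add: field_simps)
  then have e: "(2 / 3 :: complex) * of_real (1 / sqrt 2) = of_real (sqrt 2 / 3)"
    by (metis of_real_mult of_real_divide of_real_numeral)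
  have "- 2 / 3 * (p * q * m) = - (p * (2 / 3 * q)) * m" for p q m :: complex
    by simp
  then have "- 2 / 3 * csqrt y ^ 3 = - (of_real (cos (3 * \<rho>)) * of_real (sqrt 2 / 3)) * mpow (3/2) z"
    by (simp only: cube e)
  then have "- 2 / 3 * csqrt y ^ 3 = - (cos (3 * \<rho>) * (sqrt 2 / 3)) * mpow (3/2) z"
    by simp
  then show "airy_decay y = exp (- (cos (3 * \<rho>) * (sqrt 2 / 3)) * mpow (3/2) z) * airy_int 1 0 (sqrt_arg \<rho> (sqrt airy_scale) z)"
    unfolding airy_decay_def csq[symmetric] by simp
qed

text \<open>With the moments 3^(-2/3) Gamma(1/3) and 3^(-1/3) Gamma(2/3), the four constants in Ai
  and Bi reduce to one: Bi differs from Ai by the factor sqrt 3 and the sign of the g-part.\<close>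

lemma Ai_Bi_recessive:
  defines "A \<equiv> complex_of_real (1 / (Gamma (1/3) * Gamma (2/3)))"
  shows "A \<noteq> 0"
    and "Ai y = A * airy_recessive y"
    and "Bi y = A * of_real (sqrt 3) * (of_real (airy_moment 0) * airy_f y + of_real (airy_moment 1) * airy_g y)"
proof -
  have G: "Gamma (1/3 :: real) \<noteq> 0" "Gamma (2/3 :: real) \<noteq> 0"
    by (rule less_imp_neq[OF Gamma_real_pos, symmetric], simp)+
  define a where "a = 1 / (Gamma (1/3 :: real) * Gamma (2/3))"
  have A: "A = of_real a" by (simp only: A_def a_def)
  show "A \<noteq> 0" using G by (simp add: A_def)
  have m0: "1 / (3 powr (2/3) * Gamma (2/3)) = a * airy_moment 0"
    using G by (simp add: a_def airy_moment_def powr_minus divide_simps)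
  have m1: "1 / (3 powr (1/3) * Gamma (1/3)) = a * airy_moment 1"
    using G by (simp add: a_def airy_moment_def powr_minus divide_simps)
  have m2: "1 / (3 powr (1/6) * Gamma (2/3)) = a * sqrt 3 * airy_moment 0"
  proof -
    have "sqrt 3 * 3 powr (-2/3) = (3::real) powr (- 1/6)"
      by (simp add: powr_half_sqrt[symmetric] powr_add[symmetric])
    then show ?thesis using G by (simp add: a_def airy_moment_def powr_minus divide_simps)
  qed
  have m3: "3 powr (1/6) / Gamma (1/3) = a * sqrt 3 * airy_moment 1"
  proof -
    have "sqrt 3 * 3 powr (-1/3) = (3::real) powr (1/6)"
      by (simp add: powr_half_sqrt[symmetric] powr_add[symmetric])
    then show ?thesis using G by (simp add: a_def airy_moment_def divide_simps)
  qed
  show "Ai y = A * airy_recessive y"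
    unfolding Ai_def m0 m1 airy_recessive_def A by (simp only: of_real_mult) (simp add: algebra_simps)
  show "Bi y = A * of_real (sqrt 3) * (of_real (airy_moment 0) * airy_f y + of_real (airy_moment 1) * airy_g y)"
    unfolding Bi_def m2 m3 A by (simp only: of_real_mult) (simp add: algebra_simps)
qed

text \<open>The exponential is split off from a factor w with nonzero limit. The unspecified
  constant \<kappa> is absorbed into that limit.\<close>

lemma airy_recessive_expansion:
  assumes \<rho>: "\<rho> = 0 \<or> \<rho> = pi / 3"
  obtains c w where "c \<noteq> 0" "(\<lambda>z. w z - c) \<in> hO (pi - 2 * \<rho>) (- 3/4)"
    "\<And>z. z \<noteq> 0 \<Longrightarrow> \<bar>Arg (- z)\<bar> < pi - 2 * \<rho> \<Longrightarrow>
       mpow (1/4) z * airy_recessive (exp (\<i> * of_real (2 * \<rho>)) * (- of_real airy_scale * z))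
         = exp (- (cos (3 * \<rho>) * (sqrt 2 / 3)) * mpow (3/2) z) * w z"
proof -
  obtain \<kappa> where \<kappa>: "\<kappa> \<noteq> 0" "\<And>y. y \<notin> \<real>\<^sub>\<le>\<^sub>0 \<Longrightarrow> airy_recessive y = \<kappa> * airy_decay y"
    using airy_recessive_eq_decay by blast
  have rho0: "\<rho> \<ge> 0" using \<rho> pi_gt_zero by (elim disjE) linarith+
  have "sqrt airy_scale > 0" using airy_scale_pos by simp
  then obtain c where c: "c \<noteq> 0"
    "(\<lambda>z. mpow (1/4) z * airy_int 1 0 (sqrt_arg \<rho> (sqrt airy_scale) z) - c) \<in> hO (pi - 2 * \<rho>) (- 3/4)"
    using airy_int_sqrt_arg_expansion[OF rho0] by blast
  define w where "w = (\<lambda>z. \<kappa> * (mpow (1/4) z * airy_int 1 0 (sqrt_arg \<rho> (sqrt airy_scale) z)))"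
  have "(\<lambda>z. w z - \<kappa> * c) \<in> hO (pi - 2 * \<rho>) (- 3/4)"
    using hO_cmult[OF c(2), of \<kappa>] by (simp add: w_def right_diff_distrib)
  moreover have "mpow (1/4) z * airy_recessive (exp (\<i> * of_real (2 * \<rho>)) * (- of_real airy_scale * z))
         = exp (- (cos (3 * \<rho>) * (sqrt 2 / 3)) * mpow (3/2) z) * w z"
    if "z \<noteq> 0" "\<bar>Arg (- z)\<bar> < pi - 2 * \<rho>" for z
    unfolding \<kappa>(2)[OF airy_decay_rotated(1)[OF that(1) \<rho> that(2)]] airy_decay_rotated(2)[OF that(1) \<rho> that(2)] w_def
    by (simp only: mult_ac)
  ultimately show ?thesis using that[of "\<kappa> * c" w] \<kappa>(1) c(1) by simp
qed

lemma eventually_sectors_arg: "eventually_sectors \<theta>\<^sub>0 (\<lambda>z. z \<noteq> 0 \<and> \<bar>Arg (- z)\<bar> < \<theta>\<^sub>0)"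
  unfolding eventually_sectors_def
proof (intro allI impI)
  fix \<theta> assume "\<theta> < \<theta>\<^sub>0"
  show "\<forall>\<^sub>F z in sector_at_infinity \<theta>. z \<noteq> 0 \<and> \<bar>Arg (- z)\<bar> < \<theta>\<^sub>0"
    using eventually_sector_nonzero[of \<theta>] eventually_sector_arg[of \<theta>]
    by eventually_elim (use \<open>\<theta> < \<theta>\<^sub>0\<close> in auto)
qed

lemma hO_of_limit:
  assumes "\<theta>\<^sub>0 \<le> pi" "(\<lambda>z. w z - c) \<in> hO \<theta>\<^sub>0 a" "a \<le> 0"
  shows "w \<in> hO \<theta>\<^sub>0 0"
  using hO_add[OF hO_mono[OF assms(2,3)] hO_const[OF assms(1), of c]] by simp

lemma phi_wkb_recessive:
  assumes "C1 \<noteq> 0"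
  obtains c where "c \<noteq> 0"
    "(\<lambda>z. phi C1 0 z * exp (2/3 * of_real (1 / sqrt 2) * mpow (3/2) z) * mpow (1/4) z - c) \<in> hO pi (- 3/4)"
proof -
  define A where "A = complex_of_real (1 / (Gamma (1/3) * Gamma (2/3)))"
  have A0: "A \<noteq> 0" unfolding A_def by (rule Ai_Bi_recessive(1))
  obtain c w where cw: "c \<noteq> 0" "(\<lambda>z. w z - c) \<in> hO pi (- 3/4)"
    "\<And>z. z \<noteq> 0 \<Longrightarrow> \<bar>Arg (- z)\<bar> < pi \<Longrightarrow>
       mpow (1/4) z * airy_recessive (- of_real airy_scale * z) = exp (- (sqrt 2 / 3) * mpow (3/2) z) * w z"
    using airy_recessive_expansion[of 0] by (auto simp del: mult_minus_left)
  have e: "2/3 * complex_of_real (1 / sqrt 2) = of_real (sqrt 2 / 3)"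
    by (simp add: field_simps flip: of_real_mult)
  have "(\<lambda>z. phi C1 0 z * exp (2/3 * of_real (1 / sqrt 2) * mpow (3/2) z) * mpow (1/4) z - C1 * A * c) \<in> hO pi (- 3/4)"
  proof (rule hO_congD[OF order_refl hO_cmult[OF cw(2), of "C1 * A"] eventually_sectors_arg])
    fix z :: complex assume z: "z \<noteq> 0 \<and> \<bar>Arg (- z)\<bar> < pi"
    have "phi C1 0 z = C1 * A * airy_recessive (- of_real airy_scale * z)"
      using Ai_Bi_recessive(2) by (simp add: phi_def A_def airy_scale_def)
    then have "phi C1 0 z * exp (2/3 * of_real (1 / sqrt 2) * mpow (3/2) z) * mpow (1/4) z
        = C1 * A * (mpow (1/4) z * airy_recessive (- of_real airy_scale * z)) * exp (of_real (sqrt 2 / 3) * mpow (3/2) z)"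
      unfolding e by (simp only: mult_ac)
    also have "\<dots> = C1 * A * w z * (exp (- (sqrt 2 / 3) * mpow (3/2) z) * exp (of_real (sqrt 2 / 3) * mpow (3/2) z))"
      using z by (subst cw(3)) (simp_all add: mult_ac)
    also have "exp (- (sqrt 2 / 3) * mpow (3/2) z) * exp (of_real (sqrt 2 / 3) * mpow (3/2) z) = 1"
      by (simp flip: exp_add)
    finally show "C1 * A * (w z - c) = phi C1 0 z * exp (2/3 * of_real (1 / sqrt 2) * mpow (3/2) z) * mpow (1/4) z - C1 * A * c"
      by (simp add: right_diff_distrib)
  qed
  then show ?thesis using that[of "C1 * A * c"] assms A0 cw(1) by simp
qed

lemma phi_wkb_dominant:
  assumes "C2 \<noteq> 0"
  obtains c where "c \<noteq> 0"
    "(\<lambda>z. phi C1 C2 z * exp (2/3 * (- of_real (1 / sqrt 2)) * mpow (3/2) z) * mpow (1/4) z - c) \<in> hO (pi / 3) (- 3/4)"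
proof -
  define A where "A = complex_of_real (1 / (Gamma (1/3) * Gamma (2/3)))"
  have A0: "A \<noteq> 0" unfolding A_def by (rule Ai_Bi_recessive(1))
  define \<omega> where "\<omega> = cube_root_1"
  define r3 where "r3 = complex_of_real (sqrt 3)"
  \<comment> \<open>\<alpha> and \<beta> solve \<alpha> + \<beta> = A (C1 + sqrt 3 C2) and \<alpha>
    + \<omega> \<beta> = A (C1 - sqrt 3 C2), which compare the f-parts and the g-parts; subtraction
    gives \<beta>. So the growing solution occurs precisely when C2 is nonzero.\<close>
  define \<beta> where "\<beta> = 2 * r3 * A * C2 / (1 - \<omega>)"
  define \<alpha> where "\<alpha> = A * (C1 + r3 * C2) - \<beta>"
  have \<omega>1: "\<omega> \<noteq> 1" using cube_root_1_neq_1 by (simp add: \<omega>_def)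
  have \<omega>e: "\<omega> = exp (\<i> * of_real (2 * (pi / 3)))" by (simp add: \<omega>_def cube_root_1_exp)
  have \<beta>0: "\<beta> \<noteq> 0" using assms A0 \<omega>1 by (simp add: \<beta>_def r3_def)
  have phi: "phi C1 C2 z = \<alpha> * airy_recessive (- of_real airy_scale * z) + \<beta> * airy_recessive (\<omega> * (- of_real airy_scale * z))" for z
  proof -
    define y where "y = - of_real airy_scale * z"
    define f g where "f = of_real (airy_moment 0) * airy_f y" and "g = of_real (airy_moment 1) * airy_g y"
    have y: "phi C1 C2 z = C1 * (A * (f - g)) + C2 * (A * r3 * (f + g))"
      using Ai_Bi_recessive(2)[of y] Ai_Bi_recessive(3)[of y]
      by (simp add: phi_def airy_recessive_def airy_scale_def y_def f_def g_def A_def r3_def)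
    have rot: "airy_recessive (\<omega> * y) = f - \<omega> * g"
      using cube_root_1_cube by (simp add: airy_recessive_def airy_f_rotate airy_g_rotate f_def g_def \<omega>_def)
    have "\<beta> * (1 - \<omega>) = 2 * r3 * A * C2" using \<omega>1 by (simp add: \<beta>_def)
    then have "\<alpha> + \<omega> * \<beta> = A * (C1 - r3 * C2)" by (simp add: \<alpha>_def algebra_simps)
    moreover have "\<alpha> + \<beta> = A * (C1 + r3 * C2)" by (simp add: \<alpha>_def)
    moreover have "\<alpha> * (f - g) + \<beta> * (f - \<omega> * g) = (\<alpha> + \<beta>) * f - (\<alpha> + \<omega> * \<beta>) * g"
      by (simp add: algebra_simps)
    ultimately have "\<alpha> * (f - g) + \<beta> * (f - \<omega> * g) = A * (C1 + r3 * C2) * f - A * (C1 - r3 * C2) * g"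
      by (simp only:)
    also have "\<dots> = phi C1 C2 z"
      unfolding y by (simp add: algebra_simps)
    finally have "\<alpha> * (f - g) + \<beta> * (f - \<omega> * g) = phi C1 C2 z" .
    moreover have "airy_recessive y = f - g" by (simp add: airy_recessive_def f_def g_def)
    ultimately show ?thesis unfolding y_def[symmetric] rot by simp
  qed
  obtain c w where cw: "c \<noteq> 0" "(\<lambda>z. w z - c) \<in> hO pi (- 3/4)"
    "\<And>z. z \<noteq> 0 \<Longrightarrow> \<bar>Arg (- z)\<bar> < pi \<Longrightarrow>
       mpow (1/4) z * airy_recessive (- of_real airy_scale * z) = exp (- (sqrt 2 / 3) * mpow (3/2) z) * w z"
    using airy_recessive_expansion[of 0] by (auto simp del: mult_minus_left)
  obtain d v where dv: "d \<noteq> 0" "(\<lambda>z. v z - d) \<in> hO (pi / 3) (- 3/4)"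
    "\<And>z. z \<noteq> 0 \<Longrightarrow> \<bar>Arg (- z)\<bar> < pi / 3 \<Longrightarrow>
       mpow (1/4) z * airy_recessive (\<omega> * (- of_real airy_scale * z)) = exp ((sqrt 2 / 3) * mpow (3/2) z) * v z"
  proof -
    have "pi - 2 * (pi / 3) = pi / 3" "cos (3 * (pi / 3)) = - 1" by simp_all
    then show ?thesis
      using that airy_recessive_expansion[of "pi / 3"] unfolding \<omega>e by (auto simp del: mult_minus_left)
  qed
  have th: "pi / 3 \<le> pi" by simp
  have e: "2/3 * complex_of_real (1 / sqrt 2) = of_real (sqrt 2 / 3)"
    by (simp add: field_simps flip: of_real_mult)
  define X where "X = (\<lambda>z. of_real (sqrt 2 / 3) * mpow (3/2) z)"
  \<comment> \<open>After division by the growing exponential the recessive part carries the square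
    of the decaying one, whose order -3/2 is already below -3/4.\<close>
  have decay: "(\<lambda>z. \<alpha> * (exp (- of_real (2 * sqrt 2 / 3) * mpow (3/2) z) * w z)) \<in> hO (pi / 3) (- 3/4)"
  proof -
    have "w \<in> hO pi 0" by (rule hO_of_limit[OF order_refl cw(2)]) simp
    then have "w \<in> hO (pi / 3) 0" by (rule hO_antimono_angle) simp
    from hO_mult[OF hO_exp_decay[of "2 * sqrt 2 / 3"] this] show ?thesis
      by (intro hO_cmult hO_mono[where a = "- 3/2" and b = "- 3/4"]) simp_all
  qed
  have "(\<lambda>z. \<beta> * (v z - d) + \<alpha> * (exp (- of_real (2 * sqrt 2 / 3) * mpow (3/2) z) * w z)) \<in> hO (pi / 3) (- 3/4)"
    by (intro hO_add hO_cmult dv decay)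
  then have "(\<lambda>z. phi C1 C2 z * exp (2/3 * (- of_real (1 / sqrt 2)) * mpow (3/2) z) * mpow (1/4) z - \<beta> * d) \<in> hO (pi / 3) (- 3/4)"
  proof (rule hO_congD[OF th _ eventually_sectors_arg])
    fix z :: complex assume z: "z \<noteq> 0 \<and> \<bar>Arg (- z)\<bar> < pi / 3"
    have X: "- (sqrt 2 / 3) * mpow (3/2) z = - X z" "(sqrt 2 / 3) * mpow (3/2) z = X z"
      "- of_real (2 * sqrt 2 / 3) * mpow (3/2) z = - X z + - X z" "2/3 * (- of_real (1 / sqrt 2)) * mpow (3/2) z = - X z"
      using e by (simp_all add: X_def field_simps)
    have "phi C1 C2 z * exp (- X z) * mpow (1/4) z
      = (\<alpha> * (mpow (1/4) z * airy_recessive (- of_real airy_scale * z))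
         + \<beta> * (mpow (1/4) z * airy_recessive (\<omega> * (- of_real airy_scale * z)))) * exp (- X z)"
      unfolding phi by (simp only: ring_distribs mult_ac)
    also have "\<dots> = (\<alpha> * (exp (- X z) * w z) + \<beta> * (exp (X z) * v z)) * exp (- X z)"
    proof -
      have "\<bar>Arg (- z)\<bar> < pi" using z pi_gt_zero by linarith
      then show ?thesis
        using z cw(3)[of z, unfolded X] dv(3)[of z, unfolded X] by (simp only: simp_thms)
    qed
    also have "\<dots> = \<alpha> * (exp (- X z + - X z) * w z) + \<beta> * v z * (exp (X z) * exp (- X z))"
      unfolding exp_add by (simp only: ring_distribs mult_ac)
    also have "exp (X z) * exp (- X z) = 1" by (simp flip: exp_add)
    finally show "\<beta> * (v z - d) + \<alpha> * (exp (- of_real (2 * sqrt 2 / 3) * mpow (3/2) z) * w z)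
       = phi C1 C2 z * exp (2/3 * (- of_real (1 / sqrt 2)) * mpow (3/2) z) * mpow (1/4) z - \<beta> * d"
      unfolding X by (simp add: algebra_simps)
  qed
  then show ?thesis using that[of "\<beta> * d"] \<beta>0 dv(1) by simp
qed

text \<open>At n = 0 the empty determinant is 1. So the Hankel lemma covers tau_0 as well, which q_1
  requires.\<close>

lemma tau_n_eq_det: "tau_n C1 C2 n z = Determinant.det (Matrix.mat n n (\<lambda>(j, k). (deriv ^^ (j + k)) (phi C1 C2) z))"
  by (simp add: tau_n_def)

lemma eventually_sectors_finite_ball:
  "finite A \<Longrightarrow> (\<And>j. j \<in> A \<Longrightarrow> eventually_sectors \<theta>\<^sub>0 (P j)) \<Longrightarrow> eventually_sectors \<theta>\<^sub>0 (\<lambda>z. \<forall>j\<in>A. P j z)"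
  unfolding eventually_sectors_def by (auto intro: eventually_ball_finite)

lemma sigma_approx_differentiable: "- z \<notin> \<real>\<^sub>\<le>\<^sub>0 \<Longrightarrow> sigma_approx a n field_differentiable at z"
  using has_field_derivative_sigma_approx field_differentiable_def by blast

text \<open>The expansions supply the hypotheses of the determinant formula: each sigma_j is
  differentiable far out, with nonvanishing derivative if j \<ge> 1. Only finitely many j occur, so
  one radius serves them all.\<close>

lemma tau_n_toda:
  assumes th: "\<theta>\<^sub>0 \<le> pi" and a: "a \<noteq> 0"
    and nz: "eventually_sectors \<theta>\<^sub>0 (\<lambda>z. phi C1 C2 z \<noteq> 0)"
    and exp: "\<And>j. (\<lambda>z. toda_sigma (phi C1 C2) j z - sigma_approx a j z) \<in> hO \<theta>\<^sub>0 (- 4)"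
  shows "eventually_sectors \<theta>\<^sub>0 (\<lambda>z. tau_n C1 C2 n field_differentiable at z \<and> tau_n C1 C2 n z \<noteq> 0
     \<and> sigma_n C1 C2 n z = toda_sigma (phi C1 C2) n z)"
  unfolding eventually_sectors_def
proof (intro allI impI)
  fix \<theta> assume t: "\<theta> < \<theta>\<^sub>0"
  let ?u = "phi C1 C2"
  have diff: "eventually_sectors \<theta>\<^sub>0 (\<lambda>z. toda_sigma ?u j field_differentiable at z)" for j
  proof (rule eventually_sectors_elim[OF eventually_sectors_slit[OF th] hO_differentiable[OF exp[of j]]])
    fix z assume "z \<noteq> 0 \<and> - z \<notin> \<real>\<^sub>\<le>\<^sub>0"
      and "(\<lambda>z. toda_sigma ?u j z - sigma_approx a j z) field_differentiable at z"
    then show "toda_sigma ?u j field_differentiable at z"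
      using field_differentiable_add[OF _ sigma_approx_differentiable[of z a j], of "\<lambda>z. toda_sigma ?u j z - sigma_approx a j z"]
      by simp
  qed
  have "eventually_sectors \<theta>\<^sub>0 (\<lambda>z. (\<forall>j\<in>{1..Suc (2*n)}. deriv (toda_sigma ?u j) z \<noteq> 0)
      \<and> (\<forall>j\<in>{..Suc (2*n)}. toda_sigma ?u j field_differentiable at z) \<and> ?u z \<noteq> 0)"
    by (intro eventually_sectors_conj eventually_sectors_finite_ball nz diff logderiv_deriv_expansion(1)[OF th exp a]) auto
  then obtain R where R: "R > 0"
    "\<And>z j. z \<in> sector \<theta> R \<Longrightarrow> 1 \<le> j \<Longrightarrow> j \<le> Suc (2*n) \<Longrightarrow> deriv (toda_sigma ?u j) z \<noteq> 0"
    "\<And>z j. z \<in> sector \<theta> R \<Longrightarrow> j \<le> Suc (2*n) \<Longrightarrow> toda_sigma ?u j field_differentiable at z"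
    "\<And>z. z \<in> sector \<theta> R \<Longrightarrow> ?u z \<noteq> 0"
    using t by (auto simp: eventually_sectors_def eventually_sector_iff sector_def Ball_def)
  have op: "open (sector \<theta> R)" using t th R(1) by (intro open_sector) auto
  have uh: "?u holomorphic_on sector \<theta> R"
    using phi_differentiable_ode(1) by (auto simp: holomorphic_on_def intro: field_differentiable_at_within)
  have th: "toda_sigma ?u j holomorphic_on sector \<theta> R" if "j \<le> Suc (2*n)" for j
    using R(3) that by (auto simp: holomorphic_on_def intro: field_differentiable_at_within)
  have "tau_n C1 C2 n field_differentiable at z \<and> tau_n C1 C2 n z \<noteq> 0 \<and> sigma_n C1 C2 n z = toda_sigma ?u n z"
    if "z \<in> sector \<theta> R" for z
    unfolding sigma_n_def tau_n_eq_det[abs_def]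
    using hankel_det_toda[OF op uh R(4) th R(2) that] by blast
  then show "\<forall>\<^sub>F z in sector_at_infinity \<theta>. tau_n C1 C2 n field_differentiable at z \<and> tau_n C1 C2 n z \<noteq> 0
     \<and> sigma_n C1 C2 n z = toda_sigma ?u n z"
    unfolding eventually_sector_iff sector_def using R(1) by auto
qed

lemma logderiv_divide:
  assumes "f field_differentiable at z" "g field_differentiable at z" "f z \<noteq> 0" "g z \<noteq> 0"
  shows "logderiv (\<lambda>z. f z / g z) z = logderiv f z - logderiv g z"
proof -
  have "((\<lambda>z. f z / g z) has_field_derivative (deriv f z * g z - f z * deriv g z) / (g z * g z)) (at z)"
    using assms by (intro DERIV_divide field_differentiable_derivI)
  then have "deriv (\<lambda>z. f z / g z) z = (deriv f z * g z - f z * deriv g z) / (g z * g z)"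
    by (rule DERIV_imp_deriv)
  then show ?thesis using assms by (simp add: logderiv_def field_simps power2_eq_square)
qed

text \<open>p_n is -2 sigma_n', and differentiating the error improves its order to -5. q_n is
  sigma_(n-1) - sigma_n, because both determinants are nonzero far out.\<close>

lemma sigma_p_q_expansions:
  assumes th: "\<theta>\<^sub>0 \<le> pi" and a: "a ^ 2 = 1/2" and c: "c \<noteq> 0" and n: "n \<ge> 1"
    and G: "(\<lambda>z. phi C1 C2 z * exp (2/3 * a * mpow (3/2) z) * mpow (1/4) z - c) \<in> hO \<theta>\<^sub>0 (- 3/4)"
  shows "(\<lambda>z. sigma_n C1 C2 n z - sigma_approx a n z) \<in> hO \<theta>\<^sub>0 (- 4)"
    and "(\<lambda>z. p_n C1 C2 n z - (of_nat n * a * mpow (- 1/2) z - of_nat n ^ 2 / 2 * mpow (- 2) z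
       + 5 * (of_nat n * (4 * of_nat n ^ 2 + 1) / (32 * a)) * mpow (- 7/2) z)) \<in> hO \<theta>\<^sub>0 (- 5)"
    and "(\<lambda>z. q_n C1 C2 n z - (sigma_approx a (n - 1) z - sigma_approx a n z)) \<in> hO \<theta>\<^sub>0 (- 4)"
proof -
  let ?u = "phi C1 C2"
  have a0: "a \<noteq> 0" using a by auto
  note wkb = logderiv_expansion_of_wkb[OF th a c G phi_differentiable_ode]
  have toda: "(\<lambda>z. toda_sigma ?u j z - sigma_approx a j z) \<in> hO \<theta>\<^sub>0 (- 4)" for j
    by (rule toda_sigma_expansion[OF th wkb(2) a0])
  note tau = tau_n_toda[OF th a0 wkb(1) toda]
  have sigma: "(\<lambda>z. sigma_n C1 C2 j z - sigma_approx a j z) \<in> hO \<theta>\<^sub>0 (- 4)" for j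
    by (rule hO_congD[OF th toda[of j] tau[of j]]) simp
  then show "(\<lambda>z. sigma_n C1 C2 n z - sigma_approx a n z) \<in> hO \<theta>\<^sub>0 (- 4)" .
  have ev: "eventually_sectors \<theta>\<^sub>0 (\<lambda>z. (z \<noteq> 0 \<and> - z \<notin> \<real>\<^sub>\<le>\<^sub>0) \<and>
      (\<lambda>z. sigma_n C1 C2 n z - sigma_approx a n z) field_differentiable at z)"
    by (intro eventually_sectors_conj eventually_sectors_slit[OF th] hO_differentiable[OF sigma])
  have "(\<lambda>z. - 2 * deriv (\<lambda>z. sigma_n C1 C2 n z - sigma_approx a n z) z) \<in> hO \<theta>\<^sub>0 (- 5)"
    using hO_cmult[OF hO_deriv[OF th sigma[of n]], of "- 2"] by simp
  then show "(\<lambda>z. p_n C1 C2 n z - (of_nat n * a * mpow (- 1/2) z - of_nat n ^ 2 / 2 * mpow (- 2) z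
       + 5 * (of_nat n * (4 * of_nat n ^ 2 + 1) / (32 * a)) * mpow (- 7/2) z)) \<in> hO \<theta>\<^sub>0 (- 5)"
  proof (rule hO_congD[OF th _ ev])
    fix z assume z: "(z \<noteq> 0 \<and> - z \<notin> \<real>\<^sub>\<le>\<^sub>0) \<and> (\<lambda>z. sigma_n C1 C2 n z - sigma_approx a n z) field_differentiable at z"
    let ?E = "\<lambda>z. sigma_n C1 C2 n z - sigma_approx a n z"
    define k where "k = of_nat n * (4 * of_nat n ^ 2 + 1) / (32 * a)"
    have "((\<lambda>z. ?E z + sigma_approx a n z) has_field_derivative deriv ?E z +
       (- (of_nat n * a / 2) * mpow (- 1/2) z + of_nat n ^ 2 / 4 * mpow (- 2) z - 5/2 * k * mpow (- 7/2) z)) (at z)"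
      unfolding k_def using z by (intro DERIV_add field_differentiable_derivI has_field_derivative_sigma_approx) auto
    then have "(sigma_n C1 C2 n has_field_derivative deriv ?E z +
       (- (of_nat n * a / 2) * mpow (- 1/2) z + of_nat n ^ 2 / 4 * mpow (- 2) z - 5/2 * k * mpow (- 7/2) z)) (at z)"
      by simp
    then have "deriv (sigma_n C1 C2 n) z = deriv ?E z +
       (- (of_nat n * a / 2) * mpow (- 1/2) z + of_nat n ^ 2 / 4 * mpow (- 2) z - 5/2 * k * mpow (- 7/2) z)"
      by (rule DERIV_imp_deriv)
    then have p: "p_n C1 C2 n z = - 2 * (deriv ?E z +
       (- (of_nat n * a / 2) * mpow (- 1/2) z + of_nat n ^ 2 / 4 * mpow (- 2) z - 5/2 * k * mpow (- 7/2) z))"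
      by (simp only: p_n_def sigma_n_def)
    show "- 2 * deriv ?E z = p_n C1 C2 n z - (of_nat n * a * mpow (- 1/2) z - of_nat n ^ 2 / 2 * mpow (- 2) z
       + 5 * (of_nat n * (4 * of_nat n ^ 2 + 1) / (32 * a)) * mpow (- 7/2) z)"
      unfolding k_def[symmetric] p by (simp add: field_simps)
  qed
  have "(\<lambda>z. (sigma_n C1 C2 (n - 1) z - sigma_approx a (n - 1) z) - (sigma_n C1 C2 n z - sigma_approx a n z)) \<in> hO \<theta>\<^sub>0 (- 4)"
    by (intro hO_diff sigma)
  then show "(\<lambda>z. q_n C1 C2 n z - (sigma_approx a (n - 1) z - sigma_approx a n z)) \<in> hO \<theta>\<^sub>0 (- 4)"
    by (rule hO_congD[OF th _ eventually_sectors_conj[OF tau[of "n - 1"] tau[of n]]])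
       (simp add: q_n_def logderiv_divide sigma_n_def)
qed

section \<open>Return to the stated form of the expansions\<close>

lemma sector_expansion_congI:
  assumes "\<theta>\<^sub>0 \<le> pi" "(\<lambda>z. f z - g z) \<in> hO \<theta>\<^sub>0 b"
    and "\<And>z. z \<noteq> 0 \<Longrightarrow> g z = g' z" "\<And>z. mpow b z = h z"
  shows "sector_expansion \<theta>\<^sub>0 f g' h"
proof -
  have "(\<lambda>z. f z - g' z) \<in> hO \<theta>\<^sub>0 b"
    by (rule hO_congD[OF assms(1,2) eventually_sectors_slit[OF assms(1)]]) (simp add: assms(3))
  then have "sector_expansion \<theta>\<^sub>0 f g' (mpow b)" by (rule hO_imp_sector_expansion)
  also have "mpow b = h" using assms(4) by (intro ext)
  finally show ?thesis .
qed

lemma mpow_numeral: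
  shows "mpow (1/2) z = (- z) powr (1/2)" "mpow (- 1) z = - 1 / z" "mpow (- 2) z = 1 / z ^ 2"
    "mpow (- 1/2) z = 1 / (- z) powr (1/2)" "mpow (- 5/2) z = 1 / (- z) powr (5/2)" "mpow (- 7/2) z = 1 / (- z) powr (7/2)"
    "mpow (- 4) z = (- z) powr (- 4)" "mpow (- 5) z = (- z) powr (- 5)"
proof -
  show m1: "mpow (- 1) z = - 1 / z"
    by (simp add: mpow_def powr_minus_divide)
  have "mpow (- 2) z = mpow (- 1) z * mpow (- 1) z"
    by (simp add: mpow_mult)
  then show "mpow (- 2) z = 1 / z ^ 2"
    by (simp add: m1 power2_eq_square)
qed (simp_all add: mpow_def powr_minus_divide)

lemma sector_expansions_of_wkb:
  fixes s :: complex
  assumes th: "\<theta>\<^sub>0 \<le> pi" and s: "s = 1 \<or> s = - 1" and c: "c \<noteq> 0" and n: "n \<ge> 1"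
    and G: "(\<lambda>z. phi C1 C2 z * exp (2/3 * (s * of_real (1 / sqrt 2)) * mpow (3/2) z) * mpow (1/4) z - c) \<in> hO \<theta>\<^sub>0 (- 3/4)"
  shows "sector_expansion \<theta>\<^sub>0 (sigma_n C1 C2 n)
         (\<lambda>z. s * (of_nat n * (- z) powr (1/2) / of_real (sqrt 2)) - of_nat n ^ 2 / (4 * z)
              - s * (of_real (sqrt 2) * of_nat n * (4 * of_nat n ^ 2 + 1) / (32 * (- z) powr (5/2))))
         (\<lambda>z. (- z) powr (- 4))"
    and "sector_expansion \<theta>\<^sub>0 (p_n C1 C2 n)
         (\<lambda>z. s * (of_nat n / (of_real (sqrt 2) * (- z) powr (1/2))) - of_nat n ^ 2 / (2 * z ^ 2)
              + s * (5 * of_nat n * (4 * of_nat n ^ 2 + 1) * of_real (sqrt 2) / (32 * (- z) powr (7/2))))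
         (\<lambda>z. (- z) powr (- 5))"
    and "sector_expansion \<theta>\<^sub>0 (q_n C1 C2 n)
         (\<lambda>z. - s * ((- z) powr (1/2) / of_real (sqrt 2)) + (2 * of_nat n - 1) / (4 * z)
              + s * (of_real (sqrt 2) * (12 * of_nat n ^ 2 - 12 * of_nat n + 5) / (32 * (- z) powr (5/2))))
         (\<lambda>z. (- z) powr (- 4))"
proof -
  define r where "r = complex_of_real (sqrt 2)"
  have r2: "r * r = 2" by (simp add: r_def flip: of_real_mult)
  have r0: "r \<noteq> 0" using r2 by auto
  define a where "a = s * of_real (1 / sqrt 2)"
  have ss: "s * s = 1" using s by auto
  have s0: "s \<noteq> 0" using s by auto
  have ar: "a = s / r" by (simp add: a_def r_def)
  have a2: "a ^ 2 = 1/2" by (simp add: ar power2_eq_square ss r2)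
  \<comment> \<open>s^2 = 1 and r^2 = 2 give 1 / a = s r, which moves sign and root into the
    numerator.\<close>
  have ia: "x / (32 * a) = s * (r * x / 32)" for x
  proof -
    have "s * s * (r * r) = 2" by (simp add: ss r2)
    then show ?thesis using s0 r0 by (simp add: ar field_simps ss r2)
  qed
  note exps = sigma_p_q_expansions[OF th a2 c n, of C1 C2, folded a_def, OF G[folded a_def]]
  show "sector_expansion \<theta>\<^sub>0 (sigma_n C1 C2 n)
         (\<lambda>z. s * (of_nat n * (- z) powr (1/2) / of_real (sqrt 2)) - of_nat n ^ 2 / (4 * z)
              - s * (of_real (sqrt 2) * of_nat n * (4 * of_nat n ^ 2 + 1) / (32 * (- z) powr (5/2))))
         (\<lambda>z. (- z) powr (- 4))"
    by (rule sector_expansion_congI[OF th exps(1)], unfold sigma_approx_def mpow_numeral ia r_def[symmetric])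
       (simp_all add: ar divide_simps r0)
  show "sector_expansion \<theta>\<^sub>0 (p_n C1 C2 n)
         (\<lambda>z. s * (of_nat n / (of_real (sqrt 2) * (- z) powr (1/2))) - of_nat n ^ 2 / (2 * z ^ 2)
              + s * (5 * of_nat n * (4 * of_nat n ^ 2 + 1) * of_real (sqrt 2) / (32 * (- z) powr (7/2))))
         (\<lambda>z. (- z) powr (- 5))"
    by (rule sector_expansion_congI[OF th exps(2)], unfold mpow_numeral ia r_def[symmetric])
       (simp_all add: ar divide_simps r0)
  show "sector_expansion \<theta>\<^sub>0 (q_n C1 C2 n)
         (\<lambda>z. - s * ((- z) powr (1/2) / of_real (sqrt 2)) + (2 * of_nat n - 1) / (4 * z)
              + s * (of_real (sqrt 2) * (12 * of_nat n ^ 2 - 12 * of_nat n + 5) / (32 * (- z) powr (5/2))))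
         (\<lambda>z. (- z) powr (- 4))"
  proof (rule sector_expansion_congI[OF th exps(3)])
    fix z :: complex
    define m where "m = (of_nat n :: complex)"
    \<comment> \<open>n \<ge> 1 makes the truncated subtraction genuine. The last coefficient is n
      (4 n^2 + 1) - (n - 1) (4 (n - 1)^2 + 1) = 12 n^2 - 12 n + 5.\<close>
    have m1: "of_nat (n - 1) = m - 1" using n by (simp add: m_def of_nat_diff)
    assume z: "z \<noteq> 0"
    show "sigma_approx a (n - 1) z - sigma_approx a n z = - s * ((- z) powr (1/2) / of_real (sqrt 2)) + (2 * of_nat n - 1) / (4 * z)
              + s * (of_real (sqrt 2) * (12 * of_nat n ^ 2 - 12 * of_nat n + 5) / (32 * (- z) powr (5/2)))"
      unfolding sigma_approx_def mpow_numeral ia r_def[symmetric] m1 m_def[symmetric]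
      using z r0 by (simp add: ar divide_simps power2_eq_square) (simp add: algebra_simps)
  qed (simp only: mpow_numeral)
qed

theorem corollary2p4:
  fixes C1 C2 :: complex and n :: nat
  assumes "C1 \<noteq> 0 \<or> C2 \<noteq> 0" and "n \<ge> 1"
  shows
    "(C2 \<noteq> 0 \<longrightarrow>
       sector_expansion (pi / 3) (sigma_n C1 C2 n)
         (\<lambda>z. - (of_nat n * (- z) powr (1/2) / of_real (sqrt 2)) - of_nat n ^ 2 / (4 * z)
              + of_real (sqrt 2) * of_nat n * (4 * of_nat n ^ 2 + 1) / (32 * (- z) powr (5/2)))
         (\<lambda>z. (- z) powr (- 4)) \<and>
       sector_expansion (pi / 3) (p_n C1 C2 n)
         (\<lambda>z. - (of_nat n / (of_real (sqrt 2) * (- z) powr (1/2))) - of_nat n ^ 2 / (2 * z ^ 2)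
              - 5 * of_nat n * (4 * of_nat n ^ 2 + 1) * of_real (sqrt 2) / (32 * (- z) powr (7/2)))
         (\<lambda>z. (- z) powr (- 5)) \<and>
       sector_expansion (pi / 3) (q_n C1 C2 n)
         (\<lambda>z. (- z) powr (1/2) / of_real (sqrt 2) + (2 * of_nat n - 1) / (4 * z)
              - of_real (sqrt 2) * (12 * of_nat n ^ 2 - 12 * of_nat n + 5) / (32 * (- z) powr (5/2)))
         (\<lambda>z. (- z) powr (- 4)))
     \<and>
     (C2 = 0 \<longrightarrow>
       sector_expansion pi (sigma_n C1 C2 n)
         (\<lambda>z. of_nat n * (- z) powr (1/2) / of_real (sqrt 2) - of_nat n ^ 2 / (4 * z)
              - of_real (sqrt 2) * of_nat n * (4 * of_nat n ^ 2 + 1) / (32 * (- z) powr (5/2)))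
         (\<lambda>z. (- z) powr (- 4)) \<and>
       sector_expansion pi (p_n C1 C2 n)
         (\<lambda>z. of_nat n / (of_real (sqrt 2) * (- z) powr (1/2)) - of_nat n ^ 2 / (2 * z ^ 2)
              + 5 * of_nat n * (4 * of_nat n ^ 2 + 1) * of_real (sqrt 2) / (32 * (- z) powr (7/2)))
         (\<lambda>z. (- z) powr (- 5)) \<and>
       sector_expansion pi (q_n C1 C2 n)
         (\<lambda>z. - ((- z) powr (1/2) / of_real (sqrt 2)) + (2 * of_nat n - 1) / (4 * z)
              + of_real (sqrt 2) * (12 * of_nat n ^ 2 - 12 * of_nat n + 5) / (32 * (- z) powr (5/2)))
         (\<lambda>z. (- z) powr (- 4)))"
proof (intro conjI[of "_ \<longrightarrow> _"] impI)
  assume "C2 \<noteq> 0"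
  \<comment> \<open>The exponent is written as a product so as to match s = -1, the growing
    exponential.\<close>
  then obtain c where c: "c \<noteq> 0"
    "(\<lambda>z. phi C1 C2 z * exp (2/3 * (- 1 * of_real (1 / sqrt 2)) * mpow (3/2) z) * mpow (1/4) z - c) \<in> hO (pi / 3) (- 3/4)"
    using phi_wkb_dominant[of C2 C1] unfolding mult_minus1 by blast
  have "pi / 3 \<le> pi" by simp
  note exps = sector_expansions_of_wkb[OF this _ c(1) assms(2) c(2)]
  show "sector_expansion (pi / 3) (sigma_n C1 C2 n)
         (\<lambda>z. - (of_nat n * (- z) powr (1/2) / of_real (sqrt 2)) - of_nat n ^ 2 / (4 * z)
              + of_real (sqrt 2) * of_nat n * (4 * of_nat n ^ 2 + 1) / (32 * (- z) powr (5/2)))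
         (\<lambda>z. (- z) powr (- 4)) \<and>
       sector_expansion (pi / 3) (p_n C1 C2 n)
         (\<lambda>z. - (of_nat n / (of_real (sqrt 2) * (- z) powr (1/2))) - of_nat n ^ 2 / (2 * z ^ 2)
              - 5 * of_nat n * (4 * of_nat n ^ 2 + 1) * of_real (sqrt 2) / (32 * (- z) powr (7/2)))
         (\<lambda>z. (- z) powr (- 5)) \<and>
       sector_expansion (pi / 3) (q_n C1 C2 n)
         (\<lambda>z. (- z) powr (1/2) / of_real (sqrt 2) + (2 * of_nat n - 1) / (4 * z)
              - of_real (sqrt 2) * (12 * of_nat n ^ 2 - 12 * of_nat n + 5) / (32 * (- z) powr (5/2)))
         (\<lambda>z. (- z) powr (- 4))"
    using exps by (simp only: mult_minus1 minus_minus mult_1_left diff_minus_eq_add add_uminus_conv_diff simp_thms)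
next
  assume C2: "C2 = 0"
  then obtain c where c: "c \<noteq> 0"
    "(\<lambda>z. phi C1 C2 z * exp (2/3 * (1 * of_real (1 / sqrt 2)) * mpow (3/2) z) * mpow (1/4) z - c) \<in> hO pi (- 3/4)"
    using phi_wkb_recessive[of C1] assms(1) unfolding mult_1_left by blast
  note exps = sector_expansions_of_wkb[OF order_refl _ c(1) assms(2) c(2)]
  show "sector_expansion pi (sigma_n C1 C2 n)
         (\<lambda>z. of_nat n * (- z) powr (1/2) / of_real (sqrt 2) - of_nat n ^ 2 / (4 * z)
              - of_real (sqrt 2) * of_nat n * (4 * of_nat n ^ 2 + 1) / (32 * (- z) powr (5/2)))
         (\<lambda>z. (- z) powr (- 4)) \<and>
       sector_expansion pi (p_n C1 C2 n)
         (\<lambda>z. of_nat n / (of_real (sqrt 2) * (- z) powr (1/2)) - of_nat n ^ 2 / (2 * z ^ 2)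
              + 5 * of_nat n * (4 * of_nat n ^ 2 + 1) * of_real (sqrt 2) / (32 * (- z) powr (7/2)))
         (\<lambda>z. (- z) powr (- 5)) \<and>
       sector_expansion pi (q_n C1 C2 n)
         (\<lambda>z. - ((- z) powr (1/2) / of_real (sqrt 2)) + (2 * of_nat n - 1) / (4 * z)
              + of_real (sqrt 2) * (12 * of_nat n ^ 2 - 12 * of_nat n + 5) / (32 * (- z) powr (5/2)))
         (\<lambda>z. (- z) powr (- 4))"
    using exps by (simp only: mult_minus1 mult_minus_left mult_1_left simp_thms)
qed

end
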